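(* Let $n\ge 1$ and let $\mathcal{H}$ be a $J^2$-gem with $2n$ vertices, i.e. the 4-edge-colored graph obtained from two Jordan curves $X,Y$ in the plane meeting in exactly $2n$ points, all of them transversal crossings. Then the 3-manifold $|\mathcal{H}|$ induced by $\mathcal{H}$ is homeomorphic to the 3-sphere $\mathbb{S}^3$.
   Context: **$J^2$-gem.** Let $X,Y$ be two Jordan curves in the plane with $2n$ transversal crossings. The crossings cut $X$ into consecutive segments lying alternately inside $Y$ (colored 2) and outside $Y$ (colored 3), and cut $Y$ into consecutive segments lying alternately inside $X$ (colored 0) and outside $X$ (colored 1). The $J^2$-gem $\mathcal{H}$ is the 4-regular plane (multi)graph whose vertices are the $2n$ crossings and whose edges are these segments with their colors. Each vertex is incident to exactly one edge of each color $0,1,2,3$. **Induced space.** For each vertex $v$ of $\mathcal{H}$ take a tetrahedron $\nabla_v$ whose four vertices are labeled $0,1,2,3$. Its face opposite to the vertex labeled $i$ is given the color $i$. For each edge of color $i$ with ends $u,v$, glue the $i$-colored face of $\nabla_u$ to the $i$-colored face of $\nabla_v$ by the affine map matching vertices with equal labels. The resulting colored pseudo-triangulation is denoted $\mathcal{H}^\star$. The 3-manifold $|\mathcal{H}|$ induced by $\mathcal{H}$ is the resulting quotient topological space $|\mathcal{H}^\star|$. (Equivalently, in the dual description: take a 3-ball for each connected component of each subgraph formed by the edges of three colors, and paste these balls along disks bounded by the two-colored cycles.) *)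

theory Defs
  imports "HOL-Analysis.Analysis" "HOL-Homology.Homology"
begin

section \<open>Edge-coloured multigraphs and the spaces they induce\<close>

text \<open>Edges are abstract objects, so parallel edges are allowed; \<open>ends\<close> gives the set of
  end vertices of an edge. The colours that matter are 0, 1, 2, 3.\<close>

record ('v, 'e) colored_graph =
  verts :: "'v set"
  edges :: "'e set"
  ends :: "'e \<Rightarrow> 'v set"
  color :: "'e \<Rightarrow> nat"

definition quotient_topology :: "'a topology \<Rightarrow> ('a \<times> 'a) set \<Rightarrow> 'a set topology" where
  "quotient_topology T R =
     topology (\<lambda>W. W \<subseteq> topspace T // R \<and> openin T {x \<in> topspace T. R `` {x} \<in> W})"

lemma openin_quotient_topology:
  "openin (quotient_topology T R) W \<longleftrightarrow>
     W \<subseteq> topspace T // R \<and> openin T {x \<in> topspace T. R `` {x} \<in> W}"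
proof -
  have "istopology (\<lambda>W. W \<subseteq> topspace T // R \<and> openin T {x \<in> topspace T. R `` {x} \<in> W})"
    unfolding istopology_def
  proof (intro conjI allI impI)
    fix S U
    assume S: "S \<subseteq> topspace T // R \<and> openin T {x \<in> topspace T. R `` {x} \<in> S}"
      and U: "U \<subseteq> topspace T // R \<and> openin T {x \<in> topspace T. R `` {x} \<in> U}"
    show "S \<inter> U \<subseteq> topspace T // R" using S by blast
    have "{x \<in> topspace T. R `` {x} \<in> S \<inter> U} =
        {x \<in> topspace T. R `` {x} \<in> S} \<inter> {x \<in> topspace T. R `` {x} \<in> U}" by blast
    then show "openin T {x \<in> topspace T. R `` {x} \<in> S \<inter> U}" using S U by auto
  next
    fix K
    assume K: "\<forall>S\<in>K. S \<subseteq> topspace T // R \<and> openin T {x \<in> topspace T. R `` {x} \<in> S}"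
    show "\<Union>K \<subseteq> topspace T // R" using K by blast
    have "{x \<in> topspace T. R `` {x} \<in> \<Union>K} = (\<Union>S\<in>K. {x \<in> topspace T. R `` {x} \<in> S})" by blast
    then show "openin T {x \<in> topspace T. R `` {x} \<in> \<Union>K}" using K by auto
  qed
  then show ?thesis
    by (simp add: quotient_topology_def topology_inverse')
qed

lemma topspace_quotient_topology: "topspace (quotient_topology T R) = topspace T // R"
proof -
  have "{x \<in> topspace T. R `` {x} \<in> topspace T // R} = topspace T"
    by (auto simp: quotient_def)
  then have "openin (quotient_topology T R) (topspace T // R)"
    by (simp add: openin_quotient_topology)
  moreover have "topspace (quotient_topology T R) \<subseteq> topspace T // R"
    using openin_quotient_topology openin_topspace by blast
  ultimately show ?thesis
    by (simp add: openin_subset subset_antisym)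
qed

lemma quotient_map_quotient_topology:
  "quotient_map T (quotient_topology T R) (\<lambda>x. R `` {x})"
  by (auto simp: quotient_map_def topspace_quotient_topology openin_quotient_topology quotient_def)

text \<open>The disjoint union of one tetrahedron per vertex. A point of a tetrahedron is given by its
  barycentric coordinates \<open>x 0, x 1, x 2, x 3\<close>, the vertex labelled \<open>i\<close> being the one
  with \<open>x i = 1\<close>.\<close>

definition tetrahedra :: "('v, 'e) colored_graph \<Rightarrow> ('v \<times> (nat \<Rightarrow> real)) topology" where
  "tetrahedra G =
     prod_topology (discrete_topology (verts G))
       (subtopology (powertop_real UNIV) (standard_simplex 3))"

text \<open>The face of colour \<open>i\<close>, opposite to the vertex labelled \<open>i\<close>, is
  \<open>{x. x i = 0}\<close>; the affine map that matches equal labels preserves barycentric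
  coordinates.\<close>

definition glued ::
    "('v, 'e) colored_graph \<Rightarrow> 'v \<times> (nat \<Rightarrow> real) \<Rightarrow> 'v \<times> (nat \<Rightarrow> real) \<Rightarrow> bool" where
  "glued G p q \<longleftrightarrow>
     (\<exists>e\<in>edges G. \<exists>u v x. ends G e = {u, v} \<and> x \<in> standard_simplex 3 \<and> x (color G e) = 0 \<and>
        p = (u, x) \<and> q = (v, x))"

definition induced_space ::
    "('v, 'e) colored_graph \<Rightarrow> ('v \<times> (nat \<Rightarrow> real)) set topology" where
  "induced_space G = quotient_topology (tetrahedra G) {(p, q). equivclp (glued G) p q}"


section \<open>The gem of two Jordan curves\<close>

definition Jordan_curve :: "complex set \<Rightarrow> bool" where
  "Jordan_curve X \<longleftrightarrow> (\<exists>g. simple_path g \<and> pathfinish g = pathstart g \<and> path_image g = X)"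

text \<open>Jordan curves are merely continuous, so transversality is meant topologically: near the
  crossing the pair of curves looks like the pair of coordinate axes near the origin.\<close>

definition transversal_crossing :: "complex set \<Rightarrow> complex set \<Rightarrow> complex \<Rightarrow> bool" where
  "transversal_crossing X Y p \<longleftrightarrow>
     (\<exists>U h k. open U \<and> p \<in> U \<and> homeomorphism U (ball 0 1) h k \<and> h p = 0 \<and>
        h ` (X \<inter> U) = {z \<in> ball 0 1. Im z = 0} \<and>
        h ` (Y \<inter> U) = {z \<in> ball 0 1. Re z = 0})"

text \<open>A segment is represented by its relative interior, i.e. by a component of one curve minus
  the other; its ends are then the crossings in its closure.\<close>

definition J2_gem :: "complex set \<Rightarrow> complex set \<Rightarrow> (complex, complex set) colored_graph" where
  "J2_gem X Y =
     \<lparr> verts = X \<inter> Y,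
       edges = components (X - Y) \<union> components (Y - X),
       ends = (\<lambda>e. closure e \<inter> (X \<inter> Y)),
       color = (\<lambda>e. if e \<subseteq> Y then (if e \<subseteq> inside X then 0 else 1)
                   else (if e \<subseteq> inside Y then 2 else 3)) \<rparr>"

end

theory Submission
  imports Defs
begin

text \<open>The level surface \<open>x 2 + x 3 = 1 / 2\<close> cuts every tetrahedron into two halves. The
  edges of colours 2 and 3 run once around \<open>X\<close>, so the halves containing the edge \<open>01\<close> are glued
  in cyclic order to a ring of wedges around that edge, and what remains is to fold up the two
  free sides of the ring by the matchings of the crossings induced by the segments of \<open>Y\<close> inside
  and outside \<open>X\<close>. By the Jordan curve theorem for theta curves these matchings have no crossings,
  hence each folding is an iterated closing of a disc, and the result is a ball. Exchanging \<open>X\<close> and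
  \<open>Y\<close>, the other halves form a ball as well, and two balls glued along their boundaries
  are a 3-sphere.\<close>

section \<open>Folding a row of squares along a noncrossing matching\<close>

text \<open>The obstacle is that the induced space is a quotient by a generated equivalence, which
  has no manageable closed description. Injectivity of every chart is therefore stated against an
  arbitrary equivalence relation that contains the elementary gluings: equal values imply
  \<open>E\<close>. In this form it passes through the recursive construction of the foldings, and
  it applies later to very different relations: to \<open>equivclp (glued G)\<close>, and to having
  equal images under the chart of the other half. The latter shows that the two charts have the same
  fibres on the common surface. It works because gluings keep barycentric coordinates, so that every
  level of \<open>x 2 + x 3\<close> can be treated by itself. The foldings follow the recursion of
  balanced brackets: a nonempty noncrossing matching is an arch over a matching, followed by a
  matching. For the pieces to fit, every row of squares is mapped onto the same triangle, and its
  top side is always divided evenly among the squares. Two rows folded by different matchings then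
  agree along their tops, which is where the lower and the upper folding of the ring meet.\<close>

definition noncrossing_matching :: "(nat \<Rightarrow> nat) \<Rightarrow> nat \<Rightarrow> nat \<Rightarrow> bool" where
  "noncrossing_matching m i j \<longleftrightarrow>
     (\<forall>k. i \<le> k \<and> k < j \<longrightarrow> i \<le> m k \<and> m k < j \<and> m k \<noteq> k \<and> m (m k) = k) \<and>
     (\<forall>k l. i \<le> k \<and> k < l \<and> l < m k \<and> m k < j \<longrightarrow> k < m l \<and> m l < m k)"

lemma noncrossing_matchingD:
  assumes "noncrossing_matching m i j" "i \<le> k" "k < j"
  shows "i \<le> m k" "m k < j" "m k \<noteq> k" "m (m k) = k"
  using assms unfolding noncrossing_matching_def by blast+

lemma noncrossing_matching_between:
  assumes "noncrossing_matching m i j" "i \<le> k" "k < l" "l < m k" "m k < j"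
  shows "k < m l" "m l < m k"
  using assms unfolding noncrossing_matching_def by blast+

text \<open>Nesting keeps the partners of positions under an arch under that arch. With
  \<open>noncrossing_matching_after\<close> this cuts a matching into the two pieces of the
  recursion.\<close>

lemma noncrossing_matching_inner:
  assumes "noncrossing_matching m i j" "i \<le> k" "k < j" "k < m k"
  shows "noncrossing_matching m (Suc k) (m k)"
proof -
  note D = noncrossing_matchingD[OF assms(1)] and B = noncrossing_matching_between[OF assms(1)]
  have "m k < j" using D assms by blast
  then show ?thesis
    unfolding noncrossing_matching_def
    using D B[OF assms(2)] B assms(2)
    by (intro conjI allI impI) (auto simp: Suc_le_eq intro: less_imp_le dest: order.strict_trans)
qed

lemma noncrossing_matching_after:
  assumes "noncrossing_matching m i j" "i < j"
  shows "noncrossing_matching m (Suc (m i)) j"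
proof -
  note D = noncrossing_matchingD[OF assms(1)] and B = noncrossing_matching_between[OF assms(1)]
  have i: "i < m i" "m i < j" using D[of i] assms by auto
  \<comment> \<open>Otherwise \<open>m k\<close> would lie under the arch from \<open>i\<close> to
    \<open>m i\<close>, and nesting would force its partner \<open>k\<close> to lie there
    too.\<close>
  have *: "m i < m k" if "m i < k" "k < j" for k
  proof (rule ccontr)
    assume "\<not> m i < m k"
    moreover have "m k \<noteq> m i" "i \<le> m k" "m (m k) = k" using D[of k] D[of i] that i assms by auto
    ultimately have "i < m k \<longrightarrow> k < m i" using B[of i "m k"] i by auto
    then show False
      using that i \<open>i \<le> m k\<close> \<open>m (m k) = k\<close> D[of i] by (metis antisym_conv2 not_less_iff_gr_or_eq)
  qed
  show ?thesis
    unfolding noncrossing_matching_def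
  proof (intro conjI allI impI; elim conjE)
    fix k assume "Suc (m i) \<le> k" "k < j"
    then show "Suc (m i) \<le> m k" "m k < j" "m k \<noteq> k" "m (m k) = k"
      using *[of k] D[of k] i by auto
  next
    fix k l assume "Suc (m i) \<le> k" "k < l" "l < m k" "m k < j"
    then show "k < m l" "m l < m k" using B[of k l] i by auto
  qed
qed

lemma noncrossing_matching_upto:
  assumes "noncrossing_matching m i j" "i < j"
  shows "noncrossing_matching m i (Suc (m i))"
proof -
  note D = noncrossing_matchingD[OF assms(1)] and B = noncrossing_matching_between[OF assms(1)]
  have i: "i < m i" "m i < j" "m (m i) = i" using D[of i] assms by auto
  have *: "m k \<le> m i" if "i \<le> k" "k \<le> m i" for k
    using B[of i k] i that by (metis less_imp_le nat_less_le order_refl)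
  show ?thesis
    unfolding noncrossing_matching_def
  proof (intro conjI allI impI; elim conjE)
    fix k assume "i \<le> k" "k < Suc (m i)"
    then show "i \<le> m k" "m k < Suc (m i)" "m k \<noteq> k" "m (m k) = k"
      using *[of k] D[of k] i by auto
  next
    fix k l assume "i \<le> k" "k < l" "l < m k" "m k < Suc (m i)"
    then show "k < m l" "m l < m k" using B[of k l] i by auto
  qed
qed

lemma noncrossing_matching_even:
  "noncrossing_matching m i j \<Longrightarrow> i \<le> j \<Longrightarrow> even (j - i)"
proof (induction "j - i" arbitrary: i j rule: less_induct)
  case less
  show ?case
  proof (cases "i < j")
    case True
    note D = noncrossing_matchingD[OF less.prems(1), of i]
    have i: "i < m i" "m i < j" using D True by auto
    have "even (m i - Suc i)"
      using less.hyps[OF _ noncrossing_matching_inner[OF less.prems(1), of i]] i True by auto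
    moreover have "even (j - Suc (m i))"
      using less.hyps[OF _ noncrossing_matching_after[OF less.prems(1)]] i True by auto
    moreover have "j - i = (m i - Suc i) + (j - Suc (m i)) + 2" using i by auto
    ultimately show ?thesis by presburger
  qed (use less.prems in auto)
qed

text \<open>An even number of positions lies under each arch. The opposite parity of partners is
  what makes a gluing that keeps barycentric coordinates reverse the coordinate \<open>s\<close> of
  the squares.\<close>

lemma noncrossing_matching_parity:
  assumes "noncrossing_matching m i j" "i \<le> k" "k < j"
  shows "even (m k) \<longleftrightarrow> odd k"
proof -
  have *: "even (m k) \<longleftrightarrow> odd k" if "i \<le> k" "k < j" "k < m k" for k
  proof -
    have "even (m k - Suc k)"
      using noncrossing_matching_even noncrossing_matching_inner[OF assms(1) that] that(3)
      by (metis Suc_le_eq)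
    then show ?thesis using that by presburger
  qed
  note D = noncrossing_matchingD[OF assms]
  show ?thesis
    using *[of k] *[of "m k"] D assms by (metis linorder_neqE_nat)
qed

text \<open>\<open>E\<close> need not be the generated relation. Leaving it arbitrary turns "equal
  values only where the gluing demands it" into a property that can be used with relations chosen
  later.\<close>

definition seam_equivalence ::
    "(nat \<Rightarrow> nat) \<Rightarrow> nat \<Rightarrow> nat \<Rightarrow> real \<Rightarrow> (nat \<times> real \<times> real \<Rightarrow> nat \<times> real \<times> real \<Rightarrow> bool) \<Rightarrow> bool" where
  "seam_equivalence m i j r E \<longleftrightarrow> equivp E \<and>
     (\<forall>k u. i \<le> k \<and> Suc k < j \<and> 0 \<le> u \<and> u \<le> r \<longrightarrow> E (k, u, r) (Suc k, u, 0)) \<and>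
     (\<forall>k s. i \<le> k \<and> k < j \<and> 0 \<le> s \<and> s \<le> r \<longrightarrow> E (k, 0, s) (m k, 0, r - s))"

lemma seam_equivalence_mono:
  assumes "seam_equivalence m i j r E" "i \<le> i'" "j' \<le> j"
  shows "seam_equivalence m i' j' r E"
  using assms unfolding seam_equivalence_def by auto

text \<open>A fold chart maps the row of squares with left lower corners \<open>i, \<dots>, j - 1\<close>, each of side
  \<open>r\<close> and with coordinates \<open>s\<close> along the row and \<open>u\<close> across it, onto the triangle
  \<open>\<bar>a\<bar> \<le> y \<le> r\<close>, in such a way that the bottom of the row is folded up according to \<open>m\<close>.\<close>

locale fold_chart =
  fixes m :: "nat \<Rightarrow> nat" and i j :: nat and f :: "nat \<Rightarrow> real \<Rightarrow> real \<Rightarrow> real \<Rightarrow> real \<times> real"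
  assumes cont: "\<And>k. \<lbrakk>i \<le> k; k < j\<rbrakk> \<Longrightarrow> continuous_on UNIV (\<lambda>(u, s, r). f k u s r)"
    and range: "\<And>k u s r. \<lbrakk>i \<le> k; k < j; 0 \<le> u; u \<le> r; 0 \<le> s; s \<le> r\<rbrakk> \<Longrightarrow>
      \<bar>fst (f k u s r)\<bar> \<le> snd (f k u s r) \<and> snd (f k u s r) \<le> r"
    and left: "\<And>u r. \<lbrakk>0 \<le> u; u \<le> r\<rbrakk> \<Longrightarrow> f i u 0 r = (- u, u)"
    and right: "\<And>u r. \<lbrakk>0 \<le> u; u \<le> r\<rbrakk> \<Longrightarrow> f (j - 1) u r r = (u, u)"
    and top: "\<And>k s r. \<lbrakk>i \<le> k; k < j; 0 \<le> s; s \<le> r\<rbrakk> \<Longrightarrow>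
      f k r s r = ((2 * (real k - real i) * r + 2 * s) / (real j - real i) - r, r)"
    and step: "\<And>k u r. \<lbrakk>i \<le> k; Suc k < j; 0 \<le> u; u \<le> r\<rbrakk> \<Longrightarrow> f k u r r = f (Suc k) u 0 r"
    and fold: "\<And>k s r. \<lbrakk>i \<le> k; k < j; 0 \<le> s; s \<le> r\<rbrakk> \<Longrightarrow> f k 0 s r = f (m k) 0 (r - s) r"
    and onto: "\<And>a y r. \<lbrakk>\<bar>a\<bar> \<le> y; y \<le> r\<rbrakk> \<Longrightarrow>
      \<exists>k u s. i \<le> k \<and> k < j \<and> 0 \<le> u \<and> u \<le> r \<and> 0 \<le> s \<and> s \<le> r \<and> f k u s r = (a, y)"
    and seams: "\<And>E k u s k' u' s' r. \<lbrakk>seam_equivalence m i j r E;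
      i \<le> k; k < j; 0 \<le> u; u \<le> r; 0 \<le> s; s \<le> r;
      i \<le> k'; k' < j; 0 \<le> u'; u' \<le> r; 0 \<le> s'; s' \<le> r;
      f k u s r = f k' u' s' r\<rbrakk> \<Longrightarrow> E (k, u, s) (k', u', s')"

text \<open>The ray \<open>a = (2 * l - 1) * y\<close> divides the triangle. The linear maps
  \<open>T1\<close> and \<open>T2\<close> keep \<open>y\<close> and carry the whole triangle onto
  the part to the left and to the right of this ray.\<close>

lemma fold_chart_append:
  assumes f1: "fold_chart m i c f1" and f2: "fold_chart m c j f2" and ic: "i < c" and cj: "c < j"
    and m1: "\<And>k. \<lbrakk>i \<le> k; k < c\<rbrakk> \<Longrightarrow> m k < c" and m2: "\<And>k. \<lbrakk>c \<le> k; k < j\<rbrakk> \<Longrightarrow> c \<le> m k"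
  shows "\<exists>f. fold_chart m i j f"
proof -
  interpret F1: fold_chart m i c f1 by fact
  interpret F2: fold_chart m c j f2 by fact
  \<comment> \<open>The share of the left squares in the whole row, so that the top side is again
    divided evenly.\<close>
  define l where "l = (real c - real i) / (real j - real i)"
  have l: "0 < l" "l < 1" using ic cj by (auto simp: l_def field_simps)
  define T1 where "T1 = (\<lambda>(a, y). (l * a - (1 - l) * y, y :: real))"
  define T2 where "T2 = (\<lambda>(a, y). ((1 - l) * a + l * y, y :: real))"
  define f where "f = (\<lambda>k u s r. if k < c then T1 (f1 k u s r) else T2 (f2 k u s r))"
  have T1_le: "fst (T1 p) \<le> (2 * l - 1) * snd p" "- snd p \<le> fst (T1 p)" "snd (T1 p) = snd p"
    if "\<bar>fst p\<bar> \<le> snd p" for p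
  proof -
    have "l * fst p \<le> l * snd p" "l * (- snd p) \<le> l * fst p"
      using l that by - (intro mult_left_mono; linarith)+
    then show "fst (T1 p) \<le> (2 * l - 1) * snd p" "- snd p \<le> fst (T1 p)" "snd (T1 p) = snd p"
      by (auto simp: T1_def split_beta algebra_simps)
  qed
  have T2_ge: "(2 * l - 1) * snd p \<le> fst (T2 p)" "fst (T2 p) \<le> snd p" "snd (T2 p) = snd p"
    if "\<bar>fst p\<bar> \<le> snd p" for p
  proof -
    have "(1 - l) * fst p \<le> (1 - l) * snd p" "(1 - l) * (- snd p) \<le> (1 - l) * fst p"
      using l that by - (intro mult_left_mono; linarith)+
    then show "(2 * l - 1) * snd p \<le> fst (T2 p)" "fst (T2 p) \<le> snd p" "snd (T2 p) = snd p"
      by (auto simp: T2_def split_beta algebra_simps)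
  qed
  have lb: "- y \<le> (2 * l - 1) * y" "(2 * l - 1) * y \<le> y" if "0 \<le> y" for y
    using l that by (auto simp: algebra_simps mult_left_le_one_le)
  have T1_inj: "p = q" if "T1 p = T1 q" for p q
    using that l by (auto simp: T1_def split_beta prod_eq_iff)
  have T2_inj: "p = q" if "T2 p = T2 q" for p q
    using that l by (auto simp: T2_def split_beta prod_eq_iff)
  \<comment> \<open>A common value of \<open>T1\<close> and \<open>T2\<close> lies on the dividing
    ray, hence comes from the right side of the first triangle and the left side of the
    second.\<close>
  have mid: "p = (snd p, snd p)" "q = (- snd q, snd q)"
    if "T1 p = T2 q" "\<bar>fst p\<bar> \<le> snd p" "\<bar>fst q\<bar> \<le> snd q" for p q
  proof -
    have "fst (T1 p) = (2 * l - 1) * snd p" "fst (T2 q) = (2 * l - 1) * snd q"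
      using T1_le[OF that(2)] T2_ge[OF that(3)] that(1) by auto
    then have "l * fst p - (1 - l) * snd p = (2 * l - 1) * snd p"
      "(1 - l) * fst q + l * snd q = (2 * l - 1) * snd q"
      by (simp_all add: T1_def T2_def split_beta)
    moreover have "l * (fst p - snd p) = (l * fst p - (1 - l) * snd p) - (2 * l - 1) * snd p"
      "(1 - l) * (fst q + snd q) = ((1 - l) * fst q + l * snd q) - (2 * l - 1) * snd q"
      by (simp_all add: algebra_simps)
    ultimately have "l * (fst p - snd p) = 0" "(1 - l) * (fst q + snd q) = 0" by simp_all
    moreover have "l \<noteq> 0" "1 - l \<noteq> 0" using l by auto
    ultimately have "fst p - snd p = 0" "fst q + snd q = 0" by (metis mult_eq_0_iff)+
    then show "p = (snd p, snd p)" "q = (- snd q, snd q)"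
      by (auto simp: prod_eq_iff)
  qed
  have seam: "T1 (y, y) = T2 (- y, y)" for y
    by (simp add: T1_def T2_def algebra_simps)
  have "fold_chart m i j f"
  proof
    fix k assume k: "i \<le> k" "k < j"
    have "continuous_on UNIV (\<lambda>p. T1 (case p of (u, s, r) \<Rightarrow> f1 k u s r))" if "k < c"
      unfolding T1_def split_beta
      using k that by (intro continuous_intros F1.cont[unfolded split_beta])
    moreover have "continuous_on UNIV (\<lambda>p. T2 (case p of (u, s, r) \<Rightarrow> f2 k u s r))" if "\<not> k < c"
      unfolding T2_def split_beta
      using k that by (intro continuous_intros F2.cont[unfolded split_beta]) auto
    ultimately show "continuous_on UNIV (\<lambda>(u, s, r). f k u s r)"
      by (cases "k < c") (simp_all add: f_def split_beta)
  next
    fix k and u s r :: real assume *: "i \<le> k" "k < j" "0 \<le> u" "u \<le> r" "0 \<le> s" "s \<le> r"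
    show "\<bar>fst (f k u s r)\<bar> \<le> snd (f k u s r) \<and> snd (f k u s r) \<le> r"
    proof (cases "k < c")
      case True
      have p: "\<bar>fst (f1 k u s r)\<bar> \<le> snd (f1 k u s r)" "snd (f1 k u s r) \<le> r"
        using F1.range * True by auto
      then have "0 \<le> snd (f1 k u s r)" by linarith
      then show ?thesis using T1_le[OF p(1)] p lb[of "snd (f1 k u s r)"] True by (auto simp: f_def)
    next
      case False
      have p: "\<bar>fst (f2 k u s r)\<bar> \<le> snd (f2 k u s r)" "snd (f2 k u s r) \<le> r"
        using F2.range * False by auto
      then have "0 \<le> snd (f2 k u s r)" by linarith
      then show ?thesis using T2_ge[OF p(1)] p lb[of "snd (f2 k u s r)"] False by (auto simp: f_def)
    qed
  next
    fix u r :: real assume "0 \<le> u" "u \<le> r"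
    then show "f i u 0 r = (- u, u)" "f (j - 1) u r r = (u, u)"
      using F1.left[of u r] F2.right[of u r] ic cj
      by (auto simp: f_def T1_def T2_def algebra_simps)
  next
    fix k and s r :: real assume *: "i \<le> k" "k < j" "0 \<le> s" "s \<le> r"
    show "f k r s r = ((2 * (real k - real i) * r + 2 * s) / (real j - real i) - r, r)"
    proof (cases "k < c")
      case True
      have "l * ((2 * (real k - real i) * r + 2 * s) / (real c - real i) - r) - (1 - l) * r =
        (l / (real c - real i)) * (2 * (real k - real i) * r + 2 * s) - r"
        by (simp add: algebra_simps add_divide_distrib diff_divide_distrib)
      also have "l / (real c - real i) = 1 / (real j - real i)" using ic by (simp add: l_def)
      finally show ?thesis
        using True * F1.top[of k s r] by (simp add: f_def T1_def)
    next
      case False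
      have 1: "1 - l = (real j - real c) / (real j - real i)" using ic cj by (simp add: l_def field_simps)
      have "(1 - l) * ((2 * (real k - real c) * r + 2 * s) / (real j - real c) - r) + l * r =
        ((1 - l) / (real j - real c)) * (2 * (real k - real c) * r + 2 * s) + (2 * l - 1) * r"
        by (simp add: algebra_simps add_divide_distrib diff_divide_distrib)
      also have "(1 - l) / (real j - real c) = 1 / (real j - real i)" unfolding 1 using cj by simp
      also have "1 / (real j - real i) * (2 * (real k - real c) * r + 2 * s) + (2 * l - 1) * r =
         (2 * (real k - real i) * r + 2 * s) / (real j - real i) - r"
        using ic cj by (simp add: l_def divide_simps) (simp add: algebra_simps)
      finally show ?thesis
        using False * F2.top[of k s r] by (simp add: f_def T2_def)
    qed
  next
    fix k and u r :: real assume *: "i \<le> k" "Suc k < j" "0 \<le> u" "u \<le> r"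
    consider "Suc k < c" | "Suc k = c" | "c \<le> k" by linarith
    then show "f k u r r = f (Suc k) u 0 r"
    proof cases
      case 2
      then have "f1 k u r r = (u, u)" "f2 (Suc k) u 0 r = (- u, u)"
        using F1.right[of u r] F2.left[of u r] * by auto
      then show ?thesis using 2 seam by (simp add: f_def)
    qed (use * F1.step[of k u r] F2.step[of k u r] in \<open>auto simp: f_def\<close>)
  next
    fix k and s r :: real assume *: "i \<le> k" "k < j" "0 \<le> s" "s \<le> r"
    then show "f k 0 s r = f (m k) 0 (r - s) r"
      using F1.fold[of k s r] F2.fold[of k s r] m1[of k] m2[of k] by (auto simp: f_def)
  next
    fix a y r :: real assume *: "\<bar>a\<bar> \<le> y" "y \<le> r"
    show "\<exists>k u s. i \<le> k \<and> k < j \<and> 0 \<le> u \<and> u \<le> r \<and> 0 \<le> s \<and> s \<le> r \<and> f k u s r = (a, y)"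
    proof (cases "a \<le> (2 * l - 1) * y")
      case True
      have "\<bar>(a + (1 - l) * y) / l\<bar> \<le> y"
        using True * l by (auto simp: abs_le_iff field_simps)
      then obtain k u s where k: "i \<le> k \<and> k < c \<and> 0 \<le> u \<and> u \<le> r \<and> 0 \<le> s \<and> s \<le> r \<and>
          f1 k u s r = ((a + (1 - l) * y) / l, y)" using F1.onto * by blast
      then have "f k u s r = (a, y)" using l by (simp add: f_def T1_def)
      then show ?thesis using k cj by (intro exI[of _ k] exI[of _ u] exI[of _ s]) auto
    next
      case False
      have "\<bar>(a - l * y) / (1 - l)\<bar> \<le> y"
        using False * l by (auto simp: abs_le_iff field_simps)
      then obtain k u s where k: "c \<le> k \<and> k < j \<and> 0 \<le> u \<and> u \<le> r \<and> 0 \<le> s \<and> s \<le> r \<and>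
          f2 k u s r = ((a - l * y) / (1 - l), y)" using F2.onto * by blast
      then have "f k u s r = (a, y)" using l by (simp add: f_def T2_def)
      then show ?thesis using k ic by (intro exI[of _ k] exI[of _ u] exI[of _ s]) auto
    qed
  next
    fix E k k' and u s u' s' r :: real
    assume E: "seam_equivalence m i j r E"
      and p: "i \<le> k" "k < j" "0 \<le> u" "u \<le> r" "0 \<le> s" "s \<le> r"
      and q: "i \<le> k'" "k' < j" "0 \<le> u'" "u' \<le> r" "0 \<le> s'" "s' \<le> r"
      and eq: "f k u s r = f k' u' s' r"
    have E1: "seam_equivalence m i c r E" and E2: "seam_equivalence m c j r E"
      using seam_equivalence_mono[OF E] ic cj by auto
    have sym: "\<And>x y. E x y \<Longrightarrow> E y x" and trans: "\<And>x y z. E x y \<Longrightarrow> E y z \<Longrightarrow> E x z"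
      using E equivp_symp equivp_transp unfolding seam_equivalence_def by fast+
    have Estep: "E (k, u, r) (Suc k, u, 0)" if "i \<le> k" "Suc k < j" "0 \<le> u" "u \<le> r" for k u
      using E that unfolding seam_equivalence_def by auto
    \<comment> \<open>A coincidence between the two parts is traced through the side shared by the
      squares \<open>c - 1\<close> and \<open>c\<close>.\<close>
    have cross: "E (k, u, s) (k', u', s')"
      if eq: "f k u s r = f k' u' s' r" and kc: "k < c" "\<not> k' < c"
        and p: "i \<le> k" "k < j" "0 \<le> u" "u \<le> r" "0 \<le> s" "s \<le> r"
        and q: "i \<le> k'" "k' < j" "0 \<le> u'" "u' \<le> r" "0 \<le> s'" "s' \<le> r"
      for k k' u u' s s'
    proof -
      define y where "y = snd (f1 k u s r)"
      have R: "\<bar>fst (f1 k u s r)\<bar> \<le> snd (f1 k u s r)" "snd (f1 k u s r) \<le> r"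
        "\<bar>fst (f2 k' u' s' r)\<bar> \<le> snd (f2 k' u' s' r)"
        using F1.range[of k u r s] F2.range[of k' u' r s'] p q kc by auto
      have T: "T1 (f1 k u s r) = T2 (f2 k' u' s' r)" using eq kc by (simp add: f_def)
      then have "y = snd (f2 k' u' s' r)"
        using T1_le(3)[OF R(1)] T2_ge(3)[OF R(3)] by (simp add: y_def)
      then have v: "f1 k u s r = (y, y)" "f2 k' u' s' r = (- y, y)"
        using mid[OF T R(1) R(3)] by (auto simp: y_def)
      have y: "0 \<le> y" "y \<le> r" using R by (auto simp: y_def)
      have "E (k, u, s) (c - 1, y, r)"
        using F1.seams[OF E1, of k u s "c - 1" y r] F1.right[of y r] p kc v y ic by auto
      moreover have "E (c - 1, y, r) (c, y, 0)" using Estep[of "c - 1" y] y ic cj by simp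
      moreover have "E (c, y, 0) (k', u', s')"
        using F2.seams[OF E2, of c y 0 k' u' s'] F2.left[of y r] q kc v y cj by auto
      ultimately show ?thesis using trans by blast
    qed
    show "E (k, u, s) (k', u', s')"
    proof (cases "k < c"; cases "k' < c")
      assume "k < c" "k' < c"
      then show ?thesis
        using F1.seams[OF E1, of k u s k' u' s'] p q eq T1_inj by (auto simp: f_def)
    next
      assume "\<not> k < c" "\<not> k' < c"
      then show ?thesis
        using F2.seams[OF E2, of k u s k' u' s'] p q eq T2_inj by (auto simp: f_def)
    next
      assume "k < c" "\<not> k' < c"
      then show ?thesis using cross[OF eq _ _ p q] by blast
    next
      assume "\<not> k < c" "k' < c"
      then show ?thesis using sym[OF cross[OF eq[symmetric] _ _ q p]] by blast
    qed
  qed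
  then show ?thesis by blast
qed

text \<open>When the first and the last square of the row are matched, each of them is mapped to one half of
  the collar around the image of the rest of the row, which is the triangle with top side
  \<open>[- c r, c r]\<close> and bottom vertex \<open>(0, r / 2)\<close>. The left half consists of the triangle
  \<open>2 y - r \<le> - a\<close>, sheared from \<open>s + u \<le> r\<close>, and of a second triangle above it.\<close>

definition fold_strip :: "real \<Rightarrow> real \<Rightarrow> real \<Rightarrow> real \<Rightarrow> real \<times> real" where
  "fold_strip c u s r = (- u + (1 - c) * max 0 (s + u - r), min (u + s / 2) (r / 2 + u / 2))"

lemma fold_strip_cases:
  assumes "0 \<le> u" "u \<le> r" "0 \<le> s" "s \<le> r" "fold_strip c u s r = (a, y)"
  obtains "s + u \<le> r" "a = - u" "y = u + s / 2"
  | "r \<le> s + u" "u = 2 * y - r" "a = - u + (1 - c) * (s + u - r)"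
  using assms unfolding fold_strip_def by (cases "s + u \<le> r") (auto simp: max_def min_def)

lemma fold_strip_range:
  assumes "0 \<le> u" "u \<le> r" "0 \<le> s" "s \<le> r" "0 \<le> c" "c < 1" "fold_strip c u s r = (a, y)"
  shows "- y \<le> a" "a \<le> 0" "0 \<le> y" "y \<le> r"
proof -
  have "- y \<le> a \<and> a \<le> 0 \<and> 0 \<le> y \<and> y \<le> r"
    using assms(1-4,7)
  proof (cases rule: fold_strip_cases)
    case 2
    define D where "D = (1 - c) * (s + u - r)"
    have "0 \<le> D" using assms 2 by (simp add: D_def)
    moreover have "D \<le> 1 * (s + u - r)"
      unfolding D_def using assms 2 by (intro mult_right_mono) auto
    moreover have "a = - u + D" using 2 by (simp add: D_def)
    ultimately show ?thesis using assms(1-4) 2(1,2) by auto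
  qed (use assms in auto)
  then show "- y \<le> a" "a \<le> 0" "0 \<le> y" "y \<le> r" by auto
qed

text \<open>Both pieces of the map are affine and, as \<open>c < 1\<close>, injective; a coincidence
  between them is possible only on the diagonal \<open>s + u = r\<close>, where the two formulas
  agree.\<close>

lemma fold_strip_inj:
  assumes "0 \<le> u" "u \<le> r" "0 \<le> s" "s \<le> r" "0 \<le> u'" "u' \<le> r" "0 \<le> s'" "s' \<le> r" "c < 1"
    and "fold_strip c u s r = fold_strip c u' s' r"
  shows "u = u'" "s = s'"
proof -
  obtain a y where 1: "fold_strip c u s r = (a, y)" by fastforce
  then have 2: "fold_strip c u' s' r = (a, y)" using assms by simp
  have E: "x = x' \<and> t = t'" if "t + x \<le> r" "a = - x" "y = x + t / 2"
    "r \<le> t' + x'" "x' = 2 * y - r" "a = - x' + (1 - c) * (t' + x' - r)" for x t x' t'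
  proof -
    define D where "D = (1 - c) * (t' + x' - r)"
    have "0 \<le> D" using that assms by (simp add: D_def)
    moreover have "a = - x' + D" using that by (simp add: D_def)
    ultimately have z: "D = 0" "x = x'" using that(1-5) by auto
    then have "t' + x' - r = 0" using assms by (simp add: D_def)
    moreover have "t + x - r = 0" using that(3,5) z(2) by linarith
    ultimately show ?thesis using z(2) by simp
  qed
  have "u = u' \<and> s = s'"
    using assms(1-4) 1
  proof (cases rule: fold_strip_cases)
    case 1
    note one = this
    show ?thesis using assms(5-8) 2
    proof (cases rule: fold_strip_cases)
      case 1
      then show ?thesis using one by (intro conjI; linarith)
    qed (use E[OF one] in blast)
  next
    case 2
    note two = this
    show ?thesis using assms(5-8) \<open>fold_strip c u' s' r = (a, y)\<close>
    proof (cases rule: fold_strip_cases)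
      case 2
      have "(1 - c) * (s + u - r) = (1 - c) * (s' + u' - r)" using 2 two by linarith
      then have "s + u - r = s' + u' - r" using assms(9) by simp
      then show ?thesis using 2 two by simp
    qed (use E[OF _ _ _ two] in metis)
  qed
  then show "u = u'" "s = s'" by auto
qed

text \<open>The last assumption leaves out the left half of the inner triangle, without its slanted
  side, which is reserved for the rest of the row.\<close>

lemma fold_strip_onto:
  assumes "- y \<le> a" "a \<le> 0" "y \<le> r" "0 \<le> c" "c < 1" "2 * y - r \<le> - a \<or> a \<le> - c * (2 * y - r)"
  obtains u s where "0 \<le> u" "u \<le> r" "0 \<le> s" "s \<le> r" "fold_strip c u s r = (a, y)"
proof (cases "2 * y - r \<le> - a")
  case True
  \<comment> \<open>The witnesses solve \<open>a = - u\<close> and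
    \<open>y = u + s / 2\<close>.\<close>
  show ?thesis
    by (rule that[of "- a" "2 * (y + a)"])
      (use True assms in \<open>auto simp: fold_strip_def max_def min_def add_divide_distrib diff_divide_distrib\<close>)
next
  case False
  \<comment> \<open>\<open>u\<close> solves \<open>y = r / 2 + u / 2\<close>, and \<open>d\<close>
    stands for \<open>s + u - r\<close> in the formula for \<open>a\<close>.\<close>
  define u where "u = 2 * y - r"
  define d where "d = (a + u) / (1 - c)"
  have "0 \<le> d" using False assms by (auto simp: d_def u_def)
  moreover have "a \<le> - c * u" using False assms by (simp add: u_def)
  then have "a + u \<le> u * (1 - c)" by (simp add: algebra_simps)
  then have "d \<le> u" using assms unfolding d_def by (simp add: pos_divide_le_eq)
  moreover have "(1 - c) * d = a + u" using assms by (simp add: d_def)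
  ultimately show ?thesis
    by (intro that[of u "r - u + d"])
      (use False assms in \<open>auto simp: fold_strip_def max_def min_def u_def add_divide_distrib diff_divide_distrib\<close>)
qed

lemma fold_strip_left: "0 \<le> u \<Longrightarrow> u \<le> r \<Longrightarrow> fold_strip c u 0 r = (- u, u)"
  by (auto simp: fold_strip_def)

lemma fold_strip_right: "0 \<le> u \<Longrightarrow> u \<le> r \<Longrightarrow> fold_strip c u r r = (- c * u, r / 2 + u / 2)"
  by (auto simp: fold_strip_def algebra_simps min_def)

lemma fold_strip_bottom: "0 \<le> s \<Longrightarrow> s \<le> r \<Longrightarrow> fold_strip c 0 s r = (0, s / 2)"
  by (auto simp: fold_strip_def)

lemma fold_strip_top: "0 \<le> s \<Longrightarrow> s \<le> r \<Longrightarrow> fold_strip c r s r = (- r + (1 - c) * s, r)"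
  by (auto simp: fold_strip_def)

text \<open>The axis \<open>a = 0\<close> is where the strip meets its mirror image. It is reached
  from the bottom side and, if the inner triangle has shrunk to a segment of the axis
  (\<open>c = 0\<close>), also from the right side.\<close>

lemma fold_strip_eq_0:
  assumes "0 \<le> u" "u \<le> r" "0 \<le> s" "s \<le> r" "0 \<le> c" "c < 1" "fold_strip c u s r = (0, y)"
  shows "u = 0 \<and> y = s / 2 \<or> c = 0 \<and> s = r \<and> y = r / 2 + u / 2"
  using assms(1-4,7)
proof (cases rule: fold_strip_cases)
  case 2
  have "(1 - c) * (s - r) \<le> 0" "0 \<le> c * u"
    using assms by (auto intro: mult_nonneg_nonpos)
  moreover have "(1 - c) * (s - r) = c * u" using 2 by (simp add: algebra_simps)
  ultimately have "c * u = 0" "(1 - c) * (s - r) = 0" by auto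
  then have "c = 0 \<or> u = 0" "s = r" using assms by auto
  moreover have "y = r / 2 + u / 2" using 2 by (simp add: diff_divide_distrib)
  ultimately show ?thesis by auto
qed auto

text \<open>The strip touches the inner triangle only along the left side of the latter, which is
  the image of the right side of the square.\<close>

lemma fold_strip_inner:
  assumes "0 \<le> u" "u \<le> r" "0 \<le> s" "s \<le> r" "0 < c" "c < 1" "\<bar>a\<bar> \<le> y"
    and "fold_strip c u s r = (c * a, r / 2 + y / 2)"
  shows "s = r" "u = y" "a = - y"
proof -
  have ca: "c * (- y) \<le> c * a" using assms by (intro mult_left_mono) auto
  have "s = r \<and> u = y \<and> a = - y"
    using assms(1-4,8)
  proof (cases rule: fold_strip_cases)
    case 1
    then have "y \<le> u" by auto
    then have "(1 - c) * y \<le> 0" using 1 ca by (simp add: algebra_simps)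
    then have "y \<le> 0" using assms by (simp add: mult_le_0_iff)
    then have "y = 0" "a = 0" using assms by auto
    then show ?thesis using 1 assms by auto
  next
    case 2
    then have u: "u = y" by auto
    then have "0 \<le> (1 - c) * (s - r)" using ca 2 by (simp add: algebra_simps)
    then have s: "s = r" using assms by (auto simp: zero_le_mult_iff)
    then have "c * a = c * (- y)" using 2 u by (simp add: algebra_simps)
    then have "a = - y" using assms(5) by (metis less_irrefl mult_left_cancel)
    then show ?thesis using u s by auto
  qed
  then show "s = r" "u = y" "a = - y" by auto
qed

text \<open>Square \<open>i\<close> goes to the strip, square \<open>e\<close> to the mirror image
  of the strip with \<open>s\<close> reversed, and the chart of the squares between them is shrunk
  into the inner triangle. The bottom sides of \<open>i\<close> and \<open>e\<close> thus come
  together on the axis below that triangle. If \<open>Suc i = e\<close>, there is nothing between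
  and \<open>f'\<close> is arbitrary.\<close>

lemma fold_chart_wrap:
  assumes ie: "i < e" and me: "m i = e" "m e = i" and m': "noncrossing_matching m (Suc i) e"
    and f': "Suc i < e \<Longrightarrow> fold_chart m (Suc i) e f'"
  shows "\<exists>f. fold_chart m i (Suc e) f"
proof -
  \<comment> \<open>There are \<open>e - i - 1\<close> inner squares among \<open>e - i + 1\<close>,
    so this ratio divides the top side evenly. It is 0 exactly if the partners are
    neighbours.\<close>
  define c where "c = (real e - real i - 1) / (real e - real i + 1)"
  have c01: "0 \<le> c" "c < 1" using ie by (auto simp: c_def)
  have c0: "c = 0 \<longleftrightarrow> e = Suc i" using ie by (auto simp: c_def)
  have c1: "1 - c = 2 / (real e - real i + 1)" using ie by (simp add: c_def field_simps)
  define S where "S = fold_strip c"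
  define f where "f = (\<lambda>k u s r. if k = i then S u s r
    else if k = e then (- fst (S u (r - s) r), snd (S u (r - s) r))
    else (c * fst (f' k u s r), r / 2 + snd (f' k u s r) / 2))"
  have fi: "f i u s r = S u s r" for u s r by (simp add: f_def)
  have fe: "f e u s r = (- fst (S u (r - s) r), snd (S u (r - s) r))" for u s r
    using ie by (simp add: f_def)
  have fk: "f k u s r = (c * fst (f' k u s r), r / 2 + snd (f' k u s r) / 2)"
    if "i < k" "k < e" for k u s r using that by (simp add: f_def)
  have kcases: "k = i \<or> k = e \<or> (i < k \<and> k < e)" if "i \<le> k" "k < Suc e" for k
    using that by auto
  have "fold_chart m i (Suc e) f"
  proof
    fix k assume k: "i \<le> k" "k < Suc e"
    have Sc: "continuous_on UNIV (\<lambda>p. S (fst p) (g p) (snd (snd p)))"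
      if "continuous_on UNIV g" for g :: "real \<times> real \<times> real \<Rightarrow> real"
      unfolding S_def fold_strip_def by (intro continuous_intros that) auto
    from kcases[OF k] show "continuous_on UNIV (\<lambda>(u, s, r). f k u s r)"
    proof (elim disjE conjE)
      assume "k = i"
      then show ?thesis
        using Sc[of "\<lambda>p. fst (snd p)"] by (simp add: fi split_beta continuous_intros)
    next
      assume [simp]: "k = e"
      have "continuous_on UNIV (\<lambda>p. S (fst p) (snd (snd p) - fst (snd p)) (snd (snd p)) :: real \<times> real)"
        by (rule Sc) (intro continuous_intros)
      then show ?thesis
        unfolding \<open>k = e\<close> fe split_beta by (intro continuous_intros)
    next
      assume k: "i < k" "k < e"
      then interpret F: fold_chart m "Suc i" e f' using f' by auto
      show ?thesis
        unfolding fk[OF k] split_beta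
        using k by (intro continuous_intros F.cont[unfolded split_beta]) auto
    qed
  next
    fix k and u s r :: real
    assume k: "i \<le> k" "k < Suc e" and us: "0 \<le> u" "u \<le> r" "0 \<le> s" "s \<le> r"
    have S: "\<bar>fst (S u t r)\<bar> \<le> snd (S u t r) \<and> snd (S u t r) \<le> r" if "0 \<le> t" "t \<le> r" for t
      using fold_strip_range[of u r t c "fst (S u t r)" "snd (S u t r)"] us that c01
      by (auto simp: S_def)
    from kcases[OF k] show "\<bar>fst (f k u s r)\<bar> \<le> snd (f k u s r) \<and> snd (f k u s r) \<le> r"
    proof (elim disjE conjE)
      assume k: "i < k" "k < e"
      then interpret F: fold_chart m "Suc i" e f' using f' by auto
      have R: "\<bar>fst (f' k u s r)\<bar> \<le> snd (f' k u s r)" "snd (f' k u s r) \<le> r"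
        using F.range[of k u r s] k us by auto
      have "\<bar>c * fst (f' k u s r)\<bar> \<le> 1 * snd (f' k u s r)"
        unfolding abs_mult using c01 R by (intro mult_mono) auto
      then show ?thesis unfolding fk[OF k] using R by auto
    qed (use S[of s] S[of "r - s"] us in \<open>auto simp: fi fe\<close>)
  next
    fix u r :: real assume "0 \<le> u" "u \<le> r"
    then show "f i u 0 r = (- u, u)" "f (Suc e - 1) u r r = (u, u)"
      by (auto simp: fi fe S_def fold_strip_left)
  next
    fix k and s r :: real assume k: "i \<le> k" "k < Suc e" and s: "0 \<le> s" "s \<le> r"
    from kcases[OF k]
    show "f k r s r = ((2 * (real k - real i) * r + 2 * s) / (real (Suc e) - real i) - r, r)"
    proof (elim disjE conjE)
      assume [simp]: "k = i"
      have "(1 - c) * s = 2 * s / (real e - real i + 1)" unfolding c1 by simp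
      then show ?thesis
        using s by (simp add: fi S_def fold_strip_top algebra_simps)
    next
      assume [simp]: "k = e"
      have "(1 - c) * (r - s) = 2 * (r - s) / (real e - real i + 1)" unfolding c1 by simp
      moreover have "r - 2 * (r - s) / (real e - real i + 1) =
        (2 * (real e - real i) * r + 2 * s) / (real e - real i + 1) - r"
        using ie by (simp add: field_simps)
      ultimately show ?thesis
        using s ie by (simp add: fe S_def fold_strip_top algebra_simps)
    next
      assume k: "i < k" "k < e"
      then interpret F: fold_chart m "Suc i" e f' using f' by auto
      have "real i + 1 < real e" using k by linarith
      then have "c * ((2 * (real k - real (Suc i)) * r + 2 * s) / (real e - real (Suc i)) - r) =
         (2 * (real k - real i) * r + 2 * s) / (real (Suc e) - real i) - r"
        unfolding c_def by (simp add: divide_simps) (simp add: algebra_simps)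
      then show ?thesis
        unfolding fk[OF k] using F.top[of k s r] k s by simp
    qed
  next
    fix k and u r :: real assume k: "i \<le> k" "Suc k < Suc e" and u: "0 \<le> u" "u \<le> r"
    have Si: "S u r r = (- c * u, r / 2 + u / 2)" using u by (simp add: S_def fold_strip_right)
    show "f k u r r = f (Suc k) u 0 r"
    proof (cases "Suc i < e")
      case False
      then have "k = i" "Suc k = e" "c = 0" using k ie c0 by auto
      then show ?thesis using Si by (simp add: fi fe)
    next
      case True
      then interpret F: fold_chart m "Suc i" e f' using f' by auto
      consider "k = i" | "i < k" "Suc k < e" | "i < k" "Suc k = e" using k by linarith
      then show ?thesis
      proof cases
        case 1
        then show ?thesis using Si F.left[of u r] u True fk[of "Suc i"] by (simp add: fi)
      next
        case 2
        then show ?thesis using F.step[of k u r] u fk[of k] fk[of "Suc k"] by simp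
      next
        case 3
        then have "f' k u r r = (u, u)" using F.right[of u r] u by auto
        then show ?thesis using 3 Si fk[of k] by (simp add: fe)
      qed
    qed
  next
    fix k and s r :: real assume k: "i \<le> k" "k < Suc e" and s: "0 \<le> s" "s \<le> r"
    have "f i 0 t r = f e 0 (r - t) r" if "0 \<le> t" "t \<le> r" for t
      using that by (simp add: fi fe S_def fold_strip_bottom)
    moreover from this[of "r - s"] have "f e 0 s r = f i 0 (r - s) r" using s by simp
    moreover have "f k 0 s r = f (m k) 0 (r - s) r" if k: "i < k" "k < e"
    proof -
      interpret F: fold_chart m "Suc i" e f' using f' k by auto
      have "Suc i \<le> m k" "m k < e" using noncrossing_matchingD[OF m', of k] k by auto
      then show ?thesis using F.fold[of k s r] k s fk[of k] fk[of "m k"] by simp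
    qed
    ultimately show "f k 0 s r = f (m k) 0 (r - s) r" using kcases[OF k] me s by auto
  next
    fix a y r :: real assume *: "\<bar>a\<bar> \<le> y" "y \<le> r"
    \<comment> \<open>Left strip, right strip, and the inner triangle without its slanted
      sides.\<close>
    consider "a \<le> 0" "2 * y - r \<le> - a \<or> a \<le> - c * (2 * y - r)"
      | "0 \<le> a" "2 * y - r \<le> a \<or> - a \<le> - c * (2 * y - r)"
      | "\<bar>a\<bar> < c * (2 * y - r)" "0 < 2 * y - r"
      by (cases "a \<le> 0"; cases "2 * y - r \<le> \<bar>a\<bar>"; cases "c * (2 * y - r) \<le> \<bar>a\<bar>") auto
    then show "\<exists>k u s. i \<le> k \<and> k < Suc e \<and> 0 \<le> u \<and> u \<le> r \<and> 0 \<le> s \<and> s \<le> r \<and> f k u s r = (a, y)"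
    proof cases
      case 1
      obtain u s where "0 \<le> u" "u \<le> r" "0 \<le> s" "s \<le> r" "fold_strip c u s r = (a, y)"
        by (rule fold_strip_onto[of y a r c]) (use 1 * c01 in auto)
      then show ?thesis
        using ie by (intro exI[of _ i] exI[of _ u] exI[of _ s]) (auto simp: fi S_def)
    next
      case 2
      obtain u s where "0 \<le> u" "u \<le> r" "0 \<le> s" "s \<le> r" "fold_strip c u s r = (- a, y)"
        by (rule fold_strip_onto[of y "- a" r c]) (use 2 * c01 in auto)
      then show ?thesis
        using ie by (intro exI[of _ e] exI[of _ u] exI[of _ "r - s"]) (auto simp: fe S_def)
    next
      case 3
      then have "0 < c * (2 * y - r)" by linarith
      then have c: "0 < c" using 3 by (simp add: zero_less_mult_iff)
      then have "Suc i < e" using c0 ie by auto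
      then interpret F: fold_chart m "Suc i" e f' using f' by auto
      have "\<bar>a / c\<bar> \<le> 2 * y - r" using 3 c by (simp add: field_simps)
      then obtain k u s where k: "Suc i \<le> k \<and> k < e \<and> 0 \<le> u \<and> u \<le> r \<and> 0 \<le> s \<and> s \<le> r \<and>
          f' k u s r = (a / c, 2 * y - r)" using F.onto[of "a / c" "2 * y - r" r] * by auto
      then have "f k u s r = (a, y)" using c fk[of k] by (simp add: diff_divide_distrib)
      then show ?thesis using k by (intro exI[of _ k] exI[of _ u] exI[of _ s]) auto
    qed
  next
    fix E k k' and u s u' s' r :: real
    assume E: "seam_equivalence m i (Suc e) r E"
      and p: "i \<le> k" "k < Suc e" "0 \<le> u" "u \<le> r" "0 \<le> s" "s \<le> r"
      and q: "i \<le> k'" "k' < Suc e" "0 \<le> u'" "u' \<le> r" "0 \<le> s'" "s' \<le> r"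
      and eq: "f k u s r = f k' u' s' r"
    have E1: "seam_equivalence m (Suc i) e r E" using seam_equivalence_mono[OF E] by auto
    have refl: "\<And>x. E x x" and sym: "\<And>x y. E x y \<Longrightarrow> E y x"
      and trans: "\<And>x y z. E x y \<Longrightarrow> E y z \<Longrightarrow> E x z"
      using E equivp_reflp equivp_symp equivp_transp unfolding seam_equivalence_def by fast+
    have Estep: "E (k, u, r) (Suc k, u, 0)" if "i \<le> k" "Suc k \<le> e" "0 \<le> u" "u \<le> r" for k u
      using E that unfolding seam_equivalence_def by auto
    have Efold: "E (i, 0, s) (e, 0, r - s)" if "0 \<le> s" "s \<le> r" for s
      using E that ie me unfolding seam_equivalence_def by auto
    \<comment> \<open>A common value of the two strips lies on the axis. Then either both points are
      on the bottom sides, which are folded together, or \<open>c = 0\<close> and the two squares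
      are neighbours sharing a side.\<close>
    have ie_case: "E (i, u, s) (e, u', s')"
      if "f i u s r = f e u' s' r" "0 \<le> u" "u \<le> r" "0 \<le> s" "s \<le> r" "0 \<le> u'" "u' \<le> r" "0 \<le> s'" "s' \<le> r"
      for u s u' s'
    proof -
      obtain a y where S1: "S u s r = (a, y)" by fastforce
      then have S2: "S u' (r - s') r = (- a, y)" using that by (auto simp: fi fe prod_eq_iff)
      have "a \<le> 0" using fold_strip_range[of u r s c a y] that S1 c01 by (auto simp: S_def)
      moreover have "- a \<le> 0"
        using fold_strip_range[of u' r "r - s'" c "- a" y] that S2 c01 by (auto simp: S_def)
      ultimately have [simp]: "a = 0" by simp
      have c1: "u = 0 \<and> y = s / 2 \<or> c = 0 \<and> s = r \<and> y = r / 2 + u / 2"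
        using fold_strip_eq_0[of u r s c y] that S1 c01 by (auto simp: S_def)
      have c2: "u' = 0 \<and> y = (r - s') / 2 \<or> c = 0 \<and> s' = 0 \<and> y = r / 2 + u' / 2"
        using fold_strip_eq_0[of u' r "r - s'" c y] that S2 c01 by (auto simp: S_def)
      have "u = 0 \<and> u' = 0 \<and> s' = r - s \<or> c = 0 \<and> s = r \<and> s' = 0 \<and> u' = u"
        using c1 c2 that by (auto simp: diff_divide_distrib)
      then show ?thesis
        using Efold[of s] Estep[of i u] c0 that by auto
    qed
    have i_inner: "E (i, u, s) (k', u', s')"
      if "f i u s r = f k' u' s' r" "i < k'" "k' < e"
        "0 \<le> u" "u \<le> r" "0 \<le> s" "s \<le> r" "0 \<le> u'" "u' \<le> r" "0 \<le> s'" "s' \<le> r"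
      for u s k' u' s'
    proof -
      interpret F: fold_chart m "Suc i" e f' using f' that by auto
      obtain a y where v: "f' k' u' s' r = (a, y)" by fastforce
      have R: "\<bar>a\<bar> \<le> y" using F.range[of k' u' r s'] that v by auto
      have c: "0 < c" using c0 c01 that by auto
      have "S u s r = (c * a, r / 2 + y / 2)" using that v fk[of k'] by (simp add: fi)
      then have *: "s = r" "u = y" "a = - y"
        using fold_strip_inner[of u r s c a y] that c c01 R by (auto simp: S_def)
      have "E (Suc i, u, 0) (k', u', s')"
        using F.seams[OF E1, of "Suc i" u 0 k' u' s'] F.left[of u r] that v * by auto
      then show ?thesis using Estep[of i u] that * trans by force
    qed
    have e_inner: "E (k', u', s') (e, u, s)"
      if "f k' u' s' r = f e u s r" "i < k'" "k' < e"
        "0 \<le> u" "u \<le> r" "0 \<le> s" "s \<le> r" "0 \<le> u'" "u' \<le> r" "0 \<le> s'" "s' \<le> r"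
      for u s k' u' s'
    proof -
      interpret F: fold_chart m "Suc i" e f' using f' that by auto
      obtain a y where v: "f' k' u' s' r = (a, y)" by fastforce
      have R: "\<bar>a\<bar> \<le> y" using F.range[of k' u' r s'] that v by auto
      have c: "0 < c" using c0 c01 that by auto
      have "S u (r - s) r = (c * (- a), r / 2 + y / 2)"
        using that v fk[of k'] by (simp add: fe prod_eq_iff)
      then have *: "s = 0" "u = y" "a = y"
        using fold_strip_inner[of u r "r - s" c "- a" y] that c c01 R by (auto simp: S_def)
      have "E (k', u', s') (e - 1, u, r)"
        using F.seams[OF E1, of k' u' s' "e - 1" u r] F.right[of u r] that v * by auto
      moreover have "E (e - 1, u, r) (e, u, 0)" using Estep[of "e - 1" u] that by auto
      ultimately show ?thesis using * trans by blast
    qed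
    from kcases[OF p(1,2)] kcases[OF q(1,2)] show "E (k, u, s) (k', u', s')"
    proof (elim disjE conjE)
      assume "k = i" "k' = i"
      then show ?thesis
        using fold_strip_inj[of u r s u' s' c] p q eq c01 refl by (auto simp: fi S_def)
    next
      assume "k = e" "k' = e"
      then have "S u (r - s) r = S u' (r - s') r" using eq by (auto simp: fe prod_eq_iff)
      then show ?thesis
        using fold_strip_inj[of u r "r - s" u' "r - s'" c] p q \<open>k = e\<close> \<open>k' = e\<close> c01 refl
        by (auto simp: S_def)
    next
      assume k: "i < k" "k < e" "i < k'" "k' < e"
      then interpret F: fold_chart m "Suc i" e f' using f' by auto
      have "0 < c" using c0 c01 k by auto
      then have "f' k u s r = f' k' u' s' r"
        using eq fk[of k] fk[of k'] k by (auto simp: prod_eq_iff)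
      then show ?thesis using F.seams[OF E1, of k u s k' u' s'] p q k by auto
    next
      assume "k = i" "k' = e"
      then show ?thesis using ie_case[of u s u' s'] p q eq by simp
    next
      assume "k = e" "k' = i"
      then show ?thesis using sym[OF ie_case[of u' s' u s]] p q eq by simp
    next
      assume "k = i" "i < k'" "k' < e"
      then show ?thesis using i_inner[of u s k' u' s'] p q eq by simp
    next
      assume "k' = i" "i < k" "k < e"
      then show ?thesis using sym[OF i_inner[of u' s' k u s]] p q eq by simp
    next
      assume "k' = e" "i < k" "k < e"
      then show ?thesis using e_inner[of k u s u' s'] p q eq by simp
    next
      assume "k = e" "i < k'" "k' < e"
      then show ?thesis using sym[OF e_inner[of k' u' s' u s]] p q eq by simp
    qed
  qed
  then show ?thesis by blast
qed

text \<open>The square \<open>i\<close> and its partner are wrapped around what lies between them,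
  and the rest of the row is appended.\<close>

theorem fold_chart_exists:
  "noncrossing_matching m i j \<Longrightarrow> i < j \<Longrightarrow> \<exists>f. fold_chart m i j f"
proof (induction "j - i" arbitrary: i j rule: less_induct)
  case less
  note D = noncrossing_matchingD[OF less.prems(1)]
  have i: "i < m i" "m i < j" "m (m i) = i" using D[of i] less.prems by auto
  note inner = noncrossing_matching_inner[OF less.prems(1), of i]
  have "Suc i < m i \<Longrightarrow> \<exists>f. fold_chart m (Suc i) (m i) f"
    using less.hyps[OF _ inner] i by auto
  then obtain f' where "Suc i < m i \<Longrightarrow> fold_chart m (Suc i) (m i) f'" by blast
  then obtain f1 where f1: "fold_chart m i (Suc (m i)) f1"
    using fold_chart_wrap[of i "m i" m f'] inner i by auto
  show ?case
  proof (cases "Suc (m i) = j")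
    case False
    then have c: "Suc (m i) < j" using i by auto
    have after: "noncrossing_matching m (Suc (m i)) j"
      using noncrossing_matching_after less.prems by blast
    obtain f2 where f2: "fold_chart m (Suc (m i)) j f2"
      using less.hyps[OF _ after c] i by (metis diff_less_mono2 less_SucI order.strict_trans)
    show ?thesis
      using fold_chart_append[OF f1 f2 _ c] i
        noncrossing_matchingD(1)[OF after] noncrossing_matchingD(2)[OF noncrossing_matching_upto[OF less.prems]]
      by auto
  qed (use f1 in auto)
qed

section \<open>A ring of wedges folded to a ball\<close>

text \<open>Rolls the triangle up to a disc: at radius \<open>y\<close> the position
  \<open>a\<close> becomes the angle \<open>pi * a / y\<close>, so that the sides
  \<open>a = - y\<close> and \<open>a = y\<close> come together. At the apex the division by 0 is
  harmless because of the factor \<open>y\<close>.\<close>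

definition wrap :: "real \<times> real \<Rightarrow> complex" where
  "wrap p = complex_of_real (snd p) * cis (pi * fst p / snd p)"

lemma norm_wrap: "\<bar>fst p\<bar> \<le> snd p \<Longrightarrow> cmod (wrap p) = snd p"
  by (auto simp: wrap_def norm_mult)

lemma continuous_on_wrap: "continuous_on {p. \<bar>fst p\<bar> \<le> snd p} wrap"
  unfolding continuous_on_def
proof
  fix p :: "real \<times> real" assume p: "p \<in> {p. \<bar>fst p\<bar> \<le> snd p}"
  let ?F = "at p within {p. \<bar>fst p\<bar> \<le> snd p}"
  show "(wrap \<longlongrightarrow> wrap p) ?F"
  \<comment> \<open>At the apex the angle has no limit, but the modulus tends to 0.\<close>
  proof (cases "snd p = 0")
    case True
    have "((\<lambda>q. snd q) \<longlongrightarrow> snd p) ?F" by (intro tendsto_intros)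
    moreover have "\<forall>\<^sub>F q in ?F. norm (wrap q) \<le> norm (snd q)"
      by (simp add: wrap_def norm_mult)
    ultimately have "(wrap \<longlongrightarrow> 0) ?F"
      using True by (metis Lim_null_comparison tendsto_norm_zero)
    then show ?thesis using True by (simp add: wrap_def)
  next
    case False
    show ?thesis
      unfolding wrap_def using False
      by (intro tendsto_intros) auto
  qed
qed

lemma wrap_onto:
  obtains a where "\<bar>a\<bar> \<le> cmod w" "wrap (a, cmod w) = w"
proof (cases "w = 0")
  case False
  have "\<bar>Arg w\<bar> \<le> pi" using Arg_bounded[of w] by auto
  then have "\<bar>Arg w\<bar> * cmod w \<le> pi * cmod w" by (intro mult_right_mono) auto
  then have "\<bar>Arg w * cmod w / pi\<bar> \<le> cmod w" by (simp add: abs_mult field_simps)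
  moreover have "wrap (Arg w * cmod w / pi, cmod w) = w"
    using False rcis_cmod_Arg[of w] by (simp add: wrap_def rcis_def)
  ultimately show ?thesis using that by blast
qed (use that[of 0] in \<open>auto simp: wrap_def\<close>)

lemma cis_mpi: "cis (- pi) = cis pi"
  by (simp add: complex_eq_iff)

lemma cis_eq_cis_cases:
  assumes "cis x = cis y" "\<bar>x\<bar> \<le> pi" "\<bar>y\<bar> \<le> pi"
  shows "x = y \<or> x = - pi \<and> y = pi \<or> x = pi \<and> y = - pi"
proof -
  have A: "Arg (cis t) = (if t = - pi then pi else t)" if "\<bar>t\<bar> \<le> pi" for t
    using that Arg_cis[of t] Arg_cis[of pi] cis_mpi by (cases "t = - pi") (auto simp: abs_le_iff)
  have "(if x = - pi then pi else x) = (if y = - pi then pi else y)"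
    using A[OF assms(2)] A[OF assms(3)] assms(1) by simp
  then show ?thesis by (simp split: if_splits; blast)
qed

lemma wrap_inj:
  assumes "wrap (a, y) = wrap (b, y)" "\<bar>a\<bar> \<le> y" "\<bar>b\<bar> \<le> y"
  shows "a = b \<or> a = - y \<and> b = y \<or> a = y \<and> b = - y"
proof (cases "y = 0")
  case False
  then have y: "0 < y" using assms by auto
  have "cis (pi * a / y) = cis (pi * b / y)" using assms y by (simp add: wrap_def)
  moreover have "\<bar>pi * a / y\<bar> \<le> pi" "\<bar>pi * b / y\<bar> \<le> pi"
    using assms y by (auto simp: abs_mult field_simps)
  ultimately have "pi * a / y = pi * b / y \<or> pi * a / y = - pi \<and> pi * b / y = pi \<or>
      pi * a / y = pi \<and> pi * b / y = - pi"
    by (rule cis_eq_cis_cases)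
  moreover have "c = x * y / pi" if "pi * c / y = x" for c x
    using that y by auto
  ultimately show ?thesis using y by (metis minus_divide_left minus_mult_left nonzero_mult_div_cancel_left pi_neq_zero)
qed (use assms in auto)

lemma wrap_seam: "wrap (- y, y) = wrap (y, y)"
  by (cases "y = 0") (auto simp: wrap_def cis_mpi)

text \<open>The bound on \<open>v\<close> leaves room for two squares of side \<open>r\<close> to be
  folded, one at the bottom and one at the top of a block. Because \<open>r \<le> 1\<close> they do
  not overlap, and they touch only for \<open>r = 1\<close>.\<close>

definition half_coords :: "real \<Rightarrow> real \<Rightarrow> real \<Rightarrow> bool" where
  "half_coords v s r \<longleftrightarrow> 0 \<le> s \<and> s \<le> r \<and> r \<le> 1 \<and> 0 \<le> v \<and> v \<le> 4 - 2 * r"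

section \<open>Rolling up a folded row: the upper half of the double cone\<close>

locale disc_chart = fold_chart m 0 N f for m N f +
  assumes N_pos: "0 < N"
begin

lemma frame:
  assumes "k < N" "0 \<le> u" "u \<le> r" "0 \<le> s" "s \<le> r"
  shows "\<bar>fst (f k u s r)\<bar> \<le> snd (f k u s r)" "snd (f k u s r) \<le> r" "0 \<le> snd (f k u s r)"
  using range[of k u r s] assms by auto

text \<open>Only the part \<open>v \<le> r\<close> of a block is folded. Beyond it the block is a
  straight column, which is projected to the image of the top side of the square.\<close>

definition disc :: "nat \<Rightarrow> real \<Rightarrow> real \<Rightarrow> real \<Rightarrow> complex" where
  "disc k v s r = wrap (f k (min v r) s r)"

text \<open>Level \<open>r\<close> becomes the cone \<open>cmod w + h = (1 + r) / 2\<close> over the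
  disc of radius \<open>r\<close> as long as \<open>v \<le> r\<close>, and then the cylinder of
  radius \<open>r\<close>, which descends from \<open>h = (1 - r) / 2\<close> to
  \<open>h = 0\<close> at \<open>v = 2 - r\<close>.\<close>

definition height :: "nat \<Rightarrow> real \<Rightarrow> real \<Rightarrow> real \<Rightarrow> real" where
  "height k v s r = (1 + r) / 2 - snd (f k (min v r) s r) - max 0 (v - r) / 4"

lemma norm_disc:
  assumes "k < N" "0 \<le> v" "0 \<le> s" "s \<le> r"
  shows "cmod (disc k v s r) = snd (f k (min v r) s r)"
  unfolding disc_def by (rule norm_wrap, rule frame) (use assms in auto)

lemma top0:
  assumes "k < N" "0 \<le> s" "s \<le> r"
  shows "f k r s r = ((2 * real k * r + 2 * s) / real N - r, r)"
  using top[of k s r] assms by simp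

lemma disc_top:
  assumes "k < N" "0 \<le> s" "s \<le> r" "r \<le> v"
  shows "disc k v s r = wrap ((2 * real k * r + 2 * s) / real N - r, r)"
    "height k v s r = (1 - r) / 2 - (v - r) / 4" "cmod (disc k v s r) = r"
  using assms top0[of k s r] norm_disc[of k v s r]
  by (auto simp: disc_def height_def min_def max_def add_divide_distrib diff_divide_distrib)

lemma height_eq:
  assumes "k < N" "0 \<le> v" "0 \<le> s" "s \<le> r"
  shows "cmod (disc k v s r) + height k v s r = (1 + r) / 2 - max 0 (v - r) / 4"
  using norm_disc[OF assms] by (simp add: height_def)

lemma height_nonneg:
  assumes "k < N" "0 \<le> v" "v \<le> 2 - r" "0 \<le> s" "s \<le> r" "r \<le> 1"
  shows "0 \<le> height k v s r"
proof (cases "v \<le> r")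
  case True
  then show ?thesis
    using frame(2)[of k v r s] assms
    by (simp add: height_def min_absorb1 max_absorb1 add_divide_distrib)
qed (use disc_top[of k s r v] assms in \<open>simp add: diff_divide_distrib\<close>)

lemma height_boundary:
  assumes "k < N" "0 \<le> v" "v \<le> 2 - r" "0 \<le> s" "s \<le> r" "r \<le> 1"
  shows "cmod (disc k v s r) + height k v s r \<le> 1"
    "cmod (disc k v s r) + height k v s r = 1 \<longleftrightarrow> r = 1"
proof -
  have "cmod (disc k v s r) + height k v s r = (1 + r) / 2 - max 0 (v - r) / 4"
    using height_eq assms by auto
  moreover define t where "t = max 0 (v - r) / 4"
  ultimately have "cmod (disc k v s r) + height k v s r = 1 / 2 + r / 2 - t"
    by (simp add: add_divide_distrib)
  moreover have "0 \<le> t" by (simp add: t_def)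
  moreover have "t = 0" if "r = 1" using that assms by (auto simp: t_def)
  ultimately show "cmod (disc k v s r) + height k v s r \<le> 1"
    "cmod (disc k v s r) + height k v s r = 1 \<longleftrightarrow> r = 1"
    using assms(6) by auto
qed

text \<open>On the cone the second term of the maximum is \<open>r\<close>, on the cylinder the
  first. Hence the surfaces of different levels are disjoint and the level can be read off from the
  image.\<close>

lemma radius_eq:
  assumes "k < N" "0 \<le> v" "0 \<le> s" "s \<le> r"
  shows "r = max (cmod (disc k v s r)) (2 * (cmod (disc k v s r) + height k v s r) - 1)"
proof (cases "v \<le> r")
  case True
  then have "cmod (disc k v s r) \<le> r"
    using frame(2)[of k v r s] assms norm_disc[of k v s r] by simp
  then show ?thesis using True height_eq[OF assms] by (simp add: add_divide_distrib)
next
  case False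
  then show ?thesis using disc_top[of k s r v] assms by (simp add: diff_divide_distrib)
qed

lemma disc_step:
  assumes "k < N" "0 \<le> v" "0 \<le> r"
  shows "disc k v r r = disc (Suc k mod N) v 0 r" "height k v r r = height (Suc k mod N) v 0 r"
proof -
  have "wrap (f k u r r) = wrap (f (Suc k mod N) u 0 r) \<and> snd (f k u r r) = snd (f (Suc k mod N) u 0 r)"
    if "0 \<le> u" "u \<le> r" for u
  proof (cases "Suc k < N")
    case True
    then show ?thesis using step[of k u r] that by simp
  next
    case False
    then have "Suc k = N" using assms by auto
    then have "k = N - 1" "Suc k mod N = 0" by auto
    then show ?thesis using left[of u r] right[of u r] that wrap_seam[of u] by simp
  qed
  from this[of "min v r"] assms
  show "disc k v r r = disc (Suc k mod N) v 0 r" "height k v r r = height (Suc k mod N) v 0 r"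
    by (auto simp: disc_def height_def)
qed

lemma disc_fold:
  assumes "k < N" "0 \<le> s" "s \<le> r"
  shows "disc k 0 s r = disc (m k) 0 (r - s) r" "height k 0 s r = height (m k) 0 (r - s) r"
  using fold[of k s r] assms by (auto simp: disc_def height_def)

lemma top_onto:
  assumes "\<bar>a\<bar> \<le> r"
  obtains k s where "k < N" "0 \<le> s" "s \<le> r" "f k r s r = (a, r)"
proof (cases "r = 0")
  case True
  then show ?thesis using that[of 0 0] top0[of 0 0 0] N_pos assms by auto
next
  case False
  then have r: "0 < r" using assms by auto
  define x where "x = (a + r) * real N / (2 * r)"
  have "(a + r) * real N \<le> (2 * r) * real N" "0 \<le> (a + r) * real N"
    using assms by (auto intro!: mult_right_mono)
  then have x: "0 \<le> x" "x \<le> real N" using r by (auto simp: x_def pos_divide_le_eq mult.commute)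
  obtain k where k: "k < N" "real k \<le> x" "x \<le> real k + 1"
  proof (cases "x = real N")
    case True
    then show ?thesis using that[of "N - 1"] N_pos by (auto simp: of_nat_diff)
  next
    case False
    then have "nat \<lfloor>x\<rfloor> < N" using x by linarith
    then show ?thesis using that[of "nat \<lfloor>x\<rfloor>"] x by linarith
  qed
  define s where "s = (x - real k) * r"
  have s: "0 \<le> s" "s \<le> r"
    using k r mult_right_mono[of "x - real k" 1 r] by (auto simp: s_def)
  have "2 * real k * r + 2 * s = 2 * x * r" by (simp add: s_def algebra_simps)
  also have "\<dots> = (a + r) * real N" using r by (simp add: x_def)
  finally have "f k r s r = (a, r)" using top0[OF k(1) s] N_pos by simp
  then show ?thesis using that k s by blast
qed

lemma disc_onto:
  assumes "0 \<le> h" "cmod w + h \<le> 1"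
  obtains k v s r where "k < N" "half_coords v s r" "v \<le> 2 - r" "disc k v s r = w" "height k v s r = h"
proof -
  define y where "y = cmod w"
  obtain a where a: "\<bar>a\<bar> \<le> y" "wrap (a, y) = w" using wrap_onto[of w] y_def by blast
  show ?thesis
  proof (cases "y \<le> 2 * (y + h) - 1")
    case True
    \<comment> \<open>The point lies on a cone, and \<open>r\<close> solves
      \<open>cmod w + h = (1 + r) / 2\<close>.\<close>
    define r where "r = 2 * (y + h) - 1"
    obtain k u s where k: "k < N" "0 \<le> u" "u \<le> r" "0 \<le> s" "s \<le> r" "f k u s r = (a, y)"
      using onto[of a y r] a True r_def by auto
    have "r \<le> 1" using assms by (simp add: r_def y_def)
    then show ?thesis
      using k a by (intro that[of k u s r]) (auto simp: half_coords_def disc_def height_def r_def add_divide_distrib)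
  next
    case False
    have y: "0 \<le> y" "y \<le> 1" using assms by (auto simp: y_def)
    obtain k s where k: "k < N" "0 \<le> s" "s \<le> y" "f k y s y = (a, y)"
      using top_onto a by blast
    \<comment> \<open>The point lies on the cylinder of radius \<open>y\<close>, and
      \<open>v\<close> solves \<open>h = (1 - y) / 2 - (v - y) / 4\<close>.\<close>
    define v where "v = 2 - y - 4 * h"
    have v: "y \<le> v" "v \<le> 2 - y" using False assms by (auto simp: v_def)
    have "disc k v s y = w"
      using disc_top(1)[of k s y v] top0[of k s y] k a v by simp
    moreover have "height k v s y = h"
      using disc_top(2)[of k s y v] k v by (simp add: v_def diff_divide_distrib)
    ultimately show ?thesis
      using k y v by (intro that[of k v s y]) (auto simp: half_coords_def)
  qed
qed

text \<open>Rolling up adds only the coincidence of the two slanted sides of the triangle;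
  \<open>cyc\<close> accounts for it by joining the last square to the first.\<close>

lemma wrap_seams:
  assumes E: "seam_equivalence m 0 N r E"
    and cyc: "\<And>u. \<lbrakk>0 \<le> u; u \<le> r\<rbrakk> \<Longrightarrow> E (N - 1, u, r) (0, u, 0)"
    and k: "k < N" "0 \<le> u" "u \<le> r" "0 \<le> s" "s \<le> r"
    and k': "k' < N" "0 \<le> u'" "u' \<le> r" "0 \<le> s'" "s' \<le> r"
    and eq: "wrap (f k u s r) = wrap (f k' u' s' r)"
  shows "E (k, u, s) (k', u', s')"
proof -
  have sym: "\<And>x y. E x y \<Longrightarrow> E y x" and trans: "\<And>x y z. E x y \<Longrightarrow> E y z \<Longrightarrow> E x z"
    using E equivp_symp equivp_transp unfolding seam_equivalence_def by fast+
  obtain a y where v: "f k u s r = (a, y)" by fastforce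
  obtain b z where v': "f k' u' s' r = (b, z)" by fastforce
  have R: "\<bar>a\<bar> \<le> y" "y \<le> r" "0 \<le> y" "\<bar>b\<bar> \<le> z"
    using frame[OF k] frame[OF k'] v v' by auto
  have z: "z = y" using norm_wrap[of "(a, y)"] norm_wrap[of "(b, z)"] R eq v v' by auto
  have ends: "E (k, u, s) (k', u', s')"
    if "f k u s r = (- y, y)" "f k' u' s' r = (y, y)"
      "k < N" "0 \<le> u" "u \<le> r" "0 \<le> s" "s \<le> r" "k' < N" "0 \<le> u'" "u' \<le> r" "0 \<le> s'" "s' \<le> r"
    for k u s k' u' s'
  proof -
    have "E (k, u, s) (0, y, 0)"
      by (rule seams[OF E]) (use that left[of y r] R N_pos in auto)
    moreover have "E (N - 1, y, r) (k', u', s')"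
      by (rule seams[OF E]) (use that right[of y r] R N_pos in auto)
    ultimately show ?thesis using cyc[of y] R sym trans by blast
  qed
  have "a = b \<or> a = - y \<and> b = y \<or> a = y \<and> b = - y"
    using wrap_inj[of a y b] eq v v' z R by auto
  then show ?thesis
  proof (elim disjE conjE)
    assume "a = b"
    then show ?thesis using seams[OF E, of k u s k' u' s'] k k' v v' z by simp
  next
    assume "a = - y" "b = y"
    then show ?thesis using ends[of k u s k' u' s'] k k' v v' z by simp
  next
    assume "a = y" "b = - y"
    then show ?thesis using sym[OF ends[of k' u' s' k u s]] k k' v v' z by simp
  qed
qed

lemma disc_seams:
  assumes E: "equivp E"
    and step: "\<And>k v. \<lbrakk>k < N; 0 \<le> v; v \<le> 2 - r\<rbrakk> \<Longrightarrow> E (k, v, r) (Suc k mod N, v, 0)"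
    and fold: "\<And>k s. \<lbrakk>k < N; 0 \<le> s; s \<le> r\<rbrakk> \<Longrightarrow> E (k, 0, s) (m k, 0, r - s)"
    and k: "k < N" "0 \<le> v" "v \<le> 2 - r" "0 \<le> s" "s \<le> r"
    and k': "k' < N" "0 \<le> v'" "v' \<le> 2 - r" "0 \<le> s'" "s' \<le> r"
    and r: "r \<le> 1"
    and eq: "disc k v s r = disc k' v' s' r" "height k v s r = height k' v' s' r"
  shows "E (k, v, s) (k', v', s')"
proof -
  have refl: "\<And>x. E x x" and sym: "\<And>x y. E x y \<Longrightarrow> E y x"
    and trans: "\<And>x y z. E x y \<Longrightarrow> E y z \<Longrightarrow> E x z"
    using E equivp_reflp equivp_symp equivp_transp by fast+
  have r0: "0 \<le> r" using k by auto
  \<comment> \<open>On a fixed level, \<open>cmod w + h\<close> determines by how much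
    \<open>v\<close> exceeds \<open>r\<close>; so both points lie on the cone or both on the
    cylinder at the same height.\<close>
  have vv: "max 0 (v - r) = max 0 (v' - r)"
    using height_eq[of k v s r] height_eq[of k' v' s' r] k k' eq by auto
  show ?thesis
  proof (cases "v \<le> r")
    case True
    then have v': "v' \<le> r" using vv by auto
    have "E (k, u, r) (Suc k, u, 0)" if "Suc k < N" "0 \<le> u" "u \<le> r" for k u
      using step[of k u] that r by simp
    then have S: "seam_equivalence m 0 N r E"
      unfolding seam_equivalence_def using E fold by auto
    have "E (N - 1, u, r) (0, u, 0)" if "0 \<le> u" "u \<le> r" for u
      using step[of "N - 1" u] that r N_pos by simp
    then show ?thesis
      by (rule wrap_seams[OF S]) (use k k' True v' eq in \<open>auto simp: disc_def min_def\<close>)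
  next
    case False
    then have v': "v' = v" "r < v" using vv by auto
    show ?thesis
    proof (cases "r = 0")
      case True
      \<comment> \<open>On level 0 each block is a mere segment, and the steps along the row
        identify all these segments.\<close>
      have "E (k, v, 0) (0, v, 0)" if "k < N" for k
        using that
      proof (induction k)
        case (Suc k)
        then have "E (k, v, 0) (Suc k, v, 0)" using step[of k v] True k by simp
        then show ?case using Suc sym trans by (meson Suc_lessD)
      qed (rule refl)
      then have "E (k, v, 0) (0, v, 0)" "E (k', v, 0) (0, v, 0)" using k k' by auto
      moreover have "s = 0" "s' = 0" using True k k' by auto
      ultimately show ?thesis using v' sym trans by blast
    next
      case False
      \<comment> \<open>On the cylinder only the top side of the square is visible. \<open>F\<close>
        is a relation on the squares that reads \<open>E\<close> at height \<open>v\<close> on the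
        top side and at height 0 elsewhere, so that the folding statement can be applied at
        \<open>u = r\<close>.\<close>
      define F where "F = (\<lambda>p q. E (fst p, if fst (snd p) = r then v else 0, snd (snd p))
        (fst q, if fst (snd q) = r then v else 0, snd (snd q)))"
      have "equivp F"
        unfolding F_def by (intro equivpI reflpI sympI transpI) (use refl sym trans in blast)+
      moreover have "F (k, u, r) (Suc k, u, 0)" if "Suc k < N" for k u
        using step[of k v] step[of k 0] that k r by (auto simp: F_def)
      moreover have "F (k, 0, s) (m k, 0, r - s)" if "k < N" "0 \<le> s" "s \<le> r" for k s
        using fold[of k s] that False by (auto simp: F_def)
      ultimately have S: "seam_equivalence m 0 N r F"
        unfolding seam_equivalence_def by auto
      have "F (N - 1, u, r) (0, u, 0)" for u
        using step[of "N - 1" v] step[of "N - 1" 0] N_pos k r by (auto simp: F_def)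
      then have "F (k, r, s) (k', r, s')"
        by (rule wrap_seams[OF S]) (use k k' r0 v' eq in \<open>auto simp: disc_def min_def\<close>)
      then show ?thesis using v' by (simp add: F_def)
    qed
  qed
qed

lemma disc_cont:
  assumes "k < N" "D \<subseteq> {(v, s, r). 0 \<le> v \<and> 0 \<le> s \<and> s \<le> r}"
  shows "continuous_on D (\<lambda>(v, s, r). disc k v s r)" "continuous_on D (\<lambda>(v, s, r). height k v s r)"
proof -
  have "continuous_on D ((\<lambda>(u, s, r). f k u s r) \<circ> (\<lambda>p. (min (fst p) (snd (snd p)), fst (snd p), snd (snd p))))"
    by (rule continuous_on_compose[OF _ continuous_on_subset[OF cont]])
       (use assms in \<open>auto intro!: continuous_intros\<close>)
  then have *: "continuous_on D (\<lambda>(v, s, r). f k (min v r) s r)"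
    by (simp add: o_def split_beta)
  then show "continuous_on D (\<lambda>(v, s, r). height k v s r)"
    unfolding height_def split_beta by (intro continuous_intros) auto
  have img: "(\<lambda>(v, s, r). f k (min v r) s r) ` D \<subseteq> {p. \<bar>fst p\<bar> \<le> snd p}"
  proof (rule image_subsetI)
    fix p assume "p \<in> D"
    then obtain v s r where p: "p = (v, s, r)" "0 \<le> v" "0 \<le> s" "s \<le> r" using assms(2) by auto
    then show "(case p of (v, s, r) \<Rightarrow> f k (min v r) s r) \<in> {p. \<bar>fst p\<bar> \<le> snd p}"
      using frame(1)[of k "min v r" r s] assms(1) by auto
  qed
  show "continuous_on D (\<lambda>(v, s, r). disc k v s r)"
    using continuous_on_compose2[OF continuous_on_wrap * img] by (simp add: disc_def split_beta)
qed

end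

text \<open>One level \<open>r\<close> is kept fixed: the identifications never change it, and the
  two halves of the tetrahedra are later compared on the level \<open>r = 1\<close> alone.\<close>

definition ball_seams ::
    "(nat \<Rightarrow> nat) \<Rightarrow> (nat \<Rightarrow> nat) \<Rightarrow> nat \<Rightarrow> real \<Rightarrow>
      (nat \<times> real \<times> real \<Rightarrow> nat \<times> real \<times> real \<Rightarrow> bool) \<Rightarrow> bool" where
  "ball_seams m m' N r E \<longleftrightarrow> equivp E \<and>
     (\<forall>k v. k < N \<and> 0 \<le> v \<and> v \<le> 4 - 2 * r \<longrightarrow> E (k, v, r) (Suc k mod N, v, 0)) \<and>
     (\<forall>k s. k < N \<and> 0 \<le> s \<and> s \<le> r \<longrightarrow> E (k, 0, s) (m k, 0, r - s)) \<and>
     (\<forall>k s. k < N \<and> 0 \<le> s \<and> s \<le> r \<longrightarrow> E (k, 4 - 2 * r, s) (m' k, 4 - 2 * r, r - s))"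

text \<open>A ball chart assembles, for \<open>k < N\<close>, the blocks \<open>half_coords\<close> into the ball
  \<open>cmod w + \<bar>h\<bar> \<le> 1\<close>: consecutive blocks share a side, while the bottom and the top of the ring of
  blocks are folded up according to the matchings \<open>m\<close> and \<open>m'\<close>. The parameter \<open>r\<close> is \<open>1\<close> exactly on
  the boundary sphere.\<close>

locale ball_chart =
  fixes m m' :: "nat \<Rightarrow> nat" and N :: nat and H :: "nat \<Rightarrow> real \<Rightarrow> real \<Rightarrow> real \<Rightarrow> complex \<times> real"
  assumes ball_cont: "\<And>k. k < N \<Longrightarrow>
      continuous_on {(v, s, r). half_coords v s r} (\<lambda>(v, s, r). H k v s r)"
    and ball_range: "\<And>k v s r. \<lbrakk>k < N; half_coords v s r\<rbrakk> \<Longrightarrow>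
      cmod (fst (H k v s r)) + \<bar>snd (H k v s r)\<bar> \<le> 1"
    and ball_boundary: "\<And>k v s r. \<lbrakk>k < N; half_coords v s r\<rbrakk> \<Longrightarrow>
      cmod (fst (H k v s r)) + \<bar>snd (H k v s r)\<bar> = 1 \<longleftrightarrow> r = 1"
    and ball_step: "\<And>k v r. \<lbrakk>k < N; half_coords v r r\<rbrakk> \<Longrightarrow> H k v r r = H (Suc k mod N) v 0 r"
    and ball_low: "\<And>k s r. \<lbrakk>k < N; half_coords 0 s r\<rbrakk> \<Longrightarrow> H k 0 s r = H (m k) 0 (r - s) r"
    and ball_high: "\<And>k s r. \<lbrakk>k < N; half_coords (4 - 2 * r) s r\<rbrakk> \<Longrightarrow>
      H k (4 - 2 * r) s r = H (m' k) (4 - 2 * r) (r - s) r"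
    and ball_onto: "\<And>w h. cmod w + \<bar>h\<bar> \<le> 1 \<Longrightarrow>
      \<exists>k v s r. k < N \<and> half_coords v s r \<and> H k v s r = (w, h)"
    and ball_radius: "\<And>k v s r k' v' s' r'. \<lbrakk>k < N; half_coords v s r; k' < N; half_coords v' s' r';
      H k v s r = H k' v' s' r'\<rbrakk> \<Longrightarrow> r = r'"
    and ball_inj: "\<And>k v s r k' v' s' E. \<lbrakk>k < N; half_coords v s r; k' < N; half_coords v' s' r;
      H k v s r = H k' v' s' r; ball_seams m m' N r E\<rbrakk> \<Longrightarrow> E (k, v, s) (k', v', s')"

text \<open>The blocks are cut at \<open>v = 2 - r\<close>. The lower parts, folded by
  \<open>m\<close>, fill the half \<open>0 \<le> h\<close>; the upper parts, turned over by
  replacing \<open>v\<close> with \<open>4 - 2 * r - v\<close> and folded by \<open>m'\<close>, fill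
  the half \<open>h \<le> 0\<close>.\<close>

theorem ball_chart_exists:
  assumes m: "noncrossing_matching m 0 N" and m': "noncrossing_matching m' 0 N" and N: "0 < N"
  shows "\<exists>H. ball_chart m m' N H"
proof -
  obtain f where "fold_chart m 0 N f" using fold_chart_exists[OF m N] by blast
  then interpret F: disc_chart m N f by (simp add: disc_chart_def disc_chart_axioms_def N)
  obtain g where "fold_chart m' 0 N g" using fold_chart_exists[OF m' N] by blast
  then interpret G: disc_chart m' N g by (simp add: disc_chart_def disc_chart_axioms_def N)
  define H where "H = (\<lambda>k v s r. if v + r \<le> 2 then (F.disc k v s r, F.height k v s r)
    else (G.disc k (4 - 2 * r - v) s r, - G.height k (4 - 2 * r - v) s r))"
  have low: "H k v s r = (F.disc k v s r, F.height k v s r)" if "v + r \<le> 2" for k v s r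
    using that by (simp add: H_def)
  \<comment> \<open>On the cut both charts show only the top side of the folded row, whose
    parametrisation does not depend on the matching. This is why the two halves fit.\<close>
  have mid: "(F.disc k (2 - r) s r, F.height k (2 - r) s r) = (G.disc k (2 - r) s r, - G.height k (2 - r) s r)"
    "F.height k (2 - r) s r = 0" "cmod (F.disc k (2 - r) s r) = r"
    if "k < N" "0 \<le> s" "s \<le> r" "r \<le> 1" for k s r
    using that F.disc_top[of k s r "2 - r"] G.disc_top[of k s r "2 - r"] by (auto simp: diff_divide_distrib)
  have high: "H k v s r = (G.disc k (4 - 2 * r - v) s r, - G.height k (4 - 2 * r - v) s r)"
    if "2 \<le> v + r" "k < N" "0 \<le> s" "s \<le> r" "r \<le> 1" for k v s r
  proof (cases "v + r = 2")
    case True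
    then have v: "v = 2 - r" "4 - 2 * r - v = 2 - r" by auto
    show ?thesis unfolding v(2) using low[of v r k s] mid(1)[OF that(2-5)] True v(1) by simp
  qed (use that in \<open>simp add: H_def\<close>)
  have mk: "m k < N" "m' k < N" if "k < N" for k
    using noncrossing_matchingD[OF m, of k] noncrossing_matchingD[OF m', of k] that by auto
  have norms: "cmod (fst (H k v s r)) + \<bar>snd (H k v s r)\<bar> \<le> 1"
    "cmod (fst (H k v s r)) + \<bar>snd (H k v s r)\<bar> = 1 \<longleftrightarrow> r = 1"
    "r = max (cmod (fst (H k v s r))) (2 * (cmod (fst (H k v s r)) + \<bar>snd (H k v s r)\<bar>) - 1)"
    "v + r \<le> 2 \<Longrightarrow> 0 \<le> snd (H k v s r)" "2 \<le> v + r \<Longrightarrow> snd (H k v s r) \<le> 0"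
    if k: "k < N" and c: "half_coords v s r" for k v s r
  proof -
    note c' = c[unfolded half_coords_def]
    have "cmod (fst (H k v s r)) + \<bar>snd (H k v s r)\<bar> \<le> 1 \<and>
      (cmod (fst (H k v s r)) + \<bar>snd (H k v s r)\<bar> = 1 \<longleftrightarrow> r = 1) \<and>
      r = max (cmod (fst (H k v s r))) (2 * (cmod (fst (H k v s r)) + \<bar>snd (H k v s r)\<bar>) - 1) \<and>
      (v + r \<le> 2 \<longrightarrow> 0 \<le> snd (H k v s r)) \<and> (2 \<le> v + r \<longrightarrow> snd (H k v s r) \<le> 0)"
    proof (cases "v + r \<le> 2")
      case True
      note lo = low[OF this, of k s]
      have hp: "0 \<le> F.height k v s r" using F.height_nonneg[of k v r s] k c' True by auto
      have "F.height k v s r \<le> 0" if "2 \<le> v + r"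
      proof -
        have "v = 2 - r" using True that by simp
        then show ?thesis using mid(2)[of k s r] k c' by simp
      qed
      then show ?thesis
        using hp F.height_boundary[of k v r s] F.radius_eq[of k v s r] k c' True
        unfolding lo fst_conv snd_conv abs_of_nonneg[OF hp] by auto
    next
      case False
      have hi: "H k v s r = (G.disc k (4 - 2 * r - v) s r, - G.height k (4 - 2 * r - v) s r)"
        using high[of v r k s] k c' False by auto
      have hp: "0 \<le> G.height k (4 - 2 * r - v) s r"
        using G.height_nonneg[of k "4 - 2 * r - v" r s] k c' False by auto
      show ?thesis
        using hp G.height_boundary[of k "4 - 2 * r - v" r s] G.radius_eq[of k "4 - 2 * r - v" s r] k c' False
        unfolding hi fst_conv snd_conv abs_minus_cancel abs_of_nonneg[OF hp] by auto
    qed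
    then show "cmod (fst (H k v s r)) + \<bar>snd (H k v s r)\<bar> \<le> 1"
      "cmod (fst (H k v s r)) + \<bar>snd (H k v s r)\<bar> = 1 \<longleftrightarrow> r = 1"
      "r = max (cmod (fst (H k v s r))) (2 * (cmod (fst (H k v s r)) + \<bar>snd (H k v s r)\<bar>) - 1)"
      "v + r \<le> 2 \<Longrightarrow> 0 \<le> snd (H k v s r)" "2 \<le> v + r \<Longrightarrow> snd (H k v s r) \<le> 0"
      by blast+
  qed
  have "ball_chart m m' N H"
  proof
    fix k assume k: "k < N"
    let ?D = "{(v, s, r). half_coords v s r}"
    have c1: "continuous_on {p \<in> ?D. fst p + snd (snd p) \<le> 2}
        (\<lambda>p. (F.disc k (fst p) (fst (snd p)) (snd (snd p)), F.height k (fst p) (fst (snd p)) (snd (snd p))))"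
      using F.disc_cont[OF k, of "{p \<in> ?D. fst p + snd (snd p) \<le> 2}"]
      unfolding split_beta by (intro continuous_on_Pair) (auto simp: half_coords_def)
    have img: "(\<lambda>p. (4 - 2 * snd (snd p) - fst p, snd p)) ` {p \<in> ?D. 2 \<le> fst p + snd (snd p)} \<subseteq>
        {(v, s, r). 0 \<le> v \<and> 0 \<le> s \<and> s \<le> r}"
      by (auto simp: half_coords_def)
    have "continuous_on {p \<in> ?D. 2 \<le> fst p + snd (snd p)}
        ((\<lambda>(v, s, r). G.disc k v s r) \<circ> (\<lambda>p. (4 - 2 * snd (snd p) - fst p, snd p)))"
      by (intro continuous_on_compose G.disc_cont[OF k] img) (intro continuous_intros)
    moreover have "continuous_on {p \<in> ?D. 2 \<le> fst p + snd (snd p)}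
        ((\<lambda>(v, s, r). G.height k v s r) \<circ> (\<lambda>p. (4 - 2 * snd (snd p) - fst p, snd p)))"
      by (intro continuous_on_compose G.disc_cont[OF k] img) (intro continuous_intros)
    ultimately have c2: "continuous_on {p \<in> ?D. 2 \<le> fst p + snd (snd p)}
        (\<lambda>p. (G.disc k (4 - 2 * snd (snd p) - fst p) (fst (snd p)) (snd (snd p)),
          - G.height k (4 - 2 * snd (snd p) - fst p) (fst (snd p)) (snd (snd p))))"
      unfolding split_beta o_def by (intro continuous_on_Pair continuous_on_minus) simp_all
    have "continuous_on ?D (\<lambda>p. if fst p + snd (snd p) \<le> 2
        then (F.disc k (fst p) (fst (snd p)) (snd (snd p)), F.height k (fst p) (fst (snd p)) (snd (snd p)))
        else (G.disc k (4 - 2 * snd (snd p) - fst p) (fst (snd p)) (snd (snd p)),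
          - G.height k (4 - 2 * snd (snd p) - fst p) (fst (snd p)) (snd (snd p))))"
    proof (rule continuous_on_cases_le[OF c1 c2])
      fix p assume p: "p \<in> ?D" "fst p + snd (snd p) = 2"
      then have v: "fst p = 2 - snd (snd p)" "4 - 2 * snd (snd p) - fst p = 2 - snd (snd p)" by auto
      show "(F.disc k (fst p) (fst (snd p)) (snd (snd p)), F.height k (fst p) (fst (snd p)) (snd (snd p))) =
        (G.disc k (4 - 2 * snd (snd p) - fst p) (fst (snd p)) (snd (snd p)),
          - G.height k (4 - 2 * snd (snd p) - fst p) (fst (snd p)) (snd (snd p)))"
        unfolding v using mid(1)[of k "fst (snd p)" "snd (snd p)"] p k by (auto simp: half_coords_def)
    qed (intro continuous_intros)
    then show "continuous_on ?D (\<lambda>(v, s, r). H k v s r)" by (simp add: H_def split_beta)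
  next
    fix k v s r assume "k < N" "half_coords v s r"
    then show "cmod (fst (H k v s r)) + \<bar>snd (H k v s r)\<bar> \<le> 1"
      "cmod (fst (H k v s r)) + \<bar>snd (H k v s r)\<bar> = 1 \<longleftrightarrow> r = 1"
      using norms by blast+
  next
    fix k v r assume k: "k < N" "half_coords v r r"
    then show "H k v r r = H (Suc k mod N) v 0 r"
      using F.disc_step[of k v r] G.disc_step[of k "4 - 2 * r - v" r]
      by (auto simp: H_def half_coords_def)
  next
    fix k s r assume "k < N" "half_coords 0 s r"
    then show "H k 0 s r = H (m k) 0 (r - s) r"
      using F.disc_fold[of k s r] by (auto simp: low half_coords_def)
  next
    fix k s r assume *: "k < N" "half_coords (4 - 2 * r) s r"
    then have c: "0 \<le> s" "s \<le> r" "r \<le> 1" by (auto simp: half_coords_def)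
    then show "H k (4 - 2 * r) s r = H (m' k) (4 - 2 * r) (r - s) r"
      using G.disc_fold[of k s r] high[of "4 - 2 * r" r k s] high[of "4 - 2 * r" r "m' k" "r - s"] mk[of k] *
      by auto
  next
    fix w h assume wh: "cmod w + \<bar>h\<bar> \<le> 1"
    show "\<exists>k v s r. k < N \<and> half_coords v s r \<and> H k v s r = (w, h)"
    proof (cases "0 \<le> h")
      case True
      then have "0 \<le> h" "cmod w + h \<le> 1" using wh by auto
      then obtain k v s r where "k < N" "half_coords v s r" "v \<le> 2 - r" "F.disc k v s r = w" "F.height k v s r = h"
        by (rule F.disc_onto)
      then show ?thesis using low[of v r k s] by (intro exI[of _ k] exI[of _ v] exI[of _ s] exI[of _ r]) auto
    next
      case False
      then have "0 \<le> - h" "cmod w + - h \<le> 1" using wh by auto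
      then obtain k v s r where k: "k < N" "half_coords v s r" "v \<le> 2 - r" "G.disc k v s r = w" "G.height k v s r = - h"
        by (rule G.disc_onto)
      then have "H k (4 - 2 * r - v) s r = (w, h)"
        using high[of "4 - 2 * r - v" r k s] by (auto simp: half_coords_def)
      then show ?thesis
        using k by (intro exI[of _ k] exI[of _ "4 - 2 * r - v"] exI[of _ s] exI[of _ r]) (auto simp: half_coords_def)
    qed
  next
    fix k v s r k' v' s' r'
    assume "k < N" "half_coords v s r" "k' < N" "half_coords v' s' r'" "H k v s r = H k' v' s' r'"
    then show "r = r'" using norms(3)[of k v s r] norms(3)[of k' v' s' r'] by simp
  next
    fix k v s r k' v' s' and E :: "nat \<times> real \<times> real \<Rightarrow> nat \<times> real \<times> real \<Rightarrow> bool"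
    assume k: "k < N" "half_coords v s r" and k': "k' < N" "half_coords v' s' r"
      and eq: "H k v s r = H k' v' s' r" and E: "ball_seams m m' N r E"
    have eqv: "equivp E" using E by (simp add: ball_seams_def)
    have refl: "\<And>x. E x x" and sym: "\<And>x y. E x y \<Longrightarrow> E y x"
      and trans: "\<And>x y z. E x y \<Longrightarrow> E y z \<Longrightarrow> E x z"
      using eqv equivp_reflp equivp_symp equivp_transp by fast+
    have step: "E (k, v, r) (Suc k mod N, v, 0)" if "k < N" "0 \<le> v" "v \<le> 4 - 2 * r" for k v
      using E that by (auto simp: ball_seams_def)
    have LL: "E (k, v, s) (k', v', s')"
      if k: "k < N" "half_coords v s r" and k': "k' < N" "half_coords v' s' r"
        and v: "v + r \<le> 2" "v' + r \<le> 2" and eq: "H k v s r = H k' v' s' r" for k v s k' v' s'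
    proof (rule F.disc_seams[OF eqv])
      show "F.disc k v s r = F.disc k' v' s' r" "F.height k v s r = F.height k' v' s' r"
        using eq low v by auto
    qed (use k k' v step E in \<open>auto simp: half_coords_def ball_seams_def\<close>)
    have HH: "E (k, v, s) (k', v', s')"
      if k: "k < N" "half_coords v s r" and k': "k' < N" "half_coords v' s' r"
        and v: "2 \<le> v + r" "2 \<le> v' + r" and eq: "H k v s r = H k' v' s' r" for k v s k' v' s'
    proof -
      \<comment> \<open>The relation \<open>E\<close> seen through the reflection of
        \<open>v\<close>, which turns the seams at the top into seams at the bottom.\<close>
      define F where "F = (\<lambda>p q. E (fst p, 4 - 2 * r - fst (snd p), snd (snd p))
        (fst q, 4 - 2 * r - fst (snd q), snd (snd q)))"
      have "equivp F"
        unfolding F_def by (intro equivpI reflpI sympI transpI) (use refl sym trans in blast)+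
      then have "F (k, 4 - 2 * r - v, s) (k', 4 - 2 * r - v', s')"
      proof (rule G.disc_seams)
        show "G.disc k (4 - 2 * r - v) s r = G.disc k' (4 - 2 * r - v') s' r"
          "G.height k (4 - 2 * r - v) s r = G.height k' (4 - 2 * r - v') s' r"
          using eq high[of v r k s] high[of v' r k' s'] v k k' by (auto simp: half_coords_def)
      qed (use k k' v step E in \<open>auto simp: half_coords_def ball_seams_def F_def\<close>)
      then show ?thesis by (simp add: F_def)
    qed
    have LH: "E (k, v, s) (k', v', s')"
      if k: "k < N" "half_coords v s r" and k': "k' < N" "half_coords v' s' r"
        and v: "v + r \<le> 2" "2 \<le> v' + r" and eq: "H k v s r = H k' v' s' r" for k v s k' v' s'
    proof -
      \<comment> \<open>Points of different halves can coincide only at \<open>h = 0\<close>; both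
        are then related to a point of the cut \<open>v = 2 - r\<close> with the same image.\<close>
      have h0: "snd (H k v s r) = 0" using norms(4)[OF k v(1)] norms(5)[OF k' v(2)] eq by auto
      define w where "w = fst (H k v s r)"
      have "w = fst (H k v s r)" "r = max (cmod w) (2 * cmod w - 1)" "cmod w \<le> 1"
        using norms(1,3)[OF k] h0 by (auto simp: w_def)
      then have r: "r = cmod w" by auto
      obtain a where a: "\<bar>a\<bar> \<le> r" "wrap (a, r) = w" using wrap_onto[of w] r by blast
      obtain l t where l: "l < N" "0 \<le> t" "t \<le> r" "f l r t r = (a, r)" using F.top_onto[OF a(1)] by blast
      have r1: "r \<le> 1" "0 \<le> r" using k by (auto simp: half_coords_def)
      have lc: "half_coords (2 - r) t r" using l r1 by (auto simp: half_coords_def)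
      have "F.disc l (2 - r) t r = w" "F.height l (2 - r) t r = 0"
        using F.disc_top(1)[of l t r "2 - r"] F.top0[of l t r] mid(2)[of l t r] l a r1 by auto
      then have "H l (2 - r) t r = (w, 0)" using low[of "2 - r" r l t] by simp
      then have H: "H k v s r = H l (2 - r) t r" using h0 by (simp add: w_def prod_eq_iff)
      have "E (k, v, s) (l, 2 - r, t)" using LL[OF k l(1) lc v(1) _ H] by simp
      moreover have "E (l, 2 - r, t) (k', v', s')" using HH[OF l(1) lc k' _ v(2)] H eq by simp
      ultimately show ?thesis by (rule trans)
    qed
    consider "v + r \<le> 2" "v' + r \<le> 2" | "v + r \<le> 2" "2 \<le> v' + r" | "2 \<le> v + r" "v' + r \<le> 2"
      | "2 \<le> v + r" "2 \<le> v' + r" by linarith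
    then show "E (k, v, s) (k', v', s')"
    proof cases
      case 3
      then show ?thesis using sym[OF LH[OF k' k 3(2,1) eq[symmetric]]] by blast
    qed (use LL[OF k k' _ _ eq] LH[OF k k' _ _ eq] HH[OF k k' _ _ eq] in blast)+
  qed
  then show ?thesis by blast
qed

section \<open>Two balls glued to a sphere\<close>

text \<open>\<open>f\<close> is a quotient map, being continuous from a compact space onto a
  Hausdorff space, and so is the projection to the classes. Having the same fibres, each factors
  through the other.\<close>

lemma quotient_homeomorphic:
  assumes f: "continuous_map T S f" and img: "f ` topspace T = topspace S"
    and T: "compact_space T" and S: "Hausdorff_space S" and R: "equiv UNIV R"
    and fR: "\<And>x y. \<lbrakk>x \<in> topspace T; y \<in> topspace T\<rbrakk> \<Longrightarrow> f x = f y \<longleftrightarrow> (x, y) \<in> R"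
  shows "quotient_topology T R homeomorphic_space S"
proof -
  let ?Q = "quotient_topology T R" and ?\<pi> = "\<lambda>x. R `` {x}"
  have qf: "quotient_map T S f" by (rule T1_Spaces.continuous_imp_quotient_map[OF f T S img])
  have q\<pi>: "quotient_map T ?Q ?\<pi>" by (rule quotient_map_quotient_topology)
  have \<pi>: "?\<pi> x = ?\<pi> y \<longleftrightarrow> (x, y) \<in> R" for x y using eq_equiv_class_iff[OF R] by simp
  obtain g where g: "continuous_map S ?Q g" "\<And>x. x \<in> topspace T \<Longrightarrow> g (f x) = ?\<pi> x"
    by (rule quotient_map_lift_exists[OF qf quotient_imp_continuous_map[OF q\<pi>]]) (use fR \<pi> in blast)+
  obtain h where h: "continuous_map ?Q S h" "\<And>x. x \<in> topspace T \<Longrightarrow> h (?\<pi> x) = f x"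
    by (rule quotient_map_lift_exists[OF q\<pi> f]) (use fR \<pi> in blast)+
  have "h y \<in> topspace S \<and> g (h y) = y" if y: "y \<in> topspace ?Q" for y
  proof -
    obtain x where "x \<in> topspace T" "y = ?\<pi> x"
      using y unfolding topspace_quotient_topology by (rule quotientE)
    then have "h y = f x" "g (h y) = y" using g(2)[of x] h(2)[of x] by simp_all
    then show ?thesis using img \<open>x \<in> topspace T\<close> by blast
  qed
  moreover have "h (g y) = y" if y: "y \<in> topspace S" for y
  proof -
    obtain x where "x \<in> topspace T" "y = f x" using y img by blast
    then show ?thesis using g(2)[of x] h(2)[of x] by simp
  qed
  ultimately have "homeomorphic_maps ?Q S h g"
    using g h by (simp add: homeomorphic_maps_def)
  then show ?thesis unfolding homeomorphic_space_def by blast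
qed

section \<open>The norm with the double cone as unit ball, and radial projection to the round
  sphere\<close>

definition taxi :: "complex \<times> real \<Rightarrow> real" where
  "taxi p = cmod (fst p) + \<bar>snd p\<bar>"

lemma taxi_scaleR: "taxi (t *\<^sub>R p) = \<bar>t\<bar> * taxi p"
  by (simp add: taxi_def abs_mult algebra_simps)

lemma taxi_nonneg [simp]: "0 \<le> taxi p"
  by (simp add: taxi_def)

lemma taxi_eq_0 [simp]: "taxi p = 0 \<longleftrightarrow> p = 0"
  by (auto simp: taxi_def prod_eq_iff add_nonneg_eq_0_iff)

lemma taxi_0 [simp]: "taxi 0 = 0"
  by simp

lemma norm_le_taxi: "norm p \<le> taxi p"
  unfolding taxi_def using norm_Pair_le[of "fst p" "snd p"] by simp

lemma continuous_on_taxi [continuous_intros]: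
  "continuous_on S g \<Longrightarrow> continuous_on S (\<lambda>x. taxi (g x))"
  unfolding taxi_def by (intro continuous_intros)

text \<open>Points of \<open>nsphere 3\<close> are functions on all natural numbers that vanish
  beyond 3.\<close>

definition quad :: "(complex \<times> real) \<times> real \<Rightarrow> nat \<Rightarrow> real" where
  "quad q = (\<lambda>i. if i = 0 then Re (fst (fst q)) else if i = 1 then Im (fst (fst q))
    else if i = 2 then snd (fst q) else if i = 3 then snd q else 0)"

lemma norm_quad: "(\<Sum>i\<le>3. quad q i ^ 2) = (norm q)\<^sup>2"
proof -
  have "{..3} = {0, 1, 2, 3 :: nat}" by auto
  then show ?thesis
    by (cases q; cases "fst q") (simp add: quad_def norm_Pair cmod_power2)
qed

lemma quad_inj: "quad p = quad q \<Longrightarrow> p = q"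
proof -
  assume "quad p = quad q"
  then have "quad p 0 = quad q 0" "quad p 1 = quad q 1" "quad p 2 = quad q 2" "quad p 3 = quad q 3"
    by simp_all
  then show ?thesis by (simp add: quad_def prod_eq_iff complex_eq_iff)
qed

lemma quad_onto:
  assumes "\<forall>i>3. x i = 0"
  obtains q where "quad q = x"
proof (rule that[of "((Complex (x 0) (x 1), x 2), x 3)"], rule ext)
  fix i show "quad ((Complex (x 0) (x 1), x 2), x 3) i = x i"
    using assms by (auto simp: quad_def)
qed

text \<open>Two copies of the ball \<open>taxi p \<le> 1\<close>, the graphs of
  \<open>1 - taxi p\<close> and of \<open>taxi p - 1\<close>, which meet along the boundary
  sphere.\<close>

definition taxi_sphere :: "((complex \<times> real) \<times> real) set" where
  "taxi_sphere = {q. taxi (fst q) + \<bar>snd q\<bar> = 1}"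

definition to_sphere :: "(complex \<times> real) \<times> real \<Rightarrow> nat \<Rightarrow> real" where
  "to_sphere q = quad (q /\<^sub>R norm q)"

lemma taxi_sphere_nonzero: "q \<in> taxi_sphere \<Longrightarrow> norm q \<noteq> 0"
  by (auto simp: taxi_sphere_def taxi_def)

lemma to_sphere_cont: "continuous_map (top_of_set taxi_sphere) (nsphere 3) to_sphere"
proof -
  have "continuous_on taxi_sphere (\<lambda>q. to_sphere q i)" for i
    unfolding to_sphere_def quad_def
    by (cases "i = 0"; cases "i = 1"; cases "i = 2"; cases "i = 3")
      (auto intro!: continuous_intros dest: taxi_sphere_nonzero)
  moreover have "(\<Sum>i\<le>3. to_sphere q i ^ 2) = 1 \<and> (\<forall>i>3. to_sphere q i = 0)" if "q \<in> taxi_sphere" for q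
    using taxi_sphere_nonzero[OF that] unfolding to_sphere_def norm_quad by (auto simp: quad_def)
  ultimately show ?thesis
    unfolding nsphere continuous_map_in_subtopology continuous_map_componentwise_UNIV by auto
qed

lemma to_sphere_inj: "inj_on to_sphere taxi_sphere"
proof (rule inj_onI)
  fix p q assume p: "p \<in> taxi_sphere" and q: "q \<in> taxi_sphere" and "to_sphere p = to_sphere q"
  then have eq: "p /\<^sub>R norm p = q /\<^sub>R norm q" using quad_inj unfolding to_sphere_def by blast
  \<comment> \<open>The length lost in the projection is recovered from the unit vector, because
    points of \<open>taxi_sphere\<close> have sum norm 1.\<close>
  have "taxi (fst (x /\<^sub>R norm x)) + \<bar>snd (x /\<^sub>R norm x)\<bar> = inverse (norm x)" if "x \<in> taxi_sphere" for x
    using that unfolding taxi_sphere_def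
    by (simp add: taxi_scaleR abs_mult flip: distrib_left)
  then have "norm p = norm q" using eq p q by (metis inverse_inverse_eq)
  then show "p = q" using eq taxi_sphere_nonzero[OF p] by simp
qed

lemma to_sphere_onto: "to_sphere ` taxi_sphere = topspace (nsphere 3)"
proof
  show "to_sphere ` taxi_sphere \<subseteq> topspace (nsphere 3)"
    using continuous_map_image_subset_topspace[OF to_sphere_cont] by simp
  show "topspace (nsphere 3) \<subseteq> to_sphere ` taxi_sphere"
  proof
    fix x assume "x \<in> topspace (nsphere 3)"
    then have x: "(\<Sum>i\<le>3. x i ^ 2) = 1" "\<forall>i>3. x i = 0" by (auto simp: nsphere)
    obtain q where q: "quad q = x" using quad_onto x(2) by blast
    then have n: "norm q = 1" using norm_quad[of q] x(1) norm_ge_zero[of q] by (simp add: power2_eq_1_iff)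
    define t where "t = taxi (fst q) + \<bar>snd q\<bar>"
    have "t \<noteq> 0"
    proof
      assume "t = 0"
      then have "taxi (fst q) = 0" "\<bar>snd q\<bar> = 0"
        using taxi_nonneg[of "fst q"] unfolding t_def by linarith+
      then have "q = 0" by (simp add: prod_eq_iff)
      then show False using n by simp
    qed
    moreover have "0 \<le> t" unfolding t_def by simp
    ultimately have t: "0 < t" by simp
    have "q /\<^sub>R t \<in> taxi_sphere"
      using t by (simp add: taxi_sphere_def taxi_scaleR abs_mult t_def flip: distrib_left)
    moreover have "to_sphere (q /\<^sub>R t) = x"
      using t n q by (simp add: to_sphere_def)
    ultimately show "x \<in> to_sphere ` taxi_sphere" by blast
  qed
qed

lemma radial_extension:
  assumes \<psi>: "continuous_on {p. taxi p = 1} \<psi>" "\<psi> ` {p. taxi p = 1} = {p. taxi p = 1}"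
    "inj_on \<psi> {p. taxi p = 1}"
  obtains e where "continuous_on UNIV e" "inj e" "surj e" "\<And>p. taxi (e p) = taxi p"
    "\<And>p. taxi p = 1 \<Longrightarrow> e p = \<psi> p"
proof -
  define e where "e = (\<lambda>p. taxi p *\<^sub>R \<psi> (p /\<^sub>R taxi p))"
  have unit: "taxi (p /\<^sub>R taxi p) = 1" if "p \<noteq> 0" for p
    using that by (simp add: taxi_scaleR)
  have t\<psi>: "taxi (\<psi> (p /\<^sub>R taxi p)) = 1" if "p \<noteq> 0" for p
    using \<psi>(2) unit[OF that] by blast
  have te: "taxi (e p) = taxi p" for p
    using t\<psi>[of p] by (cases "p = 0") (auto simp: e_def taxi_scaleR)
  have "isCont e p" for p
  proof (cases "p = 0")
    case True
    have "(taxi \<longlongrightarrow> taxi 0) (at 0)"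
      using continuous_on_taxi[OF continuous_on_id, of UNIV] unfolding continuous_on_def by blast
    then have "(taxi \<longlongrightarrow> 0) (at 0)" by simp
    moreover have "norm (e q) \<le> taxi q" for q
      using norm_le_taxi[of "e q"] by (simp only: te)
    ultimately have "(e \<longlongrightarrow> 0) (at 0)"
      by (intro Lim_null_comparison[OF always_eventually, of e taxi]) blast+
    then show ?thesis using True by (simp add: isCont_def e_def)
  next
    case False
    have "(\<lambda>p. p /\<^sub>R taxi p) ` (- {0}) \<subseteq> {p. taxi p = 1}" using unit by blast
    then have "continuous_on (- {0}) e"
      unfolding e_def
      by (intro continuous_intros continuous_on_compose2[OF \<psi>(1)]) auto
    then show ?thesis using False by (simp add: continuous_on_eq_continuous_at open_Compl)
  qed
  then have cont: "continuous_on UNIV e" by (simp add: continuous_at_imp_continuous_on)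
  have "inj e"
  proof (rule injI)
    fix p q assume eq: "e p = e q"
    then have t: "taxi p = taxi q" using te by metis
    show "p = q"
    proof (cases "p = 0")
      case True then show ?thesis using t by (metis taxi_eq_0)
    next
      case False
      then have q: "q \<noteq> 0" using t by (metis taxi_eq_0)
      have "\<psi> (p /\<^sub>R taxi p) = \<psi> (q /\<^sub>R taxi q)" using eq t False q by (simp add: e_def)
      then have "p /\<^sub>R taxi p = q /\<^sub>R taxi q"
        using inj_onD[OF \<psi>(3)] unit[OF False] unit[OF q] by blast
      then show ?thesis using t q by simp
    qed
  qed
  moreover have "surj e"
  proof -
    have "\<exists>q. e q = p" for p
    proof (cases "p = 0")
      case True then show ?thesis by (intro exI[of _ 0]) (simp add: e_def)
    next
      case False
      have "p /\<^sub>R taxi p \<in> \<psi> ` {p. taxi p = 1}" unfolding \<psi>(2) using unit[OF False] by simp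
      then obtain q where q: "taxi q = 1" "\<psi> q = p /\<^sub>R taxi p" by auto
      then have "e (taxi p *\<^sub>R q) = p" using False by (simp add: e_def taxi_scaleR)
      then show ?thesis by blast
    qed
    then show ?thesis unfolding surj_def by metis
  qed
  moreover have "e p = \<psi> p" if "taxi p = 1" for p using that by (simp add: e_def)
  ultimately show ?thesis using that cont te by blast
qed

text \<open>Two balls glued along their boundary spheres form a 3-sphere, whatever the gluing
  homeomorphism is, since the latter extends radially to the second ball (Alexander trick).\<close>

theorem glue_balls:
  fixes T :: "'a topology" and a b :: "'a \<Rightarrow> complex \<times> real"
  assumes T: "compact_space T" and \<tau>: "continuous_map T euclideanreal \<tau>"
    and a: "continuous_map (subtopology T {x \<in> topspace T. \<tau> x \<le> c}) euclidean a"
    and b: "continuous_map (subtopology T {x \<in> topspace T. c \<le> \<tau> x}) euclidean b"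
    and a1: "\<And>x. \<lbrakk>x \<in> topspace T; \<tau> x \<le> c\<rbrakk> \<Longrightarrow> taxi (a x) \<le> 1 \<and> (taxi (a x) = 1 \<longleftrightarrow> \<tau> x = c)"
    and b1: "\<And>x. \<lbrakk>x \<in> topspace T; c \<le> \<tau> x\<rbrakk> \<Longrightarrow> taxi (b x) \<le> 1 \<and> (taxi (b x) = 1 \<longleftrightarrow> \<tau> x = c)"
    and a2: "\<And>p. taxi p \<le> 1 \<Longrightarrow> \<exists>x\<in>topspace T. \<tau> x \<le> c \<and> a x = p"
    and b2: "\<And>p. taxi p \<le> 1 \<Longrightarrow> \<exists>x\<in>topspace T. c \<le> \<tau> x \<and> b x = p"
    and ab: "\<And>x y. \<lbrakk>x \<in> topspace T; y \<in> topspace T; \<tau> x = c; \<tau> y = c\<rbrakk> \<Longrightarrow> a x = a y \<longleftrightarrow> b x = b y"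
  obtains f where "continuous_map T (nsphere 3) f" "f ` topspace T = topspace (nsphere 3)"
    "\<And>x y. \<lbrakk>x \<in> topspace T; y \<in> topspace T\<rbrakk> \<Longrightarrow> f x = f y \<longleftrightarrow>
      \<tau> x \<le> c \<and> \<tau> y \<le> c \<and> a x = a y \<or> c \<le> \<tau> x \<and> c \<le> \<tau> y \<and> b x = b y"
proof -
  let ?S = "{x \<in> topspace T. \<tau> x = c}" and ?B = "{p. taxi p = 1}"
  have S: "compact_space (subtopology T ?S)"
  proof -
    have "closedin T {x \<in> topspace T. \<tau> x \<in> {c}}"
      by (rule closedin_continuous_map_preimage[OF \<tau>]) simp
    then show ?thesis using T by (simp add: closedin_compact_space compact_space_subtopology)
  qed
  have aS: "continuous_map (subtopology T ?S) euclidean a"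
    by (rule continuous_map_from_subtopology_mono[OF a]) auto
  have bS: "continuous_map (subtopology T ?S) (top_of_set ?B) b"
    unfolding continuous_map_in_subtopology
    using b1 by (auto intro: continuous_map_from_subtopology_mono[OF b])
  have onto: "a ` ?S = ?B" "b ` ?S = ?B"
  proof -
    have "p \<in> a ` ?S" "p \<in> b ` ?S" if "taxi p = 1" for p
    proof -
      obtain x y where "x \<in> topspace T" "\<tau> x \<le> c" "a x = p" "y \<in> topspace T" "c \<le> \<tau> y" "b y = p"
        using a2[of p] b2[of p] \<open>taxi p = 1\<close> by auto
      then have "x \<in> ?S" "y \<in> ?S" "p = a x" "p = b y"
        using a1[of x] b1[of y] \<open>taxi p = 1\<close> by auto
      then show "p \<in> a ` ?S" "p \<in> b ` ?S" by blast+
    qed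
    then show "a ` ?S = ?B" "b ` ?S = ?B" using a1 b1 by auto
  qed
  \<comment> \<open>Restricted to the common boundary, \<open>b\<close> is a quotient map onto the
    unit sphere, and by \<open>ab\<close> the map \<open>a\<close> is constant on its fibres; so
    \<open>a\<close> factors as \<open>\<psi> \<circ> b\<close> there.\<close>
  have q: "quotient_map (subtopology T ?S) (top_of_set ?B) b"
    by (rule T1_Spaces.continuous_imp_quotient_map[OF bS S])
      (use onto in \<open>auto simp: Hausdorff_space_subtopology\<close>)
  obtain \<psi> where \<psi>: "continuous_map (top_of_set ?B) euclidean \<psi>"
    "\<psi> ` topspace (top_of_set ?B) = a ` topspace (subtopology T ?S)"
    "\<And>x. x \<in> topspace (subtopology T ?S) \<Longrightarrow> \<psi> (b x) = a x"
    by (rule quotient_map_lift_exists[OF q aS]) (use ab in auto)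
  have \<psi>inj: "inj_on \<psi> ?B"
  proof (rule inj_onI)
    fix p q assume "p \<in> ?B" "q \<in> ?B" and eq: "\<psi> p = \<psi> q"
    then have "p \<in> b ` ?S" "q \<in> b ` ?S" unfolding onto by auto
    then obtain x y where "x \<in> ?S" "y \<in> ?S" "p = b x" "q = b y" by blast
    then show "p = q" using eq \<psi>(3) ab by auto
  qed
  have "topspace (subtopology T ?S) = ?S" by auto
  then have \<psi>B: "\<psi> ` ?B = ?B" using \<psi>(2) onto(1) by (simp only: topspace_euclidean_subtopology)
  have \<psi>c: "continuous_on ?B \<psi>" using \<psi>(1) by simp
  obtain e where e: "continuous_on UNIV e" "inj e" "surj e" "\<And>p. taxi (e p) = taxi p"
    "\<And>p. taxi p = 1 \<Longrightarrow> e p = \<psi> p"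
    by (rule radial_extension[OF \<psi>c \<psi>B \<psi>inj]) blast
  \<comment> \<open>\<open>\<alpha>\<close> and \<open>\<beta>\<close> put the two balls on the two
    graphs that form \<open>taxi_sphere\<close>. The extension \<open>e\<close> of
    \<open>\<psi>\<close> makes them agree where \<open>\<tau> x = c\<close>.\<close>
  define \<alpha> where "\<alpha> = (\<lambda>x. (a x, 1 - taxi (a x)))"
  define \<beta> where "\<beta> = (\<lambda>x. (e (b x), taxi (b x) - 1))"
  define g where "g = (\<lambda>x. if \<tau> x \<le> c then \<alpha> x else \<beta> x)"
  have \<alpha>\<beta>: "\<alpha> x = \<beta> x" if "x \<in> topspace T" "\<tau> x = c" for x
    using that a1[of x] b1[of x] e(5)[of "b x"] \<psi>(3)[of x] by (auto simp: \<alpha>_def \<beta>_def)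
  have g\<beta>: "g x = \<beta> x" if "x \<in> topspace T" "c \<le> \<tau> x" for x
    using that \<alpha>\<beta>[of x] by (auto simp: g_def)
  have c12: "continuous_map euclidean euclidean (\<lambda>p. (p, 1 - taxi p))"
    "continuous_map euclidean euclidean (\<lambda>p. (e p, taxi p - 1))"
    by (auto intro!: continuous_intros e(1))
  have "continuous_map (subtopology T {x \<in> topspace T. \<tau> x \<le> c}) euclidean \<alpha>"
    "continuous_map (subtopology T {x \<in> topspace T. c \<le> \<tau> x}) euclidean \<beta>"
    using continuous_map_compose[OF a c12(1)] continuous_map_compose[OF b c12(2)]
    by (simp_all only: o_def \<alpha>_def \<beta>_def)
  then have "continuous_map T euclidean g"
    unfolding g_def by (intro continuous_map_cases_le[OF \<tau>] \<alpha>\<beta>) auto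
  moreover have g1: "g x \<in> taxi_sphere" if "x \<in> topspace T" for x
    using that a1[of x] b1[of x] e(4) by (auto simp: g_def \<alpha>_def \<beta>_def taxi_sphere_def)
  ultimately have "continuous_map T (top_of_set taxi_sphere) g"
    by (auto simp: continuous_map_in_subtopology)
  then have cont: "continuous_map T (nsphere 3) (to_sphere \<circ> g)"
    by (rule continuous_map_compose[OF _ to_sphere_cont])
  have gonto: "g ` topspace T = taxi_sphere"
  proof
    show "taxi_sphere \<subseteq> g ` topspace T"
    proof
      fix q assume q: "q \<in> taxi_sphere"
      show "q \<in> g ` topspace T"
      proof (cases "0 \<le> snd q")
        case True
        then obtain x where x: "x \<in> topspace T" "\<tau> x \<le> c" "a x = fst q"
          using a2[of "fst q"] q by (auto simp: taxi_sphere_def)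
        have "1 - taxi (fst q) = snd q" using q True by (simp add: taxi_sphere_def)
        then have "g x = q" using x by (simp add: g_def \<alpha>_def)
        then show ?thesis using x by blast
      next
        case False
        obtain p where p: "e p = fst q" using surjD[OF e(3), of "fst q"] by metis
        have "taxi p \<le> 1" using e(4)[of p] p q by (auto simp: taxi_sphere_def)
        then obtain x where x: "x \<in> topspace T" "c \<le> \<tau> x" "b x = p" using b2 by blast
        have "taxi p - 1 = snd q" using q False p e(4)[of p] by (simp add: taxi_sphere_def)
        then have "g x = q" using x p g\<beta>[of x] by (simp add: \<beta>_def)
        then show ?thesis using x by blast
      qed
    qed
  qed (use g1 in auto)
  have geq: "g x = g y \<longleftrightarrow> \<tau> x \<le> c \<and> \<tau> y \<le> c \<and> a x = a y \<or> c \<le> \<tau> x \<and> c \<le> \<tau> y \<and> b x = b y"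
    if xy: "x \<in> topspace T" "y \<in> topspace T" for x y
  proof -
    consider "\<tau> x \<le> c" "\<tau> y \<le> c" | "c \<le> \<tau> x" "c \<le> \<tau> y" | "\<tau> x < c" "c < \<tau> y" | "c < \<tau> x" "\<tau> y < c"
      by linarith
    then show ?thesis
    proof cases
      case 1
      then have "g x = g y \<longleftrightarrow> a x = a y" by (auto simp: g_def \<alpha>_def)
      then show ?thesis using ab xy 1 by (auto dest: order_antisym)
    next
      case 2
      then have "g x = g y \<longleftrightarrow> b x = b y" using xy e(2) by (auto simp: g\<beta> \<beta>_def inj_eq)
      then show ?thesis using ab xy 2 by (auto dest: order_antisym)
    next
      case 3
      then have "\<tau> x \<le> c" "c \<le> \<tau> y" "\<tau> x \<noteq> c" "\<tau> y \<noteq> c" by auto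
      then have "taxi (a x) < 1" "taxi (b y) < 1"
        using a1[OF xy(1)] b1[OF xy(2)] by (simp_all add: less_le)
      then show ?thesis using 3 by (auto simp: g_def \<alpha>_def \<beta>_def)
    next
      case 4
      then have "\<tau> y \<le> c" "c \<le> \<tau> x" "\<tau> x \<noteq> c" "\<tau> y \<noteq> c" by auto
      then have "taxi (b x) < 1" "taxi (a y) < 1"
        using b1[OF xy(1)] a1[OF xy(2)] by (simp_all add: less_le)
      then show ?thesis using 4 by (auto simp: g_def \<alpha>_def \<beta>_def)
    qed
  qed
  show ?thesis
  proof (rule that[OF cont])
    show "(to_sphere \<circ> g) ` topspace T = topspace (nsphere 3)"
      using gonto to_sphere_onto by (simp flip: image_image image_comp)
    fix x y assume xy: "x \<in> topspace T" "y \<in> topspace T"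
    then have "(to_sphere \<circ> g) x = (to_sphere \<circ> g) y \<longleftrightarrow> g x = g y"
      using inj_on_eq_iff[OF to_sphere_inj] g1 by simp
    then show "(to_sphere \<circ> g) x = (to_sphere \<circ> g) y \<longleftrightarrow>
      \<tau> x \<le> c \<and> \<tau> y \<le> c \<and> a x = a y \<or> c \<le> \<tau> x \<and> c \<le> \<tau> y \<and> b x = b y"
      using geq[OF xy] by simp
  qed
qed

section \<open>Adjacency by colour, and continuity of barycentric coordinates\<close>

definition joined :: "('v, 'e) colored_graph \<Rightarrow> nat \<Rightarrow> 'v \<Rightarrow> 'v \<Rightarrow> bool" where
  "joined G i u v \<longleftrightarrow> (\<exists>e\<in>edges G. color G e = i \<and> ends G e = {u, v})"

lemma glued_iff:
  "glued G p q \<longleftrightarrow> (\<exists>i. joined G i (fst p) (fst q) \<and> snd p = snd q \<and> snd p \<in> standard_simplex 3 \<and> snd p i = 0)"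
  unfolding glued_def joined_def by (cases p; cases q) auto

lemma continuous_map_Pair_euclidean:
  assumes "continuous_map X euclidean f" "continuous_map X euclidean g"
  shows "continuous_map X euclidean (\<lambda>x. (f x, g x))"
  using continuous_map_pairedI[OF assms] by simp

lemma continuous_map_barycentric: "continuous_map (tetrahedra G) euclideanreal (\<lambda>p. snd p i)"
proof -
  have "continuous_map (subtopology (powertop_real UNIV) (standard_simplex 3)) euclideanreal (\<lambda>x. x i)"
    by (intro continuous_map_from_subtopology continuous_map_product_projection) auto
  from continuous_map_compose[OF continuous_map_snd this, of "discrete_topology (verts G)"]
  show ?thesis unfolding tetrahedra_def by (simp add: o_def)
qed

section \<open>Gems with a Hamiltonian two-coloured cycle\<close>

text \<open>The colours \<open>c\<close> and \<open>d\<close> alternate along a Hamiltonian cycle,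
  and \<open>ma\<close>, \<open>mb\<close> are the chords of the other two colours in terms of
  positions on it. The colours are parameters because the same construction is used for both halves
  of the tetrahedra, with the two pairs exchanged.\<close>

locale gem_cycle =
  fixes G :: "('v, 'e) colored_graph" and N :: nat and P :: "nat \<Rightarrow> 'v"
    and a b c d :: nat and ma mb :: "nat \<Rightarrow> nat"
  assumes P: "bij_betw P {..<N} (verts G)"
    and N: "0 < N" "even N"
    and colours: "distinct [a, b, c, d]" "{a, b, c, d} = {..3}"
    and color_le: "\<And>e. e \<in> edges G \<Longrightarrow> color G e \<le> 3"
    and ma: "noncrossing_matching ma 0 N" and mb: "noncrossing_matching mb 0 N"
    and joined_a: "\<And>u v. joined G a u v \<longleftrightarrow> (\<exists>k<N. u = P k \<and> v = P (ma k))"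
    and joined_b: "\<And>u v. joined G b u v \<longleftrightarrow> (\<exists>k<N. u = P k \<and> v = P (mb k))"
    and joined_c: "\<And>u v. joined G c u v \<longleftrightarrow> (\<exists>k<N. even k \<and> {u, v} = {P k, P (Suc k mod N)})"
    and joined_d: "\<And>u v. joined G d u v \<longleftrightarrow> (\<exists>k<N. odd k \<and> {u, v} = {P k, P (Suc k mod N)})"
begin

lemma simplex_sum: "(\<Sum>i\<le>3. x i) = x a + x b + x c + x d" for x :: "nat \<Rightarrow> real"
  unfolding colours(2)[symmetric] using colours(1) by simp

lemma in_simplex:
  "x \<in> standard_simplex 3 \<longleftrightarrow> (\<forall>i. 0 \<le> x i) \<and> (\<forall>i>3. x i = 0) \<and> x a + x b + x c + x d = 1"
  (is "?L \<longleftrightarrow> ?R")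
proof
  assume ?L then show ?R by (auto simp: standard_simplex_def simplex_sum)
next
  assume R: ?R
  have "x i \<le> 1" for i
  proof (cases "i \<le> 3")
    case True
    then have "x i \<le> (\<Sum>i\<le>3. x i)" using R by (intro member_le_sum) auto
    then show ?thesis using R simplex_sum[of x] by simp
  qed (use R in auto)
  then show ?L using R by (auto simp: standard_simplex_def simplex_sum)
qed

definition idx :: "'v \<Rightarrow> nat" where
  "idx = inv_into {..<N} P"

lemma idx_P: "k < N \<Longrightarrow> idx (P k) = k"
  unfolding idx_def using P by (simp add: bij_betw_def inv_into_f_f)

lemma idx: "u \<in> verts G \<Longrightarrow> idx u < N \<and> P (idx u) = u"
  using P f_inv_into_f[of u P "{..<N}"] inv_into_into[of u P "{..<N}"]
  by (auto simp: idx_def bij_betw_def)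

lemma P_in: "k < N \<Longrightarrow> P k \<in> verts G"
  using P by (auto simp: bij_betw_def)

lemma succ: "Suc k mod N < N"
  using N by simp

lemma even_succ: "k < N \<Longrightarrow> even (Suc k mod N) \<longleftrightarrow> odd k"
  using N by (cases "Suc k = N") auto

lemma finite_verts: "finite (verts G)"
  using P bij_betw_finite by blast

lemma m_less: "k < N \<Longrightarrow> ma k < N" "k < N \<Longrightarrow> mb k < N"
  using noncrossing_matchingD(2)[OF ma] noncrossing_matchingD(2)[OF mb] by auto

lemma m_parity: "k < N \<Longrightarrow> even (ma k) \<longleftrightarrow> odd k" "k < N \<Longrightarrow> even (mb k) \<longleftrightarrow> odd k"
  using noncrossing_matching_parity[OF ma] noncrossing_matching_parity[OF mb] by auto

lemma topspace_tetrahedra: "topspace (tetrahedra G) = verts G \<times> standard_simplex 3"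
  by (auto simp: tetrahedra_def)

definition across :: "nat \<Rightarrow> (nat \<Rightarrow> real) \<Rightarrow> real" where
  "across k x = (if even k then 2 * x d else 2 * x c)"

text \<open>Inside the half \<open>x c + x d \<le> 1 / 2\<close> of a tetrahedron, \<open>r = 2 (x c + x d)\<close> measures the distance from
  the edge \<open>ab\<close>, \<open>v = 4 x a\<close> the height along it, and \<open>s\<close> runs across the wedge from the face shared with the
  predecessor on the cycle to the one shared with the successor, hence the dependence on parity.\<close>

definition point :: "real \<Rightarrow> nat \<times> real \<times> real \<Rightarrow> 'v \<times> (nat \<Rightarrow> real)" where
  "point r = (\<lambda>(k, v, s). (P k, \<lambda>i. if i = a then v / 4 else if i = b then 1 - r / 2 - v / 4
     else if i = c then (if even k then (r - s) / 2 else s / 2)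
     else if i = d then (if even k then s / 2 else (r - s) / 2) else 0))"

lemma point_coords:
  "fst (point r (k, v, s)) = P k" "snd (point r (k, v, s)) a = v / 4"
  "snd (point r (k, v, s)) b = 1 - r / 2 - v / 4"
  "snd (point r (k, v, s)) c = (if even k then (r - s) / 2 else s / 2)"
  "snd (point r (k, v, s)) d = (if even k then s / 2 else (r - s) / 2)"
  using colours(1) by (auto simp: point_def)

lemma point_in:
  assumes "k < N" "half_coords v s r"
  shows "point r (k, v, s) \<in> topspace (tetrahedra G)"
proof -
  have "i \<in> {a, b, c, d}" if "i \<le> 3" for i using that colours(2) by auto
  then have "snd (point r (k, v, s)) i = 0" if "i > 3" for i
    using that colours(2) by (auto simp: point_def)
  moreover have "0 \<le> snd (point r (k, v, s)) i" for i
    using assms(2) by (auto simp: point_def half_coords_def)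
  moreover have "snd (point r (k, v, s)) a + snd (point r (k, v, s)) b + snd (point r (k, v, s)) c +
      snd (point r (k, v, s)) d = 1"
    unfolding point_coords by (simp add: diff_divide_distrib)
  ultimately have "snd (point r (k, v, s)) \<in> standard_simplex 3" by (simp add: in_simplex)
  then show ?thesis
    using P_in[OF assms(1)] by (simp add: topspace_tetrahedra mem_Times_iff point_coords)
qed

lemma coords_of_simplex:
  assumes "x \<in> standard_simplex 3" "x c + x d \<le> 1 / 2"
  shows "half_coords (4 * x a) (across k x) (2 * (x c + x d))"
proof -
  have "x a + x b + x c + x d = 1" "0 \<le> x a" "0 \<le> x b" "0 \<le> x c" "0 \<le> x d"
    using assms in_simplex by auto
  then show ?thesis using assms(2) by (auto simp: half_coords_def across_def)
qed

lemma point_of_simplex: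
  assumes "u \<in> verts G" "x \<in> standard_simplex 3"
  shows "point (2 * (x c + x d)) (idx u, 4 * x a, across (idx u) x) = (u, x)"
proof -
  have x: "\<forall>i>3. x i = 0" "x a + x b + x c + x d = 1" using assms in_simplex by auto
  have "snd (point (2 * (x c + x d)) (idx u, 4 * x a, across (idx u) x)) i = x i" for i
  proof (cases "i \<in> {a, b, c, d}")
    case True
    then show ?thesis
      using x(2) by (auto simp: point_coords across_def add_divide_distrib)
  next
    case False
    then have "i > 3" using colours(2) by auto
    then show ?thesis using x False by (simp add: point_def)
  qed
  then have "snd (point (2 * (x c + x d)) (idx u, 4 * x a, across (idx u) x)) = x" by (rule ext)
  then show ?thesis using idx[OF assms(1)] point_coords(1) by (simp add: prod_eq_iff)
qed

lemma glued_in: "glued G p q \<Longrightarrow> p \<in> topspace (tetrahedra G) \<and> q \<in> topspace (tetrahedra G)"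
proof -
  assume "glued G p q"
  then obtain i where i: "joined G i (fst p) (fst q)" "snd p = snd q" "snd p \<in> standard_simplex 3"
    by (auto simp: glued_iff)
  then have "i \<in> {a, b, c, d}" using color_le colours(2) by (auto simp: joined_def)
  then have "fst p \<in> verts G \<and> fst q \<in> verts G"
    using i(1) joined_a joined_b joined_c joined_d P_in m_less succ
    by (auto simp: doubleton_eq_iff)
  then show ?thesis using i by (simp add: topspace_tetrahedra mem_Times_iff)
qed

lemma glued_point:
  assumes "joined G i (P k) (P k')" "snd (point r (k, v, s)) = snd (point r (k', v', s'))"
    "snd (point r (k, v, s)) i = 0" "k < N" "half_coords v s r"
  shows "glued G (point r (k, v, s)) (point r (k', v', s'))"
  unfolding glued_iff point_coords
  using assms point_in[OF assms(4,5)] by (auto simp: topspace_tetrahedra mem_Times_iff)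

text \<open>The last two properties say that the fibres of \<open>h\<close> are the classes of glued
  points. The first of them asks for the gluings on the level of \<open>p\<close> only, so that
  \<open>R\<close> may be a relation that is under control on a single level.\<close>

lemma half_chart:
  obtains h where
    "continuous_map (subtopology (tetrahedra G) {p \<in> topspace (tetrahedra G). snd p c + snd p d \<le> 1 / 2}) euclidean h"
    "\<And>p. \<lbrakk>p \<in> topspace (tetrahedra G); snd p c + snd p d \<le> 1 / 2\<rbrakk> \<Longrightarrow>
      taxi (h p) \<le> 1 \<and> (taxi (h p) = 1 \<longleftrightarrow> snd p c + snd p d = 1 / 2)"
    "\<And>y. taxi y \<le> 1 \<Longrightarrow> \<exists>p\<in>topspace (tetrahedra G). snd p c + snd p d \<le> 1 / 2 \<and> h p = y"
    "\<And>p q R. \<lbrakk>p \<in> topspace (tetrahedra G); snd p c + snd p d \<le> 1 / 2;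
       q \<in> topspace (tetrahedra G); snd q c + snd q d \<le> 1 / 2; h p = h q; equivp R;
       \<And>x y. \<lbrakk>glued G x y; snd x c + snd x d = snd p c + snd p d\<rbrakk> \<Longrightarrow> R x y\<rbrakk> \<Longrightarrow> R p q"
    "\<And>p q. \<lbrakk>glued G p q; snd p c + snd p d \<le> 1 / 2\<rbrakk> \<Longrightarrow> h p = h q"
proof -
  obtain H where "ball_chart ma mb N H" using ball_chart_exists[OF ma mb N(1)] by blast
  then interpret ball_chart ma mb N H .
  let ?T = "tetrahedra G" and ?D = "{(v, s, r). half_coords v s r}"
  define h where "h = (\<lambda>p. H (idx (fst p)) (4 * snd p a) (across (idx (fst p)) (snd p)) (2 * (snd p c + snd p d)))"
  let ?A = "{p \<in> topspace ?T. snd p c + snd p d \<le> 1 / 2}"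
  have coords: "half_coords (4 * snd p a) (across k (snd p)) (2 * (snd p c + snd p d))" if "p \<in> ?A" for p k
    by (rule coords_of_simplex) (use that in \<open>auto simp: topspace_tetrahedra\<close>)
  have idxA: "idx (fst p) < N" if "p \<in> topspace ?T" for p
    using that idx by (auto simp: topspace_tetrahedra)
  note proj = continuous_map_barycentric[of G]
  \<comment> \<open>The formula depends on the tetrahedron through \<open>idx\<close>. Each
    tetrahedron is open in the disjoint union, so continuity may be checked on one at a
    time.\<close>
  have h1: "continuous_map (subtopology ?T ?A) euclidean h"
  proof (rule pasting_lemma[where I = "verts G" and T = "\<lambda>u. {p \<in> topspace (subtopology ?T ?A). fst p = u}"
        and f = "\<lambda>u p. H (idx u) (4 * snd p a) (across (idx u) (snd p)) (2 * (snd p c + snd p d))"])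
    fix u assume u: "u \<in> verts G"
    have "continuous_map ?T (discrete_topology (verts G)) fst"
      unfolding tetrahedra_def by (rule continuous_map_fst)
    then have "continuous_map (subtopology ?T ?A) (discrete_topology (verts G)) fst"
      by (rule continuous_map_from_subtopology)
    from openin_continuous_map_preimage[OF this, of "{u}"]
    show "openin (subtopology ?T ?A) {p \<in> topspace (subtopology ?T ?A). fst p = u}"
      using u by simp
    let ?U = "subtopology (subtopology ?T ?A) {p \<in> topspace (subtopology ?T ?A). fst p = u}"
    have "continuous_map ?U euclideanreal (\<lambda>p. snd p i)" for i
      by (intro continuous_map_from_subtopology proj)
    moreover from this have "continuous_map ?U euclideanreal (\<lambda>p. across (idx u) (snd p))"
      unfolding across_def by (cases "even (idx u)") (simp_all add: continuous_map_real_mult_left)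
    ultimately have "continuous_map ?U euclidean (\<lambda>p. (4 * snd p a, across (idx u) (snd p), 2 * (snd p c + snd p d)))"
      by (intro continuous_map_Pair_euclidean continuous_map_real_mult_left continuous_map_add)
    moreover have "(4 * snd p a, across (idx u) (snd p), 2 * (snd p c + snd p d)) \<in> ?D" if "p \<in> topspace ?U" for p
      using coords[of p "idx u"] that by simp
    ultimately have 1: "continuous_map ?U (top_of_set ?D) (\<lambda>p. (4 * snd p a, across (idx u) (snd p), 2 * (snd p c + snd p d)))"
      unfolding continuous_map_in_subtopology by blast
    have 2: "continuous_map (top_of_set ?D) euclidean (\<lambda>(v, s, r). H (idx u) v s r)"
      using ball_cont[of "idx u"] idx[OF u] by simp
    show "continuous_map ?U euclidean
        (\<lambda>p. H (idx u) (4 * snd p a) (across (idx u) (snd p)) (2 * (snd p c + snd p d)))"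
      using continuous_map_compose[OF 1 2] unfolding o_def prod.case .
  qed (auto simp: h_def topspace_tetrahedra)
  have h2: "taxi (h p) \<le> 1 \<and> (taxi (h p) = 1 \<longleftrightarrow> snd p c + snd p d = 1 / 2)" if "p \<in> ?A" for p
    using ball_range[OF idxA coords[OF that]] ball_boundary[OF idxA coords[OF that]] that
    by (auto simp: taxi_def h_def)
  have h3: "\<exists>p\<in>topspace ?T. snd p c + snd p d \<le> 1 / 2 \<and> h p = y" if y: "taxi y \<le> 1" for y
  proof -
    obtain k v s r where k: "k < N" "half_coords v s r" "H k v s r = y"
      using ball_onto[of "fst y" "snd y"] y by (auto simp: taxi_def)
    let ?p = "point r (k, v, s)"
    have r: "snd ?p c + snd ?p d = r / 2" unfolding point_coords by (simp add: diff_divide_distrib)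
    have "h ?p = H k v s r"
      unfolding h_def r point_coords(1,2) idx_P[OF k(1)] across_def point_coords(4,5)
      by (simp add: diff_divide_distrib)
    then show ?thesis
      using point_in[OF k(1,2)] k r by (intro bexI[of _ ?p]) (auto simp: half_coords_def)
  qed
  have h4: "R p q"
    if p: "p \<in> topspace ?T" "snd p c + snd p d \<le> 1 / 2" and q: "q \<in> topspace ?T" "snd q c + snd q d \<le> 1 / 2"
      and eq: "h p = h q" and R: "equivp R"
      and gl: "\<And>x y. \<lbrakk>glued G x y; snd x c + snd x d = snd p c + snd p d\<rbrakk> \<Longrightarrow> R x y" for p q R
  proof -
    have A: "p \<in> ?A" "q \<in> ?A" using p q by auto
    define r where "r = 2 * (snd p c + snd p d)"
    have "2 * (snd p c + snd p d) = 2 * (snd q c + snd q d)"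
      by (rule ball_radius[OF idxA[OF p(1)] coords[OF A(1)] idxA[OF q(1)] coords[OF A(2)] eq[unfolded h_def]])
    then have rq: "2 * (snd q c + snd q d) = r" by (simp add: r_def)
    \<comment> \<open>\<open>R\<close> pulled back to the block coordinates of level
      \<open>r\<close>.\<close>
    define E where "E = (\<lambda>x y. R (point r x) (point r y))"
    have r1: "0 \<le> r" "r \<le> 1" using coords[OF A(1), of 0] by (auto simp: half_coords_def r_def)
    have cd: "snd (point r (k, v, s)) c + snd (point r (k, v, s)) d = snd p c + snd p d" for k v s
      unfolding point_coords by (simp add: diff_divide_distrib add_divide_distrib r_def)
    have glE: "E (k, v, s) (k', v', s')"
      if "joined G i (P k) (P k')" "snd (point r (k, v, s)) = snd (point r (k', v', s'))"
        "snd (point r (k, v, s)) i = 0" "k < N" "half_coords v s r" for i k v s k' v' s'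
      unfolding E_def by (rule gl[OF glued_point[OF that] cd])
    have "ball_seams ma mb N r E"
      unfolding ball_seams_def
    proof (intro conjI allI impI; (elim conjE)?)
      show "equivp E"
        unfolding E_def
        using equivp_reflp[OF R] equivp_symp[OF R] equivp_transp[OF R]
        by (intro equivpI reflpI sympI transpI) blast+
    next
      fix k v assume *: "k < N" "0 \<le> v" "v \<le> 4 - 2 * r"
      have eq: "snd (point r (k, v, r)) = snd (point r (Suc k mod N, v, 0))"
        using even_succ[OF *(1)] by (auto simp: point_def)
      have hc: "half_coords v r r" using * r1 by (simp add: half_coords_def)
      show "E (k, v, r) (Suc k mod N, v, 0)"
      proof (cases "even k")
        case True
        then have "joined G c (P k) (P (Suc k mod N))" using joined_c * by blast
        then show ?thesis by (rule glE[OF _ eq _ *(1) hc]) (simp add: point_coords True)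
      next
        case False
        then have "joined G d (P k) (P (Suc k mod N))" using joined_d * by blast
        then show ?thesis by (rule glE[OF _ eq _ *(1) hc]) (simp add: point_coords False)
      qed
    next
      fix k s assume *: "k < N" "0 \<le> s" "s \<le> r"
      \<comment> \<open>Partners have opposite parity, which exchanges the roles of \<open>c\<close>
        and \<open>d\<close> in \<open>point\<close>. Equal barycentric coordinates therefore mean
        \<open>s\<close> on one side and \<open>r - s\<close> on the other.\<close>
      have eq: "snd (point r (k, v, s)) = snd (point r (ma k, v, r - s))"
        "snd (point r (k, v, s)) = snd (point r (mb k, v, r - s))" for v
        using m_parity[OF *(1)] by (auto simp: point_def)
      have hc: "half_coords 0 s r" "half_coords (4 - 2 * r) s r" using * r1 by (simp_all add: half_coords_def)
      have "joined G a (P k) (P (ma k))" using joined_a * by blast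
      then show "E (k, 0, s) (ma k, 0, r - s)"
        by (rule glE[OF _ eq(1) _ *(1) hc(1)]) (simp add: point_coords)
      have "joined G b (P k) (P (mb k))" using joined_b * by blast
      then show "E (k, 4 - 2 * r, s) (mb k, 4 - 2 * r, r - s)"
        by (rule glE[OF _ eq(2) _ *(1) hc(2)]) (simp add: point_coords diff_divide_distrib)
    qed
    moreover have "half_coords (4 * snd p a) (across k (snd p)) r" "half_coords (4 * snd q a) (across k (snd q)) r" for k
      using coords[OF A(1)] coords[OF A(2)] rq by (auto simp: r_def)
    moreover have "H (idx (fst p)) (4 * snd p a) (across (idx (fst p)) (snd p)) r =
        H (idx (fst q)) (4 * snd q a) (across (idx (fst q)) (snd q)) r"
      using eq rq by (simp add: h_def r_def)
    ultimately have "E (idx (fst p), 4 * snd p a, across (idx (fst p)) (snd p))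
        (idx (fst q), 4 * snd q a, across (idx (fst q)) (snd q))"
      using ball_inj idxA p(1) q(1) by blast
    moreover have "point r (idx (fst p), 4 * snd p a, across (idx (fst p)) (snd p)) = p"
      "point r (idx (fst q), 4 * snd q a, across (idx (fst q)) (snd q)) = q"
      using point_of_simplex[of "fst p" "snd p"] point_of_simplex[of "fst q" "snd q"] p q rq
      by (auto simp: topspace_tetrahedra r_def)
    ultimately show "R p q" by (simp add: E_def)
  qed
  have h5: "h p = h q" if gl: "glued G p q" and t: "snd p c + snd p d \<le> 1 / 2" for p q
  proof -
    obtain i where i: "joined G i (fst p) (fst q)" "snd p = snd q" "snd p i = 0" "snd p \<in> standard_simplex 3"
      using gl by (auto simp: glued_iff)
    define x where "x = snd p"
    define r where "r = 2 * (x c + x d)"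
    have hc: "half_coords (4 * x a) (across k x) r" for k
      using coords_of_simplex i(4) t by (simp add: x_def r_def)
    have sum: "x a + x b + x c + x d = 1" using i(4) in_simplex x_def by auto
    have "H k (4 * x a) (across k x) r = H l (4 * x a) (across l x) r"
      if "k < N" "l = Suc k mod N" "if even k then x c = 0 else x d = 0" for k l
    proof -
      have "across k x = r" "across l x = 0"
        using that even_succ[of k] by (auto simp: across_def r_def split: if_splits)
      then show ?thesis using ball_step[of k "4 * x a" r] hc[of k] that by simp
    qed
    moreover have "H k (4 * x a) (across k x) r = H (ma k) (4 * x a) (across (ma k) x) r"
      if "k < N" "x a = 0" for k
    proof -
      have "across (ma k) x = r - across k x"
        using m_parity(1)[OF that(1)] by (auto simp: across_def r_def)
      then show ?thesis using ball_low[of k "across k x" r] hc[of k] that by simp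
    qed
    moreover have "H k (4 * x a) (across k x) r = H (mb k) (4 * x a) (across (mb k) x) r"
      if "k < N" "x b = 0" for k
    proof -
      \<comment> \<open>Since the coordinates sum to 1, the face \<open>x b = 0\<close> is the one
        where \<open>v\<close> reaches its upper bound.\<close>
      have "across (mb k) x = r - across k x" "4 * x a = 4 - 2 * r"
        using m_parity(2)[OF that(1)] sum that by (auto simp: across_def r_def)
      then show ?thesis using ball_high[of k r "across k x"] hc[of k] that by simp
    qed
    ultimately have "H (idx (fst p)) (4 * x a) (across (idx (fst p)) x) r =
        H (idx (fst q)) (4 * x a) (across (idx (fst q)) x) r"
    proof -
      assume st: "\<And>k l. \<lbrakk>k < N; l = Suc k mod N; if even k then x c = 0 else x d = 0\<rbrakk> \<Longrightarrow>
          H k (4 * x a) (across k x) r = H l (4 * x a) (across l x) r"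
        and lo: "\<And>k. \<lbrakk>k < N; x a = 0\<rbrakk> \<Longrightarrow> H k (4 * x a) (across k x) r = H (ma k) (4 * x a) (across (ma k) x) r"
        and hi: "\<And>k. \<lbrakk>k < N; x b = 0\<rbrakk> \<Longrightarrow> H k (4 * x a) (across k x) r = H (mb k) (4 * x a) (across (mb k) x) r"
      have "i \<in> {a, b, c, d}" using i(1) color_le colours(2) by (auto simp: joined_def)
      then show ?thesis
      proof (elim insertE emptyE)
        assume "i = a"
        then obtain k where "k < N" "fst p = P k" "fst q = P (ma k)" using joined_a i by blast
        then show ?thesis using lo[of k] i \<open>i = a\<close> m_less by (simp add: idx_P x_def)
      next
        assume "i = b"
        then obtain k where "k < N" "fst p = P k" "fst q = P (mb k)" using joined_b i by blast
        then show ?thesis using hi[of k] i \<open>i = b\<close> m_less by (simp add: idx_P x_def)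
      next
        assume "i = c"
        then obtain k where "k < N" "even k" "{fst p, fst q} = {P k, P (Suc k mod N)}" using joined_c i by blast
        then show ?thesis
          using st[of k "Suc k mod N"] i \<open>i = c\<close> succ by (auto simp: idx_P x_def doubleton_eq_iff)
      next
        assume "i = d"
        then obtain k where "k < N" "odd k" "{fst p, fst q} = {P k, P (Suc k mod N)}" using joined_d i by blast
        then show ?thesis
          using st[of k "Suc k mod N"] i \<open>i = d\<close> succ by (auto simp: idx_P x_def doubleton_eq_iff)
      qed
    qed
    then show ?thesis using i(2) by (simp add: h_def x_def r_def)
  qed
  show ?thesis
  proof (rule that[of h], goal_cases)
    case (4 p q R)
    show ?case by (rule h4[OF 4])
  next
    case (5 p q)
    show ?case by (rule h5[OF 5])
  qed (use h1 h2 h3 in auto)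
qed

end

text \<open>Each cycle provides a chart of one half. By \<open>cd\<close> and the sum 1 of the
  barycentric coordinates, the half belonging to the second cycle is the complement of the
  first.\<close>

theorem induced_space_sphere:
  assumes 1: "gem_cycle G N P a b c d ma mb" and 2: "gem_cycle G M Q c' d' a' b' mc md"
    and cd: "{a', b'} = {a, b}"
  shows "induced_space G homeomorphic_space nsphere 3"
proof -
  interpret A: gem_cycle G N P a b c d ma mb by fact
  interpret B: gem_cycle G M Q c' d' a' b' mc md by fact
  let ?T = "tetrahedra G" and ?\<tau> = "\<lambda>p. snd p c + snd p d"
  have tB: "snd p a' + snd p b' = 1 - ?\<tau> p" if "p \<in> topspace ?T" for p
  proof -
    have "snd p a + snd p b + snd p c + snd p d = 1"
      using that A.in_simplex by (auto simp: A.topspace_tetrahedra)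
    moreover have "a' = a \<and> b' = b \<or> a' = b \<and> b' = a" using cd by (auto simp: doubleton_eq_iff)
    ultimately show ?thesis by auto
  qed
  obtain hA where hA:
    "continuous_map (subtopology ?T {p \<in> topspace ?T. ?\<tau> p \<le> 1 / 2}) euclidean hA"
    "\<And>p. \<lbrakk>p \<in> topspace ?T; ?\<tau> p \<le> 1 / 2\<rbrakk> \<Longrightarrow> taxi (hA p) \<le> 1 \<and> (taxi (hA p) = 1 \<longleftrightarrow> ?\<tau> p = 1 / 2)"
    "\<And>y. taxi y \<le> 1 \<Longrightarrow> \<exists>p\<in>topspace ?T. ?\<tau> p \<le> 1 / 2 \<and> hA p = y"
    "\<And>p q R. \<lbrakk>p \<in> topspace ?T; ?\<tau> p \<le> 1 / 2; q \<in> topspace ?T; ?\<tau> q \<le> 1 / 2; hA p = hA q; equivp R;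
       \<And>x y. \<lbrakk>glued G x y; ?\<tau> x = ?\<tau> p\<rbrakk> \<Longrightarrow> R x y\<rbrakk> \<Longrightarrow> R p q"
    "\<And>p q. \<lbrakk>glued G p q; ?\<tau> p \<le> 1 / 2\<rbrakk> \<Longrightarrow> hA p = hA q"
    by (rule A.half_chart) blast
  let ?\<sigma> = "\<lambda>p. snd p a' + snd p b'"
  obtain hB where hB:
    "continuous_map (subtopology ?T {p \<in> topspace ?T. ?\<sigma> p \<le> 1 / 2}) euclidean hB"
    "\<And>p. \<lbrakk>p \<in> topspace ?T; ?\<sigma> p \<le> 1 / 2\<rbrakk> \<Longrightarrow> taxi (hB p) \<le> 1 \<and> (taxi (hB p) = 1 \<longleftrightarrow> ?\<sigma> p = 1 / 2)"
    "\<And>y. taxi y \<le> 1 \<Longrightarrow> \<exists>p\<in>topspace ?T. ?\<sigma> p \<le> 1 / 2 \<and> hB p = y"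
    "\<And>p q R. \<lbrakk>p \<in> topspace ?T; ?\<sigma> p \<le> 1 / 2; q \<in> topspace ?T; ?\<sigma> q \<le> 1 / 2; hB p = hB q; equivp R;
       \<And>x y. \<lbrakk>glued G x y; ?\<sigma> x = ?\<sigma> p\<rbrakk> \<Longrightarrow> R x y\<rbrakk> \<Longrightarrow> R p q"
    "\<And>p q. \<lbrakk>glued G p q; ?\<sigma> p \<le> 1 / 2\<rbrakk> \<Longrightarrow> hB p = hB q"
    by (rule B.half_chart) blast
  have \<sigma>: "?\<sigma> p \<le> 1 / 2 \<longleftrightarrow> 1 / 2 \<le> ?\<tau> p" "?\<sigma> p = 1 / 2 \<longleftrightarrow> ?\<tau> p = 1 / 2" if "p \<in> topspace ?T" for p
    using tB[OF that] by auto
  have T: "compact_space ?T"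
    unfolding tetrahedra_def
    using A.finite_verts compactin_standard_simplex
    by (auto simp: compact_space_prod_topology compact_space_discrete_topology compact_space_subtopology)
  note proj = continuous_map_barycentric[of G]
  have \<tau>: "continuous_map ?T euclideanreal ?\<tau>" by (intro continuous_intros proj)
  have set: "{p \<in> topspace ?T. ?\<sigma> p \<le> 1 / 2} = {p \<in> topspace ?T. 1 / 2 \<le> ?\<tau> p}" using \<sigma> by blast
  have eqv: "equivp (\<lambda>x y. g x = g y)" for g :: "'a \<times> (nat \<Rightarrow> real) \<Rightarrow> complex \<times> real"
    by (intro equivpI reflpI sympI transpI) auto
  \<comment> \<open>Each chart is constant on glued points. Hence equality under \<open>hB\<close>
    is an admissible relation for the injectivity of \<open>hA\<close> on the level 1/2, and
    conversely, so that both charts have the same fibres on the common boundary.\<close>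
  have ab: "hA x = hA y \<longleftrightarrow> hB x = hB y"
    if xy: "x \<in> topspace ?T" "y \<in> topspace ?T" "?\<tau> x = 1 / 2" "?\<tau> y = 1 / 2" for x y
  proof
    assume eq: "hA x = hA y"
    show "hB x = hB y"
    proof (rule hA(4)[OF xy(1) _ xy(2) _ eq eqv])
      fix p q assume "glued G p q" "?\<tau> p = ?\<tau> x"
      then show "hB p = hB q" using hB(5)[of p q] A.glued_in[of p q] \<sigma>[of p] xy by auto
    qed (use xy in auto)
  next
    assume eq: "hB x = hB y"
    show "hA x = hA y"
    proof (rule hB(4)[OF xy(1) _ xy(2) _ eq eqv])
      fix p q assume "glued G p q" "?\<sigma> p = ?\<sigma> x"
      then show "hA p = hA q" using hA(5)[of p q] A.glued_in[of p q] tB[of p] tB[OF xy(1)] xy by auto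
    qed (use xy \<sigma> in auto)
  qed
  have b2: "taxi (hB x) \<le> 1 \<and> (taxi (hB x) = 1 \<longleftrightarrow> ?\<tau> x = 1 / 2)" if "x \<in> topspace ?T" "1 / 2 \<le> ?\<tau> x" for x
    using hB(2)[of x] \<sigma>[of x] that by blast
  have b3: "\<exists>x\<in>topspace ?T. 1 / 2 \<le> ?\<tau> x \<and> hB x = y" if "taxi y \<le> 1" for y
    using hB(3)[OF that] \<sigma> by blast
  obtain f where f: "continuous_map ?T (nsphere 3) f" "f ` topspace ?T = topspace (nsphere 3)"
    "\<And>x y. \<lbrakk>x \<in> topspace ?T; y \<in> topspace ?T\<rbrakk> \<Longrightarrow> f x = f y \<longleftrightarrow>
      ?\<tau> x \<le> 1 / 2 \<and> ?\<tau> y \<le> 1 / 2 \<and> hA x = hA y \<or> 1 / 2 \<le> ?\<tau> x \<and> 1 / 2 \<le> ?\<tau> y \<and> hB x = hB y"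
    by (rule glue_balls[OF T \<tau> hA(1) hB(1)[unfolded set] hA(2) b2 hA(3) b3 ab]) (assumption+, rule that)
  show ?thesis
    unfolding induced_space_def
  proof (rule quotient_homeomorphic[OF f(1,2) T])
    show "Hausdorff_space (nsphere 3)"
      unfolding nsphere by (intro Hausdorff_space_subtopology) (simp add: Hausdorff_space_product_topology)
    have eq: "equivp (equivclp (glued G))" by (rule equivp_evquivclp)
    then show "equiv UNIV {(p, q). equivclp (glued G) p q}"
      by (simp add: equivp_equiv)
    fix x y assume xy: "x \<in> topspace ?T" "y \<in> topspace ?T"
    have fgl: "f p = f q" if "glued G p q" for p q
    proof -
      have pq: "p \<in> topspace ?T" "q \<in> topspace ?T" "snd p = snd q"
        using A.glued_in[OF that] that by (auto simp: glued_iff)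
      show ?thesis
        unfolding f(3)[OF pq(1,2)]
        using hA(5)[OF that] hB(5)[OF that] pq \<sigma>[OF pq(1)] by (cases "?\<tau> p \<le> 1 / 2") auto
    qed
    have const: "f p = f q" if "equivclp (glued G) p q" for p q
      using that
    proof (induction rule: equivclp_induct)
      case (step y z)
      then show ?case using fgl[of y z] fgl[of z y] by auto
    qed simp
    have "equivclp (glued G) x y" if "f x = f y"
      using that unfolding f(3)[OF xy]
    proof (elim disjE conjE)
      assume "?\<tau> x \<le> 1 / 2" "?\<tau> y \<le> 1 / 2" "hA x = hA y"
      then show ?thesis by (intro hA(4)[OF xy(1) _ xy(2) _ _ eq]) auto
    next
      assume "1 / 2 \<le> ?\<tau> x" "1 / 2 \<le> ?\<tau> y" "hB x = hB y"
      then show ?thesis using \<sigma> xy by (intro hB(4)[OF xy(1) _ xy(2) _ _ eq]) auto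
    qed
    then show "f x = f y \<longleftrightarrow> (x, y) \<in> {(p, q). equivclp (glued G) p q}" using const[of x y] by auto
  qed
qed

section \<open>The order of the crossings on a Jordan curve\<close>

lemma simple_path_eqD:
  assumes "simple_path g" "g x = g y" "x \<in> {0..1}" "y \<in> {0..1}"
  shows "x = y \<or> x = 0 \<and> y = 1 \<or> x = 1 \<and> y = 0"
  using assms unfolding simple_path_def loop_free_def by blast

text \<open>The closed arc and the closed rest of the loop cover \<open>S\<close> and meet only in
  the two excluded points, so that a connected \<open>S\<close> stays in one of them.\<close>

lemma connected_within_open_arc:
  fixes g :: "real \<Rightarrow> 'a::t2_space"
  assumes g: "simple_path g" and \<alpha>\<beta>: "0 \<le> \<alpha>" "\<alpha> < \<beta>" "\<beta> \<le> 1"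
    and S: "connected S" "S \<subseteq> path_image g - {g \<alpha>, g \<beta>}" "S \<inter> g ` {\<alpha><..<\<beta>} \<noteq> {}"
  shows "S \<subseteq> g ` {\<alpha><..<\<beta>}"
proof -
  have cont: "continuous_on {0..1} g" using g by (simp add: simple_path_def path_def)
  let ?I = "g ` {\<alpha>..\<beta>}" and ?O = "g ` ({0..\<alpha>} \<union> {\<beta>..1})"
  have "compact ?I" "compact ?O"
    using \<alpha>\<beta> by (auto intro!: compact_continuous_image continuous_on_subset[OF cont] compact_Un)
  then have cl: "closed ?I" "closed ?O" by (simp_all add: compact_imp_closed)
  have cover: "S \<subseteq> ?I \<union> ?O"
  proof
    fix z assume "z \<in> S"
    then obtain x where "x \<in> {0..1}" "z = g x" using S(2) unfolding path_image_def by blast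
    then show "z \<in> ?I \<union> ?O" by (cases "x \<le> \<alpha>"; cases "\<beta> \<le> x") auto
  qed
  have disj: "z \<in> {g \<alpha>, g \<beta>}" if z: "z \<in> ?I" "z \<in> ?O" for z
  proof -
    obtain x y where xy: "z = g x" "x \<in> {\<alpha>..\<beta>}" "z = g y" "y \<in> {0..\<alpha>} \<union> {\<beta>..1}"
      using z by blast
    then have "x = y \<or> x = 0 \<and> y = 1 \<or> x = 1 \<and> y = 0"
      using simple_path_eqD[OF g, of x y] \<alpha>\<beta> by auto
    then have "x = \<alpha> \<or> x = \<beta>" using xy(2,4) \<alpha>\<beta> by auto
    then show ?thesis using xy(1) by auto
  qed
  have "?I \<inter> S = {} \<or> ?O \<inter> S = {}"
    by (rule connected_closedD[OF S(1) _ cover cl]) (use disj S(2) in blast)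
  moreover have "g ` {\<alpha><..<\<beta>} \<subseteq> ?I" by (rule image_mono) auto
  then have "?I \<inter> S \<noteq> {}" using S(3) by blast
  ultimately have O: "?O \<inter> S = {}" by blast
  show ?thesis
  proof
    fix z assume z: "z \<in> S"
    then obtain x where x: "x \<in> {\<alpha>..\<beta>}" "z = g x" using cover O by blast
    moreover have "x \<noteq> \<alpha>" "x \<noteq> \<beta>" using S(2) z x by auto
    ultimately show "z \<in> g ` {\<alpha><..<\<beta>}" by auto
  qed
qed

text \<open>The curve \<open>X\<close>, parametrised by the loop \<open>g\<close>, meets \<open>Y\<close> exactly at the times
  \<open>0 = t 0 < \<dots> < t N = 1\<close>, the last of which is the base point again.\<close>

locale crossing_order =
  fixes X Y :: "complex set" and N :: nat and g :: "real \<Rightarrow> complex" and t :: "nat \<Rightarrow> real"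
  assumes g: "simple_path g" "pathfinish g = pathstart g" "path_image g = X"
    and t0: "t 0 = 0" and tN: "t N = 1" and t_step: "\<And>k. k < N \<Longrightarrow> t k < t (Suc k)"
    and hits: "\<And>x. x \<in> {0..1} \<Longrightarrow> g x \<in> Y \<longleftrightarrow> (\<exists>k\<le>N. x = t k)"
begin

definition crossing :: "nat \<Rightarrow> complex" where
  "crossing k = g (t k)"

definition segment :: "nat \<Rightarrow> complex set" where
  "segment k = g ` {t k<..<t (Suc k)}"

lemma N_pos: "0 < N"
  using t0 tN by (cases N) auto

lemma t_less: "k < l \<Longrightarrow> l \<le> N \<Longrightarrow> t k < t l"
proof (induction l)
  case (Suc l)
  then have "t l < t (Suc l)" using t_step by simp
  then show ?case using Suc by (cases "k = l") auto
qed simp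

lemma t_le: "k \<le> l \<Longrightarrow> l \<le> N \<Longrightarrow> t k \<le> t l"
  using t_less by (cases "k = l") (auto intro: less_imp_le)

lemma t_bounds: "k \<le> N \<Longrightarrow> t k \<in> {0..1}"
  using t_le[of 0 k] t_le[of k N] t0 tN by auto

lemma t_less_iff: "k \<le> N \<Longrightarrow> l \<le> N \<Longrightarrow> t k < t l \<longleftrightarrow> k < l"
  using t_less[of k l] t_le[of l k] by (cases "k < l") auto

lemma cont: "continuous_on {0..1} g"
  using g(1) by (simp add: simple_path_def path_def)

lemma loop: "g 1 = g 0"
  using g(2) by (simp add: pathfinish_def pathstart_def)

lemma crossing_succ: "k < N \<Longrightarrow> crossing (Suc k mod N) = g (t (Suc k))"
  using loop t0 tN by (cases "Suc k = N") (auto simp: crossing_def)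

lemma inj_crossing: "inj_on crossing {..<N}"
proof (rule inj_onI)
  fix k l assume kl: "k \<in> {..<N}" "l \<in> {..<N}" "crossing k = crossing l"
  then have "t k < 1" "t l < 1" using t_less[of k N] t_less[of l N] tN by auto
  then have "t k = t l"
    using simple_path_eqD[OF g(1), of "t k" "t l"] kl t_bounds[of k] t_bounds[of l] by (auto simp: crossing_def)
  then show "k = l" using t_less_iff[of k l] t_less_iff[of l k] kl by (metis lessThan_iff less_imp_le less_irrefl linorder_neqE_nat)
qed

lemma crossing_image: "crossing ` {..<N} = X \<inter> Y"
proof
  show "crossing ` {..<N} \<subseteq> X \<inter> Y"
  proof
    fix z assume "z \<in> crossing ` {..<N}"
    then obtain k where "k < N" "z = g (t k)" by (auto simp: crossing_def)
    moreover from this have "g (t k) \<in> Y" using hits[OF t_bounds[of k]] less_imp_le[of k N] by blast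
    ultimately show "z \<in> X \<inter> Y" using t_bounds[of k] g(3) by (auto simp: path_image_def)
  qed
  show "X \<inter> Y \<subseteq> crossing ` {..<N}"
  proof
    fix z assume "z \<in> X \<inter> Y"
    then obtain x where x: "x \<in> {0..1}" "z = g x" "g x \<in> Y" using g(3) by (auto simp: path_image_def)
    then obtain k where k: "k \<le> N" "x = t k" using hits by blast
    show "z \<in> crossing ` {..<N}"
    proof (cases "k = N")
      case True
      then have "z = crossing 0" using x k loop t0 tN by (simp add: crossing_def)
      then show ?thesis using N_pos by blast
    qed (use x k in \<open>auto simp: crossing_def\<close>)
  qed
qed

lemma bij_crossing: "bij_betw crossing {..<N} (X \<inter> Y)"
  using inj_crossing crossing_image by (simp add: bij_betw_def)

lemma no_hits: "k < N \<Longrightarrow> x \<in> {t k<..<t (Suc k)} \<Longrightarrow> x \<in> {0..1} \<and> g x \<notin> Y"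
proof -
  assume k: "k < N" and x: "x \<in> {t k<..<t (Suc k)}"
  have x01: "x \<in> {0..1}" using x t_bounds[of k] t_bounds[of "Suc k"] k by auto
  have "\<not> (\<exists>l\<le>N. x = t l)"
  proof
    assume "\<exists>l\<le>N. x = t l"
    then obtain l where "l \<le> N" "x = t l" by blast
    then show False using x t_less_iff[of k l] t_less_iff[of l "Suc k"] k by auto
  qed
  then show ?thesis using hits[OF x01] x01 by blast
qed

lemma segment_sub: "k < N \<Longrightarrow> segment k \<subseteq> X - Y"
  using no_hits g(3) by (force simp: segment_def path_image_def)

lemma segment_nonempty: "k < N \<Longrightarrow> segment k \<noteq> {}"
  by (simp add: segment_def not_le t_step)

lemma connected_segment: "k < N \<Longrightarrow> connected (segment k)"
  unfolding segment_def using no_hits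
  by (intro connected_continuous_image continuous_on_subset[OF cont]) auto

lemma segment_cover: "z \<in> X - Y \<Longrightarrow> \<exists>k<N. z \<in> segment k"
proof -
  assume "z \<in> X - Y"
  then obtain x where x: "x \<in> {0..1}" "z = g x" "g x \<notin> Y" using g(3) by (auto simp: path_image_def)
  define k where "k = (GREATEST k. k \<le> N \<and> t k \<le> x)"
  have ex: "0 \<le> N \<and> t 0 \<le> x" using x t0 by auto
  have k: "k \<le> N \<and> t k \<le> x"
    unfolding k_def by (rule GreatestI_nat[of _ 0 N]) (use ex in auto)
  have kmax: "l \<le> k" if "l \<le> N" "t l \<le> x" for l
    unfolding k_def by (rule Greatest_le_nat[of _ _ N]) (use that in auto)
  have ne: "x \<noteq> t l" if "l \<le> N" for l using hits[OF x(1)] x(3) that by blast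
  have "k \<noteq> N" using k ne[of N] tN x(1) by auto
  then have "k < N" using k by auto
  then have "x < t (Suc k)" using kmax[of "Suc k"] by force
  then have "z \<in> segment k" using k ne[of k] x by (auto simp: segment_def)
  then show ?thesis using \<open>k < N\<close> by blast
qed

lemma connected_in_segment:
  assumes "k < N" "connected S" "S \<subseteq> X - Y" "S \<inter> segment k \<noteq> {}"
  shows "S \<subseteq> segment k"
  unfolding segment_def
proof (rule connected_within_open_arc[OF g(1)])
  have "g (t l) \<in> Y" if "l \<le> N" for l using hits[OF t_bounds[OF that]] that by blast
  from this[of k] this[of "Suc k"] show "S \<subseteq> path_image g - {g (t k), g (t (Suc k))}"
    using assms g(3) by auto
qed (use assms t_bounds[of k] t_bounds[of "Suc k"] t_step in \<open>auto simp: segment_def\<close>)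

lemma components_eq: "components (X - Y) = segment ` {..<N}"
proof -
  have seg: "segment k \<in> components (X - Y)" if "k < N" for k
    unfolding in_components_maximal
    using that segment_sub segment_nonempty connected_segment connected_in_segment
    by (metis inf.absorb_iff2 inf_commute subset_antisym)
  moreover have "C \<in> segment ` {..<N}" if C: "C \<in> components (X - Y)" for C
  proof -
    obtain z where z: "z \<in> C" using in_components_nonempty[OF C] by blast
    then obtain k where k: "k < N" "z \<in> segment k"
      using in_components_subset[OF C] segment_cover by blast
    then have "C = segment k" using components_nonoverlap[OF C seg[OF k(1)]] z by blast
    then show ?thesis using k by blast
  qed
  ultimately show ?thesis by blast
qed

lemma closure_segment: "k < N \<Longrightarrow> closure (segment k) = g ` {t k..t (Suc k)}"
proof -
  assume k: "k < N"
  then have sub: "{t k..t (Suc k)} \<subseteq> {0..1}" using t_bounds[of k] t_bounds[of "Suc k"] by auto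
  have "closure {t k<..<t (Suc k)} = {t k..t (Suc k)}" using t_step[OF k] by simp
  then have "g ` {t k..t (Suc k)} \<subseteq> closure (segment k)"
    unfolding segment_def
    using image_closure_subset[of "{t k<..<t (Suc k)}" g "closure (g ` {t k<..<t (Suc k)})"]
      continuous_on_subset[OF cont sub] closure_subset[of "g ` {t k<..<t (Suc k)}"] by simp
  moreover have "closed (g ` {t k..t (Suc k)})"
    by (intro compact_imp_closed compact_continuous_image continuous_on_subset[OF cont sub]) auto
  then have "closure (segment k) \<subseteq> g ` {t k..t (Suc k)}"
    unfolding segment_def by (intro closure_minimal) auto
  ultimately show ?thesis by blast
qed

lemma closure_segment_eq: "k < N \<Longrightarrow> closure (segment k) = segment k \<union> {crossing k, crossing (Suc k mod N)}"
proof -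
  assume k: "k < N"
  have "{t k..t (Suc k)} = {t k<..<t (Suc k)} \<union> {t k, t (Suc k)}" using t_step[OF k] by auto
  then show ?thesis
    unfolding closure_segment[OF k] crossing_succ[OF k] by (auto simp: segment_def crossing_def)
qed

lemma segment_ends: "k < N \<Longrightarrow> closure (segment k) \<inter> (X \<inter> Y) = {crossing k, crossing (Suc k mod N)}"
  using closure_segment_eq segment_sub crossing_image N_pos mod_less_divisor[OF N_pos, of "Suc k"] by fastforce

lemma segment_disjoint: "k < N \<Longrightarrow> l < N \<Longrightarrow> k \<noteq> l \<Longrightarrow> segment k \<inter> segment l = {}"
proof (rule ccontr)
  assume kl: "k < N" "l < N" "k \<noteq> l" "segment k \<inter> segment l \<noteq> {}"
  then obtain x y where xy: "x \<in> {t k<..<t (Suc k)}" "y \<in> {t l<..<t (Suc l)}" "g x = g y"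
    unfolding segment_def by blast
  then have "x = y \<or> x = 0 \<and> y = 1 \<or> x = 1 \<and> y = 0"
    using simple_path_eqD[OF g(1), of x y] no_hits kl(1,2) by blast
  moreover have "0 < x" "0 < y" using xy t_bounds[of k] t_bounds[of l] kl by auto
  ultimately have "x = y" by auto
  then have "t k < t (Suc l)" "t l < t (Suc k)" using xy by auto
  then show False using t_less_iff[of k "Suc l"] t_less_iff[of l "Suc k"] kl by auto
qed

end

lemma crossing_order_exists:
  assumes X: "Jordan_curve X" and N: "card (X \<inter> Y) = N" "0 < N"
  obtains g t where "crossing_order X Y N g t"
proof -
  obtain g0 where g0: "simple_path g0" "pathfinish g0 = pathstart g0" "path_image g0 = X"
    using X by (auto simp: Jordan_curve_def)
  have fin: "finite (X \<inter> Y)" "X \<inter> Y \<noteq> {}" using N by (auto intro: card_ge_0_finite)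
  then obtain p where p: "p \<in> X" "p \<in> Y" by blast
  then obtain a where a: "a \<in> {0..1}" "g0 a = p" using g0(3) by (auto simp: path_image_def)
  \<comment> \<open>The loop is rotated so that its base point is a crossing.\<close>
  define g where "g = shiftpath a g0"
  have g: "simple_path g" "pathfinish g = pathstart g" "path_image g = X" "g 0 = p"
    using simple_path_shiftpath[of g0 a] path_image_shiftpath[of a g0] closed_shiftpath[of g0 a] a g0
    by (auto simp: g_def shiftpath_def)
  have g1: "g 1 = p" using g by (simp add: pathfinish_def pathstart_def)
  define T where "T = {x \<in> {0..1}. g x \<in> Y}"
  have T01: "0 \<in> T" "1 \<in> T" using g g1 p by (auto simp: T_def)
  have inj: "inj_on g (T - {1})"
    by (rule inj_onI) (use simple_path_eqD[OF g(1)] in \<open>force simp: T_def\<close>)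
  have img: "g ` (T - {1}) = X \<inter> Y"
  proof
    show "g ` (T - {1}) \<subseteq> X \<inter> Y" using g(3) by (auto simp: T_def path_image_def)
    show "X \<inter> Y \<subseteq> g ` (T - {1})"
    proof
      fix z assume z: "z \<in> X \<inter> Y"
      then obtain x where x: "x \<in> {0..1}" "z = g x" using g(3) by (auto simp: path_image_def)
      show "z \<in> g ` (T - {1})"
      proof (cases "x = 1")
        case True
        then have "z = g 0" using x g1 g(4) by simp
        then show ?thesis using T01 by auto
      qed (use x z in \<open>auto simp: T_def\<close>)
    qed
  qed
  have finT: "finite T" using finite_imageD[of g "T - {1}"] inj img fin by auto
  have "card (T - {1}) = N" using card_image[OF inj] img N by simp
  \<comment> \<open>The crossing at the base point is met at time 0 and again at time 1, hence one
    time more than there are crossings.\<close>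
  then have card: "card T = Suc N" using card.remove[OF finT T01(2)] by simp
  define xs where "xs = sorted_list_of_set T"
  have xs: "set xs = T" "length xs = Suc N" "sorted_wrt (<) xs"
    using finT card by (auto simp: xs_def)
  have nth: "xs ! k < xs ! l" if "k < l" "l \<le> N" for k l
    using xs that by (auto intro: sorted_wrt_nth_less)
  have memT: "x \<in> T \<longleftrightarrow> (\<exists>k\<le>N. x = xs ! k)" for x
    using xs by (metis in_set_conv_nth less_Suc_eq_le)
  have "xs ! 0 = 0"
  proof -
    obtain k where k: "k \<le> N" "0 = xs ! k" using memT T01 by blast
    moreover have "xs ! 0 \<in> T" using memT by blast
    then have "0 \<le> xs ! 0" by (simp add: T_def)
    ultimately show ?thesis using nth[of 0 k] by (cases "k = 0") auto
  qed
  moreover have "xs ! N = 1"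
  proof -
    obtain k where k: "k \<le> N" "1 = xs ! k" using memT T01 by blast
    moreover have "xs ! N \<in> T" using memT by blast
    then have "xs ! N \<le> 1" by (simp add: T_def)
    ultimately show ?thesis using nth[of k N] by (cases "k = N") auto
  qed
  ultimately have "crossing_order X Y N g ((!) xs)"
    using g nth memT by unfold_locales (auto simp: T_def)
  then show ?thesis by (rule that)
qed

section \<open>Chords of a Jordan curve\<close>

lemma connected_side:
  fixes g :: "real \<Rightarrow> complex"
  assumes g: "simple_path g" "pathfinish g = pathstart g" and A: "connected A" "A \<inter> path_image g = {}"
  shows "A \<subseteq> inside (path_image g) \<or> A \<subseteq> outside (path_image g)"
proof -
  note J = Jordan_inside_outside[OF g]
  have "inside (path_image g) \<inter> A = {} \<or> outside (path_image g) \<inter> A = {}"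
    by (rule connectedD[OF A(1)]) (use J A(2) in blast)+
  then show ?thesis using J A(2) by blast
qed

text \<open>The chord and the two arcs \<open>u\<close>, \<open>d\<close> of the curve between its
  ends form a theta curve, which splits the inside into two regions. The connected set
  \<open>D\<close> lies in one of them, and the closure of that region meets the curve only in the
  arc bounding it.\<close>

lemma chord_separates_inside:
  fixes g c :: "real \<Rightarrow> complex"
  assumes g: "simple_path g" "pathfinish g = pathstart g"
    and c: "simple_path c" "pathstart c = a" "pathfinish c = b" "a \<noteq> b"
    and cg: "path_image c \<inter> path_image g = {a, b}" "path_image c - {a, b} \<subseteq> inside (path_image g)"
    and D: "connected D" "D \<subseteq> inside (path_image g)" "D \<inter> path_image c = {}"
    and p: "p \<in> closure D" "p \<in> path_image g - {a, b}"
    and q: "q \<in> closure D" "q \<in> path_image g - {a, b}"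
  obtains S where "connected S" "S \<subseteq> path_image g - {a, b}" "p \<in> S" "q \<in> S"
proof -
  have ab: "a \<in> path_image g" "b \<in> path_image g" using cg(1) by auto
  obtain u d where ud: "arc u" "arc d" "pathstart u = a" "pathfinish u = b" "pathstart d = b" "pathfinish d = a"
    "path_image u \<inter> path_image d = {a, b}" "path_image u \<union> path_image d = path_image g"
    using exists_double_arc[OF g ab c(4)] by metis
  \<comment> \<open>The midpoint shows that the chord does enter the inside, as the theorem on theta
    curves requires.\<close>
  have "c (1 / 2) \<in> path_image c" by (simp add: path_image_def)
  moreover have "c (1 / 2) \<noteq> a" "c (1 / 2) \<noteq> b"
    using simple_path_eqD[OF c(1), of "1 / 2" 0] simple_path_eqD[OF c(1), of "1 / 2" 1] c(2,3)
    by (auto simp: pathstart_def pathfinish_def)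
  ultimately have ne: "path_image c \<inter> inside (path_image u \<union> path_image (reversepath d)) \<noteq> {}"
    using cg(2) ud(8) by auto
  have uc: "path_image u \<inter> path_image c = {a, b}" and dc: "path_image (reversepath d) \<inter> path_image c = {a, b}"
    using ud(7,8) cg(1) by auto
  obtain dis: "inside (path_image u \<union> path_image c) \<inter> inside (path_image (reversepath d) \<union> path_image c) = {}"
    and un: "inside (path_image u \<union> path_image c) \<union> inside (path_image (reversepath d) \<union> path_image c) \<union>
       (path_image c - {a, b}) = inside (path_image u \<union> path_image (reversepath d))"
    by (rule split_inside_simple_closed_curve[of u a b "reversepath d" c])
      (use ud c uc dc ne in \<open>auto intro: arc_imp_simple_path simple_path_reversepath\<close>)
  have cl: "closed (path_image u \<union> path_image c)" "closed (path_image d \<union> path_image c)"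
    using ud(1,2) c(1) by (auto intro!: closed_Un closed_path_image simp: arc_imp_path simple_path_imp_path)
  have on: "connected (path_image w - {a, b}) \<and> p \<in> path_image w - {a, b} \<and> q \<in> path_image w - {a, b}"
    if w: "arc w" "{pathstart w, pathfinish w} = {a, b}" "path_image w \<subseteq> path_image g"
      "closed (path_image w \<union> path_image c)" "D \<subseteq> inside (path_image w \<union> path_image c)"
      "inside (path_image w \<union> path_image c) \<subseteq> inside (path_image g)" for w
  proof -
    have "closure D \<subseteq> (path_image w \<union> path_image c) \<union> inside (path_image w \<union> path_image c)"
      using closure_mono[OF w(5)] closure_inside_subset[OF w(4)] by blast
    then have "x \<in> path_image w - {a, b}" if "x \<in> closure D" "x \<in> path_image g - {a, b}" for x
      using that w(6) inside_no_overlap[of "path_image g"] cg(1) by blast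
    moreover have "connected (path_image w - {a, b})"
      using connected_simple_path_endless[OF arc_imp_simple_path[OF w(1)]] w(2) by simp
    ultimately show ?thesis using p q by blast
  qed
  have "inside (path_image u \<union> path_image c) \<inter> D = {} \<or> inside (path_image d \<union> path_image c) \<inter> D = {}"
  proof (rule connectedD[OF D(1)])
    show "open (inside (path_image u \<union> path_image c))" "open (inside (path_image d \<union> path_image c))"
      using cl by (auto intro: open_inside)
    show "inside (path_image u \<union> path_image c) \<inter> inside (path_image d \<union> path_image c) \<inter> D = {}"
      using dis by auto
    show "D \<subseteq> inside (path_image u \<union> path_image c) \<union> inside (path_image d \<union> path_image c)"
      using un D(2,3) ud(8) by auto
  qed
  then have "D \<subseteq> inside (path_image d \<union> path_image c) \<or> D \<subseteq> inside (path_image u \<union> path_image c)"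
    using un D(2,3) ud(8) by auto
  then show ?thesis
  proof
    assume *: "D \<subseteq> inside (path_image d \<union> path_image c)"
    have "path_image d - {a, b} \<subseteq> path_image g - {a, b}" using ud(8) by blast
    moreover note on[OF ud(2) _ _ cl(2) *]
    moreover have "inside (path_image d \<union> path_image c) \<subseteq> inside (path_image g)" using un ud(8) by auto
    moreover have "{pathstart d, pathfinish d} = {a, b}" "path_image d \<subseteq> path_image g" using ud by auto
    ultimately show ?thesis using that by blast
  next
    assume *: "D \<subseteq> inside (path_image u \<union> path_image c)"
    have "path_image u - {a, b} \<subseteq> path_image g - {a, b}" using ud(8) by blast
    moreover note on[OF ud(1) _ _ cl(1) *]
    moreover have "inside (path_image u \<union> path_image c) \<subseteq> inside (path_image g)" using un ud(8) by auto
    moreover have "{pathstart u, pathfinish u} = {a, b}" "path_image u \<subseteq> path_image g" using ud by auto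
    ultimately show ?thesis using that by blast
  qed
qed

text \<open>The inversion is unbounded near \<open>z0\<close>, so the connected punctured inside
  cannot go to the bounded side of the image curve. That side must then contain the image of a point
  outside, and with it of the whole connected outside.\<close>

lemma inversion_swaps_sides:
  fixes g :: "real \<Rightarrow> complex"
  assumes g: "simple_path g" "pathfinish g = pathstart g" and z0: "z0 \<in> inside (path_image g)"
  defines "i \<equiv> \<lambda>z. inverse (z - z0)"
  shows "simple_path (i \<circ> g)" "pathfinish (i \<circ> g) = pathstart (i \<circ> g)" "path_image (i \<circ> g) = i ` path_image g"
    "i ` outside (path_image g) \<subseteq> inside (i ` path_image g)"
proof -
  let ?X = "path_image g"
  note J = Jordan_inside_outside[OF g]
  have z0X: "z0 \<notin> ?X" "z0 \<notin> outside ?X" using z0 J inside_no_overlap[of ?X] by blast+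
  have cont: "continuous_on (- {z0}) i" unfolding i_def by (intro continuous_intros) auto
  \<comment> \<open>Injective on the whole plane, because \<open>inverse 0 = 0\<close> sends
    \<open>z0\<close> to 0.\<close>
  have inj: "x = y" if "i x = i y" for x y using that unfolding i_def by (metis inverse_inverse_eq diff_add_cancel)
  show sp: "simple_path (i \<circ> g)"
    by (rule simple_path_continuous_image[OF g(1)])
      (use z0X inj in \<open>auto intro: continuous_on_subset[OF cont] simp: inj_on_def\<close>)
  show loop: "pathfinish (i \<circ> g) = pathstart (i \<circ> g)"
    using g(2) by (simp add: pathfinish_compose pathstart_compose)
  show img: "path_image (i \<circ> g) = i ` ?X" by (simp add: path_image_compose)
  note J' = Jordan_inside_outside[OF sp loop, unfolded img]
  have side: "i ` A \<subseteq> inside (i ` ?X) \<or> i ` A \<subseteq> outside (i ` ?X)"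
    if "connected A" "z0 \<notin> A" "A \<inter> ?X = {}" for A
  proof -
    have "connected (i ` A)"
      using that by (intro connected_continuous_image continuous_on_subset[OF cont]) auto
    moreover have "i ` A \<inter> i ` ?X = {}" using that(3) inj by blast
    ultimately show ?thesis using connected_side[OF sp loop] img by metis
  qed
  have "connected (inside ?X - {z0})"
    using J by (intro connected_open_delete) auto
  moreover have "\<not> i ` (inside ?X - {z0}) \<subseteq> inside (i ` ?X)"
  proof
    assume sub: "i ` (inside ?X - {z0}) \<subseteq> inside (i ` ?X)"
    have "bounded (inside (i ` ?X))" using J' by blast
    then obtain B where B: "\<And>w. w \<in> inside (i ` ?X) \<Longrightarrow> cmod w \<le> B" by (auto simp: bounded_iff)
    obtain e where e: "0 < e" "ball z0 e \<subseteq> inside ?X" using J z0 by (metis openE)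
    \<comment> \<open>So small that a point at this distance from \<open>z0\<close> is still inside
      and has an image of modulus greater than \<open>B\<close>.\<close>
    define \<delta> where "\<delta> = min (e / 2) (1 / (\<bar>B\<bar> + 1))"
    have \<delta>: "0 < \<delta>" "\<delta> < e" "\<delta> \<le> 1 / (\<bar>B\<bar> + 1)" using e by (auto simp: \<delta>_def)
    have "z0 + of_real \<delta> \<in> inside ?X - {z0}" using e \<delta> by (auto simp: dist_norm intro!: subsetD[OF e(2)])
    then have "cmod (i (z0 + of_real \<delta>)) \<le> B" using sub B by blast
    then have "1 / \<delta> \<le> B" using \<delta> by (simp add: i_def norm_inverse norm_divide inverse_eq_divide)
    moreover have "\<bar>B\<bar> + 1 \<le> 1 / \<delta>" using \<delta> by (simp add: field_simps)
    ultimately show False by linarith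
  qed
  ultimately have in_out: "i ` (inside ?X - {z0}) \<subseteq> outside (i ` ?X)"
    using side[of "inside ?X - {z0}"] inside_no_overlap[of ?X] by blast
  have "infinite (inside (i ` ?X))" using J' finite_imp_not_open by blast
  \<comment> \<open>The point 0 has to be avoided, since only \<open>z0\<close> is sent to
    it.\<close>
  then obtain w where w: "w \<in> inside (i ` ?X)" "w \<noteq> 0"
    by (metis finite.emptyI finite_insert infinite_imp_nonempty finite_subset insertCI subsetI)
  define z where "z = z0 + inverse w"
  have iz: "i z = w" "z \<noteq> z0" using w by (auto simp: z_def i_def)
  have "z \<notin> ?X" using w iz inside_no_overlap[of "i ` ?X"] by blast
  moreover have "z \<notin> inside ?X" using in_out iz w J' by blast
  ultimately have "z \<in> outside ?X" using J by blast
  moreover have "i ` outside ?X \<subseteq> inside (i ` ?X) \<or> i ` outside ?X \<subseteq> outside (i ` ?X)"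
    using side[of "outside ?X"] J z0X outside_no_overlap[of ?X] by blast
  ultimately show "i ` outside ?X \<subseteq> inside (i ` ?X)" using iz w J' by blast
qed

text \<open>The outside is reduced to the inside by an inversion centred at an inside point; the
  connected set found there is carried back by the inverse map \<open>k\<close>.\<close>

lemma chord_separates:
  fixes g c :: "real \<Rightarrow> complex"
  assumes g: "simple_path g" "pathfinish g = pathstart g"
    and c: "simple_path c" "pathstart c = a" "pathfinish c = b" "a \<noteq> b"
    and W: "W = inside (path_image g) \<or> W = outside (path_image g)"
    and cg: "path_image c \<inter> path_image g = {a, b}" "path_image c - {a, b} \<subseteq> W"
    and D: "connected D" "D \<subseteq> W" "D \<inter> path_image c = {}"
    and p: "p \<in> closure D" "p \<in> path_image g - {a, b}"
    and q: "q \<in> closure D" "q \<in> path_image g - {a, b}"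
  obtains S where "connected S" "S \<subseteq> path_image g - {a, b}" "p \<in> S" "q \<in> S"
proof (cases "W = inside (path_image g)")
  case True
  then show ?thesis
    using chord_separates_inside[OF g c cg(1) _ D(1) _ D(3) p q] cg(2) D(2) that by metis
next
  case False
  then have W: "W = outside (path_image g)" using W by blast
  let ?X = "path_image g"
  note J = Jordan_inside_outside[OF g]
  obtain z0 where z0: "z0 \<in> inside ?X" using J by blast
  define i where "i = (\<lambda>z. inverse (z - z0))"
  note I = inversion_swaps_sides[OF g z0, folded i_def]
  have z0X: "z0 \<notin> ?X" "z0 \<notin> outside ?X" using z0 J inside_no_overlap[of ?X] by blast+
  have cont: "continuous_on (- {z0}) i" unfolding i_def by (intro continuous_intros) auto
  have inj: "x = y" if "i x = i y" for x y using that unfolding i_def by (metis inverse_inverse_eq diff_add_cancel)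
  have zc: "z0 \<notin> path_image c" using cg W z0X by blast
  have Dc: "closure D \<subseteq> - {z0}"
  proof -
    have "closure D \<subseteq> closure (outside ?X)" using D(2) W closure_mono by metis
    also have "\<dots> = outside ?X \<union> ?X" using J closure_Un_frontier[of "outside ?X"] by simp
    finally show ?thesis using z0X by blast
  qed
  have clD: "i ` closure D \<subseteq> closure (i ` D)"
    using image_closure_subset[OF continuous_on_subset[OF cont Dc], of "closure (i ` D)"] closure_subset[of "i ` D"]
    by simp
  have inj_i: "inj i" using inj by (rule injI)
  have c1: "simple_path (i \<circ> c)"
    by (rule simple_path_continuous_image[OF c(1)])
      (use zc inj in \<open>auto intro: continuous_on_subset[OF cont] simp: inj_on_def\<close>)
  have c2: "pathstart (i \<circ> c) = i a" "pathfinish (i \<circ> c) = i b" "i a \<noteq> i b"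
    using c by (simp_all add: pathstart_compose pathfinish_compose inj_eq[OF inj_i])
  have c3: "path_image (i \<circ> c) \<inter> path_image (i \<circ> g) = {i a, i b}"
    unfolding I(3) path_image_compose image_Int[OF inj_i, symmetric] cg(1) by simp
  have "path_image (i \<circ> c) - {i a, i b} = i ` (path_image c - {a, b})"
    by (simp add: path_image_compose image_set_diff[OF inj_i])
  also have "\<dots> \<subseteq> i ` outside ?X" using cg(2) W by (intro image_mono) simp
  also have "\<dots> \<subseteq> inside (path_image (i \<circ> g))" using I(3,4) by simp
  finally have c4: "path_image (i \<circ> c) - {i a, i b} \<subseteq> inside (path_image (i \<circ> g))" .
  have d1: "connected (i ` D)"
    using D(1,2) W z0X by (intro connected_continuous_image continuous_on_subset[OF cont]) auto
  have "i ` D \<subseteq> i ` outside ?X" using D(2) W by (intro image_mono) simp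
  then have d2: "i ` D \<subseteq> inside (path_image (i \<circ> g))" using I(3,4) by simp
  have d3: "i ` D \<inter> path_image (i \<circ> c) = {}"
    unfolding path_image_compose image_Int[OF inj_i, symmetric] D(3) by simp
  have pq: "i p \<in> closure (i ` D)" "i q \<in> closure (i ` D)" using clD p(1) q(1) by (auto dest: subsetD)
  have pq': "i p \<in> path_image (i \<circ> g) - {i a, i b}" "i q \<in> path_image (i \<circ> g) - {i a, i b}"
    unfolding I(3) using p(2) q(2) by (simp_all add: inj_image_mem_iff[OF inj_i] inj_eq[OF inj_i])
  obtain S where S: "connected S" "S \<subseteq> path_image (i \<circ> g) - {i a, i b}" "i p \<in> S" "i q \<in> S"
    by (rule chord_separates_inside[OF I(1,2) c1 c2 c3 c4 d1 d2 d3 pq(1) pq'(1) pq(2) pq'(2)]) blast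
  define k where "k = (\<lambda>w. z0 + inverse w)"
  have ki: "k (i z) = z" for z by (simp add: k_def i_def)
  have "0 \<notin> path_image (i \<circ> g)" using z0X I(3) by (auto simp: i_def)
  then have "connected (k ` S)"
    unfolding k_def using S(1,2) by (intro connected_continuous_image continuous_intros) auto
  moreover have "k ` S \<subseteq> ?X - {a, b}"
  proof
    fix z assume "z \<in> k ` S"
    then obtain w where w: "w \<in> S" "z = k w" by (rule imageE)
    then have "w \<in> path_image (i \<circ> g)" "w \<noteq> i a" "w \<noteq> i b" using S(2) by auto
    moreover from this obtain x where "x \<in> ?X" "w = i x" unfolding I(3) by (elim imageE)
    ultimately show "z \<in> ?X - {a, b}" using w(2) ki[of x] by auto
  qed
  moreover have "p \<in> k ` S" "q \<in> k ` S" using S(3,4) ki by (metis imageI)+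
  ultimately show ?thesis by (rule that)
qed

section \<open>Local sides at a transversal crossing and the alternation of segments\<close>

lemma transversal_crossing_sides:
  assumes Y: "simple_path y" "pathfinish y = pathstart y" "path_image y = Y"
    and tr: "transversal_crossing X Y p" and pY: "p \<in> Y"
  obtains U \<phi> where "open U" "p \<in> U" "continuous_on U \<phi>" "\<phi> p = (0::real)" "inj_on \<phi> (X \<inter> U)"
    "\<And>v w. \<lbrakk>v \<in> U; w \<in> U; \<phi> v < 0; 0 < \<phi> w\<rbrakk> \<Longrightarrow> v \<in> inside Y \<longleftrightarrow> w \<notin> inside Y"
proof -
  obtain U h k where U: "open U" "p \<in> U" and hom: "homeomorphism U (ball 0 1) h k" and hp: "h p = 0"
    and hX: "h ` (X \<inter> U) = {z \<in> ball 0 1. Im z = 0}" and hY: "h ` (Y \<inter> U) = {z \<in> ball 0 1. Re z = 0}"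
    using tr unfolding transversal_crossing_def by blast
  note J = Jordan_inside_outside[OF Y(1,2), unfolded Y(3)]
  have hU: "h z \<in> ball 0 1" "k (h z) = z" if "z \<in> U" for z
    using hom that unfolding homeomorphism_def by blast+
  have injh: "z = w" if "z \<in> U" "w \<in> U" "h z = h w" for z w using hU that by metis
  \<comment> \<open>\<open>Y\<close> cuts the neighbourhood into two halves; each is connected and
    hence lies on one side of \<open>Y\<close>.\<close>
  let ?L = "{z \<in> U. Re (h z) < 0}" and ?R = "{z \<in> U. 0 < Re (h z)}"
  have LR: "?L = k ` (ball 0 1 \<inter> {z. Re z < 0})" "?R = k ` (ball 0 1 \<inter> {z. 0 < Re z})"
    using hom unfolding homeomorphism_def by force+
  have "connected (k ` (ball 0 1 \<inter> H))" if "convex H" for H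
    using hom that unfolding homeomorphism_def
    by (intro connected_continuous_image convex_connected) (auto intro: continuous_on_subset convex_Int)
  then have conn: "connected ?L" "connected ?R"
    unfolding LR by (simp_all add: convex_halfspace_Re_lt convex_halfspace_Re_gt)
  have YU: "z \<in> Y \<longleftrightarrow> Re (h z) = 0" if "z \<in> U" for z
  proof
    assume "z \<in> Y" then show "Re (h z) = 0" using hY that by blast
  next
    assume "Re (h z) = 0"
    then have "h z \<in> h ` (Y \<inter> U)" using hU(1)[OF that] hY by simp
    then obtain w where "w \<in> Y" "w \<in> U" "h z = h w" by blast
    then show "z \<in> Y" using injh[OF that] by blast
  qed
  have sides: "A \<subseteq> inside Y \<or> A \<subseteq> outside Y" if "A = ?L \<or> A = ?R" for A
    using connected_side[OF Y(1,2), of A] that conn YU Y(3) by fastforce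
  \<comment> \<open>Each point of a Jordan curve is in the frontier of both sides, so both sides
    occur near \<open>p\<close>. This forces the two halves to lie on different sides.\<close>
  have meet: "\<exists>z\<in>U. z \<in> V \<and> Re (h z) \<noteq> 0" if "V = inside Y \<or> V = outside Y" for V
  proof -
    have "p \<in> closure V" using J pY that by (auto simp: frontier_def)
    then obtain z where "z \<in> V" "z \<in> U" using U by (metis closure_iff_nhds_not_empty disjoint_iff order_refl)
    moreover have "z \<notin> Y" using that J \<open>z \<in> V\<close> inside_no_overlap[of Y] outside_no_overlap[of Y] by blast
    ultimately show ?thesis using YU by blast
  qed
  obtain v w where vw: "v \<in> U" "v \<in> inside Y" "Re (h v) \<noteq> 0" "w \<in> U" "w \<in> outside Y" "Re (h w) \<noteq> 0"
    using meet by metis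
  have LR': "v \<in> ?L \<or> v \<in> ?R" "w \<in> ?L \<or> w \<in> ?R" using vw by auto
  have gen: "v' \<in> I \<longleftrightarrow> w' \<notin> I"
    if "A \<subseteq> I \<or> A \<subseteq> K" "B \<subseteq> I \<or> B \<subseteq> K" "v \<in> A \<or> v \<in> B" "w \<in> A \<or> w \<in> B" "v \<in> I" "w \<in> K" "I \<inter> K = {}"
      "v' \<in> A" "w' \<in> B" for v' w' and A B I K :: "complex set"
    using that by blast
  note opp = gen[OF sides[OF disjI1[OF refl]] sides[OF disjI2[OF refl]] LR' vw(2,5) inside_Int_outside]
  show ?thesis
  proof (rule that[of U "\<lambda>z. Re (h z)"])
    show "continuous_on U (\<lambda>z. Re (h z))"
      using hom unfolding homeomorphism_def by (intro continuous_on_Re) blast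
    show "inj_on (\<lambda>z. Re (h z)) (X \<inter> U)"
    proof (rule inj_onI)
      fix z w assume zw: "z \<in> X \<inter> U" "w \<in> X \<inter> U" "Re (h z) = Re (h w)"
      then have "Im (h z) = 0" "Im (h w) = 0" using hX by blast+
      then show "z = w" using zw injh by (auto simp: complex_eq_iff)
    qed
  qed (use U hp opp in auto)
qed

context crossing_order
begin

text \<open>Near the crossing \<open>\<phi>\<close> is injective on \<open>X\<close>, so along
  \<open>X\<close> it is a continuous injective function of the parameter and therefore strictly
  monotone. It changes sign at the crossing, that is, \<open>X\<close> passes from one local half to
  the other.\<close>

lemma segment_alternates:
  assumes Y: "simple_path y" "pathfinish y = pathstart y" "path_image y = Y"
    and tr: "transversal_crossing X Y (crossing (Suc k))" and k: "Suc k < N"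
  shows "segment (Suc k) \<subseteq> inside Y \<longleftrightarrow> \<not> segment k \<subseteq> inside Y"
proof -
  let ?p = "crossing (Suc k)" and ?s = "t (Suc k)"
  have pY: "?p \<in> Y" "?p \<in> X" using crossing_image k by blast+
  obtain U \<phi> where U: "open U" "?p \<in> U" "continuous_on U \<phi>" "\<phi> ?p = (0::real)" "inj_on \<phi> (X \<inter> U)"
    and opp: "\<And>v w. \<lbrakk>v \<in> U; w \<in> U; \<phi> v < 0; 0 < \<phi> w\<rbrakk> \<Longrightarrow> v \<in> inside Y \<longleftrightarrow> w \<notin> inside Y"
    using transversal_crossing_sides[OF Y tr pY(1)] by metis
  have s: "t k < ?s" "?s < t (Suc (Suc k))" "0 \<le> t k" "t (Suc (Suc k)) \<le> 1"
    using t_step k t_bounds[of k] t_bounds[of "Suc (Suc k)"] by auto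
  have "continuous (at ?s within {0..1}) g" using cont s by (simp add: continuous_on_eq_continuous_within)
  then obtain d where d: "0 < d" "\<And>x. \<lbrakk>x \<in> {0..1}; dist x ?s < d\<rbrakk> \<Longrightarrow> g x \<in> U"
    using U(1,2) unfolding continuous_within_topological crossing_def
    by (metis (no_types, lifting) UNIV_I cont continuous_on_topological eventually_at
        open_dist openE mem_ball dist_commute subsetD)
  obtain e where "0 < e" "e < min d (min (?s - t k) (t (Suc (Suc k)) - ?s))"
    using dense[of 0 "min d (min (?s - t k) (t (Suc (Suc k)) - ?s))"] d(1) s by auto
  then have e: "0 < e" "e < d" "e < ?s - t k" "e < t (Suc (Suc k)) - ?s" by auto
  have IU: "g x \<in> U" "x \<in> {0<..<1}" if "x \<in> {?s - e..?s + e}" for x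
    using that d(2)[of x] e s by (auto simp: dist_real_def)
  let ?I = "{?s - e..?s + e}"
  have I01: "?I \<subseteq> {0..1}" and gI: "g ` ?I \<subseteq> U" using IU by force+
  have gX: "g ` ?I \<subseteq> X \<inter> U" using I01 gI g(3) by (auto simp: path_image_def)
  have "inj_on g ?I"
  proof (rule inj_onI)
    fix x x' assume "x \<in> ?I" "x' \<in> ?I" "g x = g x'"
    then show "x = x'" using simple_path_eqD[OF g(1), of x x'] IU(2)[of x] IU(2)[of x'] by auto
  qed
  then have "inj_on (\<phi> \<circ> g) ?I" by (rule comp_inj_on[OF _ inj_on_subset[OF U(5) gX]])
  moreover have "continuous_on ?I (\<phi> \<circ> g)"
    by (rule continuous_on_compose[OF continuous_on_subset[OF cont I01] continuous_on_subset[OF U(3) gI]])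
  ultimately have mono: "\<phi> (g (?s - e)) < \<phi> (g ?s) \<and> \<phi> (g ?s) < \<phi> (g (?s + e)) \<or>
      \<phi> (g (?s + e)) < \<phi> (g ?s) \<and> \<phi> (g ?s) < \<phi> (g (?s - e))"
    using continuous_inj_imp_mono[of "?s - e" ?s "?s + e" "\<phi> \<circ> g"] e by auto
  have v: "g (?s - e) \<in> segment k" "g (?s + e) \<in> segment (Suc k)"
    using e by (auto simp: segment_def)
  have w: "g (?s - e) \<in> U" "g (?s + e) \<in> U" using IU e by auto
  have "g (?s - e) \<in> inside Y \<longleftrightarrow> g (?s + e) \<notin> inside Y"
    using mono opp[OF w] opp[OF w(2,1)] U(4) by (auto simp: crossing_def)
  moreover have "segment l \<subseteq> inside Y \<longleftrightarrow> z \<in> inside Y" if "l < N" "z \<in> segment l" for l z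
    using connected_side[OF Y(1,2) connected_segment[OF that(1)]] segment_sub[OF that(1)] that(2)
      Jordan_inside_outside[OF Y(1,2)] Y(3) by blast
  ultimately show ?thesis using v k by (metis Suc_lessD)
qed

end

section \<open>The matchings of a pair of Jordan curves\<close>

text \<open>A quarter turn of the local chart interchanges the coordinate axes.\<close>

lemma transversal_crossing_commute:
  assumes "transversal_crossing X Y p"
  shows "transversal_crossing Y X p"
proof -
  obtain U h k where U: "open U" "p \<in> U" and hom: "homeomorphism U (ball 0 1) h k" and hp: "h p = 0"
    and hX: "h ` (X \<inter> U) = {z \<in> ball 0 1. Im z = 0}" and hY: "h ` (Y \<inter> U) = {z \<in> ball 0 1. Re z = 0}"
    using assms unfolding transversal_crossing_def by blast
  have rot: "homeomorphism (ball 0 1) (ball 0 1) (\<lambda>z. \<i> * z) (\<lambda>z. - \<i> * z)"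
  proof
    show "(\<lambda>z. \<i> * z) ` ball 0 1 \<subseteq> ball 0 1" "(\<lambda>z. - \<i> * z) ` ball 0 1 \<subseteq> ball 0 1"
      by (auto simp: norm_mult)
  qed (auto intro!: continuous_intros simp: algebra_simps)
  have "homeomorphism U (ball 0 1) ((\<lambda>z. \<i> * z) \<circ> h) (k \<circ> (\<lambda>z. - \<i> * z))"
    by (rule homeomorphism_compose[OF hom rot])
  moreover have "((\<lambda>z. \<i> * z) \<circ> h) ` (Y \<inter> U) = {z \<in> ball 0 1. Im z = 0}"
  proof -
    have "((\<lambda>z. \<i> * z) \<circ> h) ` (Y \<inter> U) = (\<lambda>z. \<i> * z) ` {z \<in> ball 0 1. Re z = 0}"
      by (simp only: image_comp[symmetric] hY)
    also have "\<dots> = {z \<in> ball 0 1. Im z = 0}"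
    proof
      show "{z \<in> ball 0 1. Im z = 0} \<subseteq> (\<lambda>z. \<i> * z) ` {z \<in> ball 0 1. Re z = 0}"
        by (rule subsetI, rule_tac x = "- \<i> * x" in image_eqI) (auto simp: norm_mult)
    qed (auto simp: norm_mult)
    finally show ?thesis .
  qed
  moreover have "((\<lambda>z. \<i> * z) \<circ> h) ` (X \<inter> U) = {z \<in> ball 0 1. Re z = 0}"
  proof -
    have "((\<lambda>z. \<i> * z) \<circ> h) ` (X \<inter> U) = (\<lambda>z. \<i> * z) ` {z \<in> ball 0 1. Im z = 0}"
      by (simp only: image_comp[symmetric] hX)
    also have "\<dots> = {z \<in> ball 0 1. Re z = 0}"
    proof
      show "{z \<in> ball 0 1. Re z = 0} \<subseteq> (\<lambda>z. \<i> * z) ` {z \<in> ball 0 1. Im z = 0}"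
        by (rule subsetI, rule_tac x = "- \<i> * x" in image_eqI) (auto simp: norm_mult)
    qed (auto simp: norm_mult)
    finally show ?thesis .
  qed
  ultimately show ?thesis
    unfolding transversal_crossing_def using U hp
    by (intro exI[of _ U] exI[of _ "(\<lambda>z. \<i> * z) \<circ> h"] exI[of _ "k \<circ> (\<lambda>z. - \<i> * z)"]) simp
qed

text \<open>The same crossings are numbered twice, by \<open>A\<close> in their order along
  \<open>X\<close> and by \<open>B\<close> in their order along \<open>Y\<close>. The two orders are
  independent and are translated by \<open>to_A\<close> and \<open>to_B\<close>.\<close>

locale crossing_pair =
  A: crossing_order X Y N g t + B: crossing_order Y X N g' t'
  for X Y :: "complex set" and N g t g' t' +
  assumes even_N: "even N"
    and transversal: "\<And>p. p \<in> X \<inter> Y \<Longrightarrow> transversal_crossing X Y p"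
begin

lemma segment_side:
  "q < N \<Longrightarrow> B.segment q \<subseteq> inside X \<longleftrightarrow> (even q \<longleftrightarrow> B.segment 0 \<subseteq> inside X)"
proof (induction q)
  case (Suc q)
  have "B.crossing (Suc q) \<in> X \<inter> Y" using B.crossing_image Suc.prems by blast
  then have "transversal_crossing Y X (B.crossing (Suc q))"
    by (rule transversal_crossing_commute[OF transversal])
  then have "B.segment (Suc q) \<subseteq> inside X \<longleftrightarrow> \<not> B.segment q \<subseteq> inside X"
    using B.segment_alternates[OF A.g] Suc.prems by blast
  moreover have "B.segment q \<subseteq> inside X \<longleftrightarrow> (even q \<longleftrightarrow> B.segment 0 \<subseteq> inside X)"
    using Suc by simp
  ultimately show ?case unfolding even_Suc by argo
qed simp

lemma segment_outside:
  assumes "q < N" "\<not> B.segment q \<subseteq> inside X"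
  shows "B.segment q \<subseteq> outside X"
  using connected_side[OF A.g(1,2) B.connected_segment] B.segment_sub assms A.g(3) by blast

text \<open>Of the two segments of \<open>Y\<close> at crossing \<open>q\<close>, one has an even
  index (\<open>e = True\<close>) and one an odd index; \<open>mate\<close> gives its other end and
  \<open>base\<close> its index. Adding \<open>N - 1\<close> modulo \<open>N\<close> is the cyclic
  predecessor, where subtraction would be truncated at 0.\<close>

definition mate :: "bool \<Rightarrow> nat \<Rightarrow> nat" where
  "mate e q = (if even q = e then Suc q mod N else (q + (N - 1)) mod N)"

definition base :: "bool \<Rightarrow> nat \<Rightarrow> nat" where
  "base e q = (if even q = e then q else (q + (N - 1)) mod N)"

lemma N2: "2 \<le> N"
  using A.N_pos even_N by (cases N; cases "N - 1") auto

lemma mate_pred: "0 < q \<Longrightarrow> q < N \<Longrightarrow> (q + (N - 1)) mod N = q - 1" "(N - 1) mod N = N - 1"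
proof -
  assume "0 < q" "q < N"
  then have "q + (N - 1) = (q - 1) + N" by auto
  then have "(q + (N - 1)) mod N = (q - 1) mod N" by (simp only: mod_add_self2)
  also have "\<dots> = q - 1" using \<open>q < N\<close> by (intro mod_less) simp
  finally show "(q + (N - 1)) mod N = q - 1" .
qed (use A.N_pos in simp)

lemma mate:
  assumes "q < N"
  shows "mate e q < N" "even (mate e q) \<longleftrightarrow> odd q" "mate e (mate e q) = q" "mate e q \<noteq> q"
    "base e q < N" "even (base e q) = e" "{q, mate e q} = {base e q, Suc (base e q) mod N}"
proof -
  have "mate e q < N \<and> (even (mate e q) \<longleftrightarrow> odd q) \<and> mate e (mate e q) = q \<and> mate e q \<noteq> q \<and>
    base e q < N \<and> even (base e q) = e \<and> {q, mate e q} = {base e q, Suc (base e q) mod N}"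
  proof (cases "even q = e")
    case True
    show ?thesis
    proof (cases "Suc q = N")
      case False
      then have "Suc q < N" using assms by simp
      then show ?thesis using True mate_pred(1)[of "Suc q"] by (auto simp: mate_def base_def)
    next
      case last: True
      then have "odd q" using even_N by (metis even_Suc)
      then show ?thesis
        using True last mate_pred(2) even_N N2 by (auto simp: mate_def base_def)
    qed
  next
    case False
    show ?thesis
    proof (cases "q = 0")
      case zero: True
      have "Suc (N - 1) = N" "odd (N - 1)" using N2 even_N by auto
      then show ?thesis
        using False zero mate_pred(2) N2 by (auto simp: mate_def base_def)
    next
      case pos: False
      then have "(q + (N - 1)) mod N = q - 1" "Suc (q - 1) = q" "even (q - 1) \<longleftrightarrow> odd q"
        using mate_pred(1)[of q] assms by auto
      then show ?thesis using False assms by (auto simp: mate_def base_def)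
    qed
  qed
  then show "mate e q < N" "even (mate e q) \<longleftrightarrow> odd q" "mate e (mate e q) = q" "mate e q \<noteq> q"
    "base e q < N" "even (base e q) = e" "{q, mate e q} = {base e q, Suc (base e q) mod N}" by blast+
qed

definition to_B :: "nat \<Rightarrow> nat" where
  "to_B k = inv_into {..<N} B.crossing (A.crossing k)"

definition to_A :: "nat \<Rightarrow> nat" where
  "to_A q = inv_into {..<N} A.crossing (B.crossing q)"

lemma to_B: "k < N \<Longrightarrow> to_B k < N" "k < N \<Longrightarrow> B.crossing (to_B k) = A.crossing k"
proof -
  assume "k < N"
  then have *: "A.crossing k \<in> B.crossing ` {..<N}" using A.crossing_image B.crossing_image by blast
  show "to_B k < N" "B.crossing (to_B k) = A.crossing k"
    unfolding to_B_def using inv_into_into[OF *] f_inv_into_f[OF *] by simp_all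
qed

lemma to_A: "q < N \<Longrightarrow> to_A q < N" "q < N \<Longrightarrow> A.crossing (to_A q) = B.crossing q"
proof -
  assume "q < N"
  then have *: "B.crossing q \<in> A.crossing ` {..<N}" using A.crossing_image B.crossing_image by blast
  show "to_A q < N" "A.crossing (to_A q) = B.crossing q"
    unfolding to_A_def using inv_into_into[OF *] f_inv_into_f[OF *] by simp_all
qed

lemma A_inj: "k < N \<Longrightarrow> l < N \<Longrightarrow> A.crossing k = A.crossing l \<longleftrightarrow> k = l"
  using A.inj_crossing by (auto simp: inj_on_def)

lemma B_inj: "k < N \<Longrightarrow> l < N \<Longrightarrow> B.crossing k = B.crossing l \<longleftrightarrow> k = l"
  using B.inj_crossing by (auto simp: inj_on_def)

lemma to_B_to_A: "q < N \<Longrightarrow> to_B (to_A q) = q"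
  using to_B[of "to_A q"] to_A[of q] B_inj by metis

lemma to_A_to_B: "k < N \<Longrightarrow> to_A (to_B k) = k"
  using to_A[of "to_B k"] to_B[of k] A_inj by metis

text \<open>The segments of \<open>Y\<close> of one parity all lie on one side of \<open>X\<close>.
  They are taken as chords of \<open>X\<close>, with their ends renumbered along
  \<open>X\<close>.\<close>

definition matching :: "bool \<Rightarrow> nat \<Rightarrow> nat" where
  "matching e k = to_A (mate e (to_B k))"

lemma matching:
  assumes "k < N"
  shows "matching e k < N" "matching e k \<noteq> k" "matching e (matching e k) = k"
    "A.crossing (matching e k) = B.crossing (mate e (to_B k))"
proof -
  note b = to_B(1)[OF assms]
  note m = mate[OF b, of e]
  show "matching e k < N" using to_A(1)[OF m(1)] by (simp add: matching_def)
  show "A.crossing (matching e k) = B.crossing (mate e (to_B k))"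
    using to_A(2)[OF m(1)] by (simp add: matching_def)
  show "matching e (matching e k) = k"
    using to_B_to_A[OF m(1)] m(3) to_A_to_B[OF assms] by (simp add: matching_def)
  show "matching e k \<noteq> k"
    using to_B_to_A[OF m(1)] m(4) by (auto simp: matching_def)
qed

lemma matching_ends:
  "k < N \<Longrightarrow> {A.crossing k, A.crossing (matching e k)} =
    {B.crossing (base e (to_B k)), B.crossing (Suc (base e (to_B k)) mod N)}"
proof -
  assume k: "k < N"
  have "B.crossing ` {to_B k, mate e (to_B k)} = B.crossing ` {base e (to_B k), Suc (base e (to_B k)) mod N}"
    using mate(7)[OF to_B(1)[OF k], of e] by simp
  then show ?thesis using matching(4)[OF k] to_B(2)[OF k] by simp
qed

lemma matching_iff:
  "(\<exists>q<N. even q = e \<and> {u, v} = {B.crossing q, B.crossing (Suc q mod N)}) \<longleftrightarrow>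
   (\<exists>k<N. u = A.crossing k \<and> v = A.crossing (matching e k))"
proof
  assume "\<exists>q<N. even q = e \<and> {u, v} = {B.crossing q, B.crossing (Suc q mod N)}"
  then obtain q where q: "q < N" "even q = e" "{u, v} = {B.crossing q, B.crossing (Suc q mod N)}" by blast
  have m: "mate e q = Suc q mod N" using q(2) by (simp add: mate_def)
  note M = mate[OF q(1), of e]
  have A1: "A.crossing (matching e (to_A q)) = B.crossing (mate e q)"
    using matching(4)[OF to_A(1)[OF q(1)], of e] to_B_to_A[OF q(1)] by simp
  have A2: "A.crossing (matching e (to_A (mate e q))) = B.crossing q"
    using matching(4)[OF to_A(1)[OF M(1)], of e] to_B_to_A[OF M(1)] M(3) by simp
  have "u = B.crossing q \<and> v = B.crossing (mate e q) \<or> u = B.crossing (mate e q) \<and> v = B.crossing q"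
    using q(3) unfolding m by (auto simp: doubleton_eq_iff)
  then show "\<exists>k<N. u = A.crossing k \<and> v = A.crossing (matching e k)"
    using A1 A2 to_A[OF q(1)] to_A[OF M(1)] by metis
next
  assume "\<exists>k<N. u = A.crossing k \<and> v = A.crossing (matching e k)"
  then obtain k where k: "k < N" "u = A.crossing k" "v = A.crossing (matching e k)" by blast
  note M = mate[OF to_B(1)[OF k(1)], of e]
  show "\<exists>q<N. even q = e \<and> {u, v} = {B.crossing q, B.crossing (Suc q mod N)}"
    using M(5,6) matching_ends[OF k(1), of e] k(2,3) by (intro exI[of _ "base e (to_B k)"]) simp
qed

text \<open>Two chords on the same side of \<open>X\<close> are disjoint, so by
  \<open>chord_separates\<close> the ends of the second are not separated on \<open>X\<close> by the
  ends of the first. As \<open>l\<close> lies between the ends of the first chord, so does its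
  partner.\<close>

lemma matching_between:
  assumes kl: "k < l" "l < matching e k" "matching e k < N"
  shows "k < matching e l" "matching e l < matching e k"
proof -
  have kN: "k < N" "l < N" using kl by auto
  note mk = matching[OF kN(1), of e] and ml = matching[OF kN(2), of e]
  define r where "r = base e (to_B k)"
  define r' where "r' = base e (to_B l)"
  have r: "r < N" "even r = e" and r': "r' < N" "even r' = e"
    unfolding r_def r'_def using mate[OF to_B(1)[OF kN(1)]] mate[OF to_B(1)[OF kN(2)]] by blast+
  let ?a = "B.crossing r" and ?b = "B.crossing (Suc r mod N)"
  have ends: "{A.crossing k, A.crossing (matching e k)} = {?a, ?b}"
    "{A.crossing l, A.crossing (matching e l)} = {B.crossing r', B.crossing (Suc r' mod N)}"
    unfolding r_def r'_def using matching_ends kN by blast+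
  have l: "l \<noteq> k" "l \<noteq> matching e k" "matching e l \<noteq> k" "matching e l \<noteq> matching e k"
    using kl mk ml by auto
  then have not_end: "A.crossing l \<notin> {?a, ?b}" "A.crossing (matching e l) \<notin> {?a, ?b}"
    unfolding ends(1)[symmetric] using A_inj kN mk(1) ml(1) by auto
  then have rr': "r \<noteq> r'" using ends(2) by auto
  have sr: "Suc r mod N < N" "Suc r mod N \<noteq> r" using N2 r(1) by (cases "Suc r = N"; force)+
  define c where "c = subpath (t' r) (t' (Suc r)) g'"
  have tr: "t' r \<in> {0..1}" "t' (Suc r) \<in> {0..1}" "t' r < t' (Suc r)"
    using B.t_bounds[of r] B.t_bounds[of "Suc r"] B.t_step r by auto
  have c: "pathstart c = ?a" "pathfinish c = ?b"
    using B.crossing_succ[OF r(1)] by (simp_all add: c_def B.crossing_def)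
  have ab: "?a \<noteq> ?b" using B_inj r(1) sr by simp
  have sc: "simple_path c"
    unfolding c_def using tr c ab B.g(1) by (intro simple_path_subpath) auto
  have ic: "path_image c = B.segment r \<union> {?a, ?b}"
    unfolding c_def using path_image_subpath[of "t' r" "t' (Suc r)" g'] tr
      B.closure_segment[OF r(1)] B.closure_segment_eq[OF r(1)] by auto
  have abX: "?a \<in> X" "?b \<in> X" using B.crossing_image r(1) sr(1) by blast+
  have segX: "B.segment r \<inter> X = {}" "B.segment r' \<inter> X = {}" using B.segment_sub r(1) r'(1) by blast+
  \<comment> \<open>Equal parity of the indices means the same side of \<open>X\<close>.\<close>
  obtain W where W: "W = inside (path_image g) \<or> W = outside (path_image g)" "B.segment r \<subseteq> W" "B.segment r' \<subseteq> W"
  proof (cases "B.segment r \<subseteq> inside X")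
    case True
    then have "B.segment r' \<subseteq> inside X" using segment_side[OF r(1)] segment_side[OF r'(1)] r(2) r'(2) by simp
    then show ?thesis using True that A.g(3) by blast
  next
    case False
    then have "\<not> B.segment r' \<subseteq> inside X" using segment_side[OF r(1)] segment_side[OF r'(1)] r(2) r'(2) by simp
    then show ?thesis using False segment_outside r(1) r'(1) that A.g(3) by blast
  qed
  have cg: "path_image c \<inter> path_image g = {?a, ?b}" "path_image c - {?a, ?b} \<subseteq> W"
    unfolding ic A.g(3) using abX segX W(2) by auto
  have D: "B.segment r' \<inter> path_image c = {}"
    unfolding ic using B.segment_disjoint[OF r'(1) r(1)] rr' abX segX by auto
  have cl: "A.crossing l \<in> closure (B.segment r')" "A.crossing (matching e l) \<in> closure (B.segment r')"
    unfolding B.closure_segment_eq[OF r'(1)] using ends(2) by auto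
  have X: "A.crossing l \<in> path_image g - {?a, ?b}" "A.crossing (matching e l) \<in> path_image g - {?a, ?b}"
    using not_end A.crossing_image A.g(3) kN ml(1) by auto
  obtain S where S: "connected S" "S \<subseteq> path_image g - {?a, ?b}" "A.crossing l \<in> S" "A.crossing (matching e l) \<in> S"
    by (rule chord_separates[OF A.g(1,2) sc c ab W(1) cg B.connected_segment[OF r'(1)] W(3) D cl(1) X(1) cl(2) X(2)]) blast
  have tt: "t k < t l" "t l < t (matching e k)" using A.t_less kl kN mk by auto
  \<comment> \<open>\<open>S\<close> avoids the ends of the first chord and contains the crossing
    \<open>l\<close> of the open arc between them, so it cannot leave this arc.\<close>
  have "S \<subseteq> g ` {t k<..<t (matching e k)}"
  proof (rule connected_within_open_arc[OF A.g(1)])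
    show "S \<subseteq> path_image g - {g (t k), g (t (matching e k))}"
      using S(2) ends(1) by (simp add: A.crossing_def)
    show "S \<inter> g ` {t k<..<t (matching e k)} \<noteq> {}"
      using S(3) tt by (auto simp: A.crossing_def)
  qed (use A.t_bounds[of k] A.t_bounds[of "matching e k"] kN mk tt S(1) in auto)
  then obtain x where x: "x \<in> {t k<..<t (matching e k)}" "g (t (matching e l)) = g x"
    using S(4) by (auto simp: A.crossing_def)
  \<comment> \<open>Excludes the ambiguity of the base point, which has the parameters 0 and
    1.\<close>
  have "t (matching e l) < 1" using A.t_less[of "matching e l" N] ml(1) A.tN by simp
  moreover have "x \<in> {0<..<1}" using x A.t_bounds[of k] A.t_bounds[of "matching e k"] kN mk by auto
  ultimately have "t (matching e l) = x"
    using simple_path_eqD[OF A.g(1) x(2)] A.t_bounds[of "matching e l"] ml(1) by auto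
  then show "k < matching e l" "matching e l < matching e k"
    using x(1) A.t_less_iff kN mk(1) ml(1) by auto
qed

lemma noncrossing_matching: "noncrossing_matching (matching e) 0 N"
  unfolding noncrossing_matching_def using matching matching_between by auto

lemma gem_cycle_crossing:
  assumes "verts G = X \<inter> Y" "distinct [a, b, c, d]" "{a, b, c, d} = {..3}"
    and "\<And>e. e \<in> edges G \<Longrightarrow> color G e \<le> 3"
    and "\<And>u v. joined G a u v \<longleftrightarrow> (\<exists>q<N. even q \<and> {u, v} = {B.crossing q, B.crossing (Suc q mod N)})"
    and "\<And>u v. joined G b u v \<longleftrightarrow> (\<exists>q<N. odd q \<and> {u, v} = {B.crossing q, B.crossing (Suc q mod N)})"
    and "\<And>u v. joined G c u v \<longleftrightarrow> (\<exists>k<N. even k \<and> {u, v} = {A.crossing k, A.crossing (Suc k mod N)})"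
    and "\<And>u v. joined G d u v \<longleftrightarrow> (\<exists>k<N. odd k \<and> {u, v} = {A.crossing k, A.crossing (Suc k mod N)})"
  shows "gem_cycle G N A.crossing a b c d (matching True) (matching False)"
proof
  show "bij_betw A.crossing {..<N} (verts G)" using A.bij_crossing assms(1) by simp
  show "joined G a u v \<longleftrightarrow> (\<exists>k<N. u = A.crossing k \<and> v = A.crossing (matching True k))" for u v
    using assms(5) matching_iff[of True] by simp
  show "joined G b u v \<longleftrightarrow> (\<exists>k<N. u = A.crossing k \<and> v = A.crossing (matching False k))" for u v
    using assms(6) matching_iff[of False] by simp
qed (fact A.N_pos even_N noncrossing_matching assms)+

end

theorem proposition1p1:
  fixes X Y :: "complex set" and n :: nat
  assumes "n \<ge> 1"
    and "Jordan_curve X" and "Jordan_curve Y"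
    and "card (X \<inter> Y) = 2 * n"
    and "\<And>p. p \<in> X \<inter> Y \<Longrightarrow> transversal_crossing X Y p"
  shows "induced_space (J2_gem X Y) homeomorphic_space nsphere 3"
proof -
  have card: "card (X \<inter> Y) = 2 * n" "card (Y \<inter> X) = 2 * n" "0 < 2 * n"
    using assms by (auto simp: Int_commute)
  obtain g t where "crossing_order X Y (2 * n) g t" using crossing_order_exists[OF assms(2) card(1,3)] by blast
  then interpret A: crossing_order X Y "2 * n" g t .
  obtain g' t' where "crossing_order Y X (2 * n) g' t'" using crossing_order_exists[OF assms(3) card(2,3)] by blast
  then interpret B: crossing_order Y X "2 * n" g' t' .
  interpret AB: crossing_pair X Y "2 * n" g t g' t' by unfold_locales (use assms(5) in auto)
  interpret BA: crossing_pair Y X "2 * n" g' t' g t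
    by unfold_locales (use transversal_crossing_commute[OF assms(5)] in auto)
  let ?G = "J2_gem X Y"
  \<comment> \<open>\<open>a\<close> and \<open>c\<close> are the colours of the segments with even
    index, which depend on the side where segment 0 of the curve happens to lie;
    \<open>1 - a\<close> and \<open>5 - c\<close> are the other colours of the pairs 0, 1 and 2,
    3.\<close>
  define a b where "a = (if B.segment 0 \<subseteq> inside X then 0 else 1 :: nat)" and "b = 1 - a"
  define c d where "c = (if A.segment 0 \<subseteq> inside Y then 2 else 3 :: nat)" and "d = 5 - c"
  have abcd: "(a = 0 \<and> b = 1 \<or> a = 1 \<and> b = 0) \<and> (c = 2 \<and> d = 3 \<or> c = 3 \<and> d = 2)"
    by (auto simp: a_def b_def c_def d_def)
  have colA: "color ?G (A.segment k) = (if even k then c else d)" if "k < 2 * n" for k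
  proof -
    have "\<not> A.segment k \<subseteq> Y" using A.segment_sub[OF that] A.segment_nonempty[OF that] by blast
    then show ?thesis using BA.segment_side[OF that] by (auto simp: J2_gem_def c_def d_def)
  qed
  have colB: "color ?G (B.segment q) = (if even q then a else b)" if "q < 2 * n" for q
  proof -
    have "B.segment q \<subseteq> Y" using B.segment_sub[OF that] by blast
    then show ?thesis using AB.segment_side[OF that] by (auto simp: J2_gem_def a_def b_def)
  qed
  have edges: "edges ?G = A.segment ` {..<2 * n} \<union> B.segment ` {..<2 * n}"
    using A.components_eq B.components_eq by (simp add: J2_gem_def)
  have ends: "ends ?G (A.segment k) = {A.crossing k, A.crossing (Suc k mod (2 * n))}"
    "ends ?G (B.segment k) = {B.crossing k, B.crossing (Suc k mod (2 * n))}" if "k < 2 * n" for k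
    using A.segment_ends[OF that] B.segment_ends[OF that] by (simp_all add: J2_gem_def Int_commute)
  have joined: "joined ?G i u v \<longleftrightarrow>
      (\<exists>k<2 * n. (if even k then c else d) = i \<and> {u, v} = {A.crossing k, A.crossing (Suc k mod (2 * n))}) \<or>
      (\<exists>q<2 * n. (if even q then a else b) = i \<and> {u, v} = {B.crossing q, B.crossing (Suc q mod (2 * n))})" for i u v
    unfolding joined_def edges bex_Un bex_simps(7)
    using colA colB ends by (auto simp: eq_commute[of "{u, v}"])
  have V: "verts ?G = X \<inter> Y" by (simp add: J2_gem_def)
  have col: "color ?G e \<le> 3" for e by (simp add: J2_gem_def)
  have three: "{..3} = {0, 1, 2, 3 :: nat}" by auto
  have ne: "a \<noteq> b" "c \<noteq> d" "a \<noteq> c" "a \<noteq> d" "b \<noteq> c" "b \<noteq> d" using abcd by auto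
  have cd: "(if even k then c else d) = c \<longleftrightarrow> even k" "(if even k then c else d) = d \<longleftrightarrow> odd k"
    "(if even k then c else d) = a \<longleftrightarrow> False" "(if even k then c else d) = b \<longleftrightarrow> False" for k
    using ne by auto
  have ab: "(if even k then a else b) = a \<longleftrightarrow> even k" "(if even k then a else b) = b \<longleftrightarrow> odd k"
    "(if even k then a else b) = c \<longleftrightarrow> False" "(if even k then a else b) = d \<longleftrightarrow> False" for k
    using ne by auto
  have J: "joined ?G a u v \<longleftrightarrow> (\<exists>q<2 * n. even q \<and> {u, v} = {B.crossing q, B.crossing (Suc q mod (2 * n))})"
    "joined ?G b u v \<longleftrightarrow> (\<exists>q<2 * n. odd q \<and> {u, v} = {B.crossing q, B.crossing (Suc q mod (2 * n))})"
    "joined ?G c u v \<longleftrightarrow> (\<exists>k<2 * n. even k \<and> {u, v} = {A.crossing k, A.crossing (Suc k mod (2 * n))})"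
    "joined ?G d u v \<longleftrightarrow> (\<exists>k<2 * n. odd k \<and> {u, v} = {A.crossing k, A.crossing (Suc k mod (2 * n))})" for u v
    unfolding joined ab cd by simp_all
  have dist: "distinct [a, b, c, d]" "{a, b, c, d} = {..3}" "distinct [c, d, a, b]" "{c, d, a, b} = {..3}"
    using abcd ne three by auto
  have V': "verts ?G = Y \<inter> X" using V by (simp add: Int_commute)
  note C = AB.gem_cycle_crossing[OF V dist(1,2) col J]
  note D = BA.gem_cycle_crossing[OF V' dist(3,4) col J(3,4,1,2)]
  show ?thesis by (rule induced_space_sphere[OF C D refl])
qed

end
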